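(* Assume that $\mathcal I$ is $\kappa$-uniformly convex for some $\kappa>0$, that $\mathcal I(t,\cdot)\in C^{2,1}_{loc}(\mathcal Z;\mathbb R)$, that there is $\delta\in(0,\kappa]$ with $|\ell|_{Lip}\le \kappa-\delta$, and that $\ell\in W^{1,\infty}([0,T];\mathcal V^* )$ with $\ell'\in BV([0,T];\mathcal V^* )$. Then the sequence $\{z_\tau\}_{\tau>0}$ of retransformed discrete parameterized solutions converges, as $\tau\searrow 0$, to the unique differential solution $z$ of the rate-independent system (exactly one differential solution exists), and there is a constant $K=K(\alpha,\kappa,\ell,z_0,T,\mathcal F,\|A\|_{\mathcal L(\mathcal Z,\mathcal Z^* )})>0$, independent of $\tau$, such that $$\|z_\tau(t)-z(t)\|_{\mathcal Z}\le K\,\tau\qquad\text{for all } t\in[0,T].$$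
   Context: Setting. Let $T>0$. $\mathcal X$ is a Banach space and $\mathcal Z,\mathcal V$ are Hilbert spaces (all real) with $\mathcal Z\hookrightarrow\mathcal V$ densely and compactly and $\mathcal V\hookrightarrow\mathcal X$ continuously; the embedding constant of $\mathcal Z\hookrightarrow\mathcal V$ is normalized to $1$, i.e. $\|v\|_{\mathcal V}\le\|v\|_{\mathcal Z}$. Energy: $\mathcal I:[0,T]\times\mathcal Z\to\mathbb R$, $\mathcal I(t,z)=\frac12\langle Az,z\rangle_{\mathcal Z^*,\mathcal Z}+\mathcal F(z)-\langle \ell(t),z\rangle_{\mathcal V^*,\mathcal V}$, where $A\in\mathcal L(\mathcal Z,\mathcal Z^* )$ is self-adjoint with $\langle Az,z\rangle\ge\alpha\|z\|_{\mathcal Z}^2$ for some $\alpha>0$; $\ell\in C^{0,1}([0,T];\mathcal V^* )$ with Lipschitz constant $|\ell|_{Lip}$; $\mathcal F\in C^2(\mathcal Z;\mathbb R)$, $\mathcal F\ge0$, $D_z\mathcal F\in C^1(\mathcal Z,\mathcal V^* )$ and $\|D_z^2\mathcal F(z)v\|_{\mathcal V^*}\le C_{\mathcal F}(1+\|z\|_{\mathcal Z}^q)\|v\|_{\mathcal Z}$ for some $q\ge1$. $\mathcal I(t,\cdot)\in C^{2,1}_{loc}(\mathcal Z;\mathbb R)$ means: for every $r>0$ there is $C(r)\ge0$ with $\langle[D_z^2\mathcal I(t,z_1)-D_z^2\mathcal I(t,z_2)]v,v\rangle_{\mathcal Z^*,\mathcal Z}\le C(r)\|z_1-z_2\|_{\mathcal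 Z}\|v\|_{\mathcal Z}^2$ for all $z_1,z_2\in B_{\mathcal Z}(0,r)$, $v\in\mathcal Z$. $\kappa$-uniform convexity: $\langle D_z^2\mathcal I(t,z)v,v\rangle_{\mathcal Z^*,\mathcal Z}\ge\kappa\|v\|_{\mathcal Z}^2$ for all $t\in[0,T]$, $z,v\in\mathcal Z$. Dissipation: $\mathcal R:\mathcal V\to[0,\infty)$ is lower semicontinuous, convex, positively homogeneous of degree one, and there are $\underline\rho,\overline\rho>0$ with $\underline\rho\|v\|_{\mathcal X}\le\mathcal R(v)\le\overline\rho\|v\|_{\mathcal V}$ for all $v\in\mathcal V$. For $w\in\mathcal Z$, $\xi\in\mathcal Z^*$, the inclusion $0\in\partial\mathcal R(w)+\xi$ means $\mathcal R(v)\ge\mathcal R(w)-\langle\xi,v-w\rangle_{\mathcal Z^*,\mathcal Z}$ for all $v\in\mathcal Z$ (equivalently, by density, $-\xi$ extends to an element of the subdifferential of $\mathcal R$ at $w$ in $\mathcal V^*$). Initial state: $z_0\in\mathcal Z$ with $0\in\partial\mathcal R(0)+D_z\mathcal I(0,z_0)$. Differential solution: $z\in W^{1,1}(0,T;\mathcal Z)$ with $z(0)=z_0$ and $0\in\partial\mathcal R(z'(t))+D_z\mathcal I(t,z(t))$ for almost all $t\in[0,T]$. Local incremental minimization scheme: for $\tau>0$ put $t_0=0$ and, for $k\ge1$, let $z_k\in\arg\min\{\mathcal I(t_{k-1},z)+\mathcal R(z-z_{k-1}):z\in\mathcal Z,\ \|z-z_{k-1}\|_{\mathcal V}\le\tau\}$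 (an arbitrary minimizer) and $t_k=\min\{t_{k-1}+\tau-\|z_k-z_{k-1}\|_{\mathcal V},T\}$. The iterates depend on $\tau$. $N(\tau)$ is the number of iterations needed to reach $T$, i.e. the smallest index with $t_{N(\tau)}=T$ (it is finite). Retransformed discrete parameterized solution $z_\tau:[0,T]\to\mathcal Z$: the affine interpolant of the iterates in physical time, $z_\tau(t)=z_{k-1}+\frac{t-t_{k-1}}{t_k-t_{k-1}}(z_k-z_{k-1})$ for $t\in[t_{k-1},t_k)$, $1\le k\le N(\tau)$, and $z_\tau(T)=z_{N(\tau)}$. (Under the hypotheses of the claim $t_0<t_1<\dots<t_{N(\tau)}=T$.) *)

theory Defs
  imports "HOL-Analysis.Analysis"
begin

text \<open>
  The spaces Z, V, X are types, and the embeddings between them are explicit bounded linear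
  injections \<open>\<iota> :: 'z \<Rightarrow>\<^sub>L 'v\<close> and \<open>j :: 'v \<Rightarrow>\<^sub>L 'x\<close>. The duals of Z and V are
  \<open>'z \<Rightarrow>\<^sub>L real\<close> and \<open>'v \<Rightarrow>\<^sub>L real\<close>; the embedding of the dual of V into the dual of Z is
  \<open>\<lambda>\<xi>. \<xi> o\<^sub>L \<iota>\<close>.
\<close>

definition continuous_embedding :: "('a::real_normed_vector \<Rightarrow>\<^sub>L 'b::real_normed_vector) \<Rightarrow> bool" where
  "continuous_embedding j \<longleftrightarrow> inj (blinfun_apply j)"

definition dense_compact_embedding :: "('a::real_normed_vector \<Rightarrow>\<^sub>L 'b::real_normed_vector) \<Rightarrow> bool" where
  "dense_compact_embedding j \<longleftrightarrow>
     continuous_embedding j \<and>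
     closure (range (blinfun_apply j)) = UNIV \<and>
     compact (closure (blinfun_apply j ` cball 0 1))"

definition Deriv :: "('a::real_normed_vector \<Rightarrow> 'b::real_normed_vector) \<Rightarrow> 'a \<Rightarrow> ('a \<Rightarrow>\<^sub>L 'b)" where
  "Deriv f x = Blinfun (frechet_derivative f (at x))"

definition C1 :: "('a::real_normed_vector \<Rightarrow> 'b::real_normed_vector) \<Rightarrow> bool" where
  "C1 f \<longleftrightarrow> (\<forall>x. f differentiable (at x)) \<and> continuous_on UNIV (Deriv f)"

definition C2 :: "('a::real_normed_vector \<Rightarrow> 'b::real_normed_vector) \<Rightarrow> bool" where
  "C2 f \<longleftrightarrow> C1 f \<and> C1 (Deriv f)"

definition C21_loc :: "('z::real_normed_vector \<Rightarrow> real) \<Rightarrow> bool" where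
  "C21_loc f \<longleftrightarrow> C2 f \<and>
     (\<forall>r>0. \<exists>C\<ge>0. \<forall>z1\<in>ball 0 r. \<forall>z2\<in>ball 0 r. \<forall>v.
        (Deriv (Deriv f) z1 - Deriv (Deriv f) z2) v v \<le> C * norm (z1 - z2) * (norm v)\<^sup>2)"

text \<open>
  The function \<open>G\<close> is the derivative of \<open>F\<close> regarded as a map into the dual of V; it is
  unique because the range of \<open>\<iota>\<close> is dense.
\<close>

definition admissible_nonlinearity ::
  "('z::real_normed_vector \<Rightarrow>\<^sub>L 'v::real_normed_vector) \<Rightarrow> ('z \<Rightarrow> real) \<Rightarrow> bool" where
  "admissible_nonlinearity \<iota> F \<longleftrightarrow>
     C2 F \<and> (\<forall>z. F z \<ge> 0) \<and>
     (\<exists>G :: 'z \<Rightarrow> ('v \<Rightarrow>\<^sub>L real).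
        (\<forall>z. Deriv F z = G z o\<^sub>L \<iota>) \<and> C1 G \<and>
        (\<exists>C q. q \<ge> 1 \<and> (\<forall>z v. norm (Deriv G z v) \<le> C * (1 + norm z powr q) * norm v)))"

definition elliptic_operator ::
  "real \<Rightarrow> ('z::real_normed_vector \<Rightarrow>\<^sub>L 'z \<Rightarrow>\<^sub>L real) \<Rightarrow> bool" where
  "elliptic_operator \<alpha> A \<longleftrightarrow>
     (\<forall>u v. A u v = A v u) \<and> (\<forall>z. A z z \<ge> \<alpha> * (norm z)\<^sup>2)"

definition energy ::
  "('z::real_normed_vector \<Rightarrow>\<^sub>L 'v::real_normed_vector) \<Rightarrow> ('z \<Rightarrow>\<^sub>L 'z \<Rightarrow>\<^sub>L real) \<Rightarrow> ('z \<Rightarrow> real)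
    \<Rightarrow> (real \<Rightarrow> ('v \<Rightarrow>\<^sub>L real)) \<Rightarrow> real \<Rightarrow> 'z \<Rightarrow> real" where
  "energy \<iota> A F l t z = 1 / 2 * A z z + F z - l t (\<iota> z)"

definition uniformly_convex_energy ::
  "real \<Rightarrow> real \<Rightarrow> (real \<Rightarrow> 'z::real_normed_vector \<Rightarrow> real) \<Rightarrow> bool" where
  "uniformly_convex_energy T \<kappa> I \<longleftrightarrow>
     (\<forall>t\<in>{0..T}. \<forall>z v. Deriv (Deriv (I t)) z v v \<ge> \<kappa> * (norm v)\<^sup>2)"

definition lower_semicontinuous :: "('a::topological_space \<Rightarrow> real) \<Rightarrow> bool" where
  "lower_semicontinuous f \<longleftrightarrow> (\<forall>x. \<forall>c < f x. \<forall>\<^sub>F y in nhds x. c < f y)"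

definition dissipation_potential ::
  "('v::real_normed_vector \<Rightarrow>\<^sub>L 'x::real_normed_vector) \<Rightarrow> ('v \<Rightarrow> real) \<Rightarrow> bool" where
  "dissipation_potential j R \<longleftrightarrow>
     (\<forall>v. R v \<ge> 0) \<and> lower_semicontinuous R \<and> convex_on UNIV R \<and>
     (\<forall>c>0. \<forall>v. R (c *\<^sub>R v) = c * R v) \<and>
     (\<exists>\<rho>1>0. \<exists>\<rho>2>0. \<forall>v. \<rho>1 * norm (j v) \<le> R v \<and> R v \<le> \<rho>2 * norm v)"

text \<open>The inclusion \<open>0 \<in> \<partial>R(w) + \<xi>\<close> for \<open>w\<close> in Z and \<open>\<xi>\<close> in the dual of Z.\<close>

definition subdiff_inclusion ::
  "('z::real_normed_vector \<Rightarrow>\<^sub>L 'v::real_normed_vector) \<Rightarrow> ('v \<Rightarrow> real) \<Rightarrow> 'z \<Rightarrow> ('z \<Rightarrow>\<^sub>L real) \<Rightarrow> bool" where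
  "subdiff_inclusion \<iota> R w \<xi> \<longleftrightarrow> (\<forall>v. R (\<iota> v) \<ge> R (\<iota> w) - \<xi> (v - w))"

text \<open>
  Bochner integrability is stated in its textbook form, since \<^const>\<open>integrable\<close> requires
  a second countable codomain, which is not available for the dual of V. For Bochner integrable
  functions the Bochner integral coincides with the gauge integral \<^const>\<open>has_integral\<close>.
  A Sobolev function on \<open>(0,T)\<close> is identified with its continuous representative on \<open>[0,T]\<close>,
  and its weak derivative \<open>g\<close> (unique almost everywhere) is determined by
  \<open>f(t) = f(0) + \<integral>\<^sub>0\<^sup>t g\<close>.
\<close>

definition strongly_measurable :: "'a measure \<Rightarrow> ('a \<Rightarrow> 'b::real_normed_vector) \<Rightarrow> bool" where
  "strongly_measurable M f \<longleftrightarrow>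
     (\<exists>s. (\<forall>n::nat. simple_function M (s n)) \<and> (AE x in M. (\<lambda>n. s n x) \<longlonglongrightarrow> f x))"

definition bochner_integrable :: "'a measure \<Rightarrow> ('a \<Rightarrow> 'b::real_normed_vector) \<Rightarrow> bool" where
  "bochner_integrable M f \<longleftrightarrow> strongly_measurable M f \<and> integrable M (\<lambda>x. norm (f x))"

definition has_W11_derivative :: "real \<Rightarrow> (real \<Rightarrow> 'b::real_normed_vector) \<Rightarrow> (real \<Rightarrow> 'b) \<Rightarrow> bool" where
  "has_W11_derivative T f g \<longleftrightarrow>
     bochner_integrable (lebesgue_on {0..T}) g \<and>
     (\<forall>t\<in>{0..T}. (g has_integral (f t - f 0)) {0..t})"

definition has_W1inf_derivative :: "real \<Rightarrow> (real \<Rightarrow> 'b::real_normed_vector) \<Rightarrow> (real \<Rightarrow> 'b) \<Rightarrow> bool" where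
  "has_W1inf_derivative T f g \<longleftrightarrow>
     has_W11_derivative T f g \<and> (\<exists>C. AE t in lebesgue_on {0..T}. norm (g t) \<le> C)"

definition bounded_variation_on :: "real set \<Rightarrow> (real \<Rightarrow> 'b::real_normed_vector) \<Rightarrow> bool" where
  "bounded_variation_on S g \<longleftrightarrow>
     (\<exists>M. \<forall>(n::nat) p. (\<forall>k\<le>n. p k \<in> S) \<and> (\<forall>k<n. p k \<le> p (Suc k)) \<longrightarrow>
        (\<Sum>k<n. norm (g (p (Suc k)) - g (p k))) \<le> M)"

definition lip_seminorm :: "'a::metric_space set \<Rightarrow> ('a \<Rightarrow> 'b::metric_space) \<Rightarrow> real" where
  "lip_seminorm S f = Inf {L. L-lipschitz_on S f}"

definition differential_solution ::
  "real \<Rightarrow> ('z::real_normed_vector \<Rightarrow>\<^sub>L 'v::real_normed_vector) \<Rightarrow> (real \<Rightarrow> 'z \<Rightarrow> real) \<Rightarrow> ('v \<Rightarrow> real)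
    \<Rightarrow> 'z \<Rightarrow> (real \<Rightarrow> 'z) \<Rightarrow> bool" where
  "differential_solution T \<iota> I R z0 z \<longleftrightarrow>
     z 0 = z0 \<and>
     (\<exists>z'. has_W11_derivative T z z' \<and>
        (AE t in lebesgue_on {0..T}. subdiff_inclusion \<iota> R (z' t) (Deriv (I t) (z t))))"

definition local_incremental_scheme ::
  "real \<Rightarrow> ('z::real_normed_vector \<Rightarrow>\<^sub>L 'v::real_normed_vector) \<Rightarrow> (real \<Rightarrow> 'z \<Rightarrow> real) \<Rightarrow> ('v \<Rightarrow> real)
    \<Rightarrow> 'z \<Rightarrow> real \<Rightarrow> (nat \<Rightarrow> 'z) \<Rightarrow> (nat \<Rightarrow> real) \<Rightarrow> bool" where
  "local_incremental_scheme T \<iota> I R z0 \<tau> zs ts \<longleftrightarrow>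
     zs 0 = z0 \<and> ts 0 = 0 \<and>
     (\<forall>k\<ge>1. is_arg_min (\<lambda>z. I (ts (k - 1)) z + R (\<iota> (z - zs (k - 1))))
               (\<lambda>z. norm (\<iota> (z - zs (k - 1))) \<le> \<tau>) (zs k) \<and>
             ts k = min (ts (k - 1) + \<tau> - norm (\<iota> (zs k - zs (k - 1)))) T)"

definition num_steps :: "real \<Rightarrow> (nat \<Rightarrow> real) \<Rightarrow> nat" where
  "num_steps T ts = (LEAST k. ts k = T)"

text \<open>
  Only the values on \<open>[0,T]\<close> are meaningful. For \<open>t < T\<close> the index \<open>k\<close> is the one with
  \<open>t \<in> [t\<^sub>k\<^sub>-\<^sub>1, t\<^sub>k)\<close>.
\<close>

definition retransformed :: "real \<Rightarrow> (nat \<Rightarrow> 'z::real_vector) \<Rightarrow> (nat \<Rightarrow> real) \<Rightarrow> real \<Rightarrow> 'z" where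
  "retransformed T zs ts t =
     (if t = T then zs (num_steps T ts)
      else let k = (THE k. 1 \<le> k \<and> k \<le> num_steps T ts \<and> ts (k - 1) \<le> t \<and> t < ts k)
           in zs (k - 1) + ((t - ts (k - 1)) / (ts k - ts (k - 1))) *\<^sub>R (zs k - zs (k - 1)))"

end

(*
  The increments of the scheme are shorter than tau, so the constraint is never active; shifting the
  index by one turns the scheme into the implicit Euler scheme on a nonuniform grid. Any two curves
  u, w that satisfy stability and energy balance approximately are compared through
  gamma = <DI(u) - DI(w), u - w>, which dominates kappa |u - w|^2: the inclusions make the
  monotone part of its derivative nonpositive and the local Lipschitz bound on the second derivative
  leaves a Gronwall term. For the affine interpolant of the Euler scheme the accumulated defect is
  O(tau^2) rather than O(tau): testing consecutive inclusions against each other yields a telescoping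
  energy of the discrete velocities, and this is where the bounded variation of the derivative of the
  load enters. Comparing Euler schemes with each other gives a Cauchy family whose limit is a
  Lipschitz curve; it solves the inclusion almost everywhere because Hilbert spaces have the
  Radon-Nikodym property. Comparing this limit with an arbitrary differential solution, with its arc
  length as clock, gives uniqueness.
*)
theory Submission
  imports Defs
begin

text \<open>The comparison bounds \<open>\<kappa> * (norm (u - w))\<^sup>2\<close> by the
  accumulated defect, so an error of order tau requires a defect of order tau squared. A cell of
  length h contributes h * q, where q is the failure of the energy balance at its left node. Knowing
  only that q is of order h would give a sum of order tau. Instead h * q is written as h^2 * (q /
  h), and the telescoping energy bounds the sum of q / h on every grid. No lower bound on the step
  sizes enters; this matters because the last step is cut off at T and may be arbitrarily short.
  Strong monotonicity lets a stable state react to a load change e by at most e / \<kappa>. With L <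
  \<kappa> an increment is therefore at most (L / \<kappa>) * tau, and a step that does not reach T
  advances the time by at least (1 - L / \<kappa>) * tau. Limits are taken in a derivative-free
  formulation (stability at every time, energy inequality with an error quadratic in elapsed time),
  which survives pointwise convergence; derivatives return only for the limit curve.\<close>

section \<open>Calculus and integration of vector-valued functions\<close>

text \<open>The second difference of \<open>f\<close> with steps \<open>s *\<^sub>R u\<close> and
  \<open>s *\<^sub>R v\<close> is symmetric in \<open>u\<close> and \<open>v\<close>, and up to
  o(s^2) it equals \<open>s\<^sup>2 * B v u\<close>. Since \<open>f'\<close> is differentiable at
  the single point \<open>x\<close> only, the mean value theorem is applied once, in direction
  \<open>u\<close>, and the linearization of \<open>f'\<close> at \<open>x\<close> does the
  rest.\<close>

lemma symmetric_second_derivative: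
  fixes f :: "'a::real_normed_vector \<Rightarrow> real"
  assumes f: "\<And>x. (f has_derivative blinfun_apply (f' x)) (at x)"
    and f': "(f' has_derivative blinfun_apply B) (at x)"
  shows "B u v = B v u"
proof -
  have est: "\<exists>\<delta>>0. \<forall>s. 0 < s \<and> s < \<delta> \<longrightarrow>
      \<bar>f (x + s *\<^sub>R u + s *\<^sub>R v) - f (x + s *\<^sub>R u) - f (x + s *\<^sub>R v) + f x - s\<^sup>2 * B v u\<bar> \<le> e * s\<^sup>2"
    if "e > 0" for e u v
  proof -
    define n where "n = norm u + norm v + 1"
    have n: "n > 0" by (simp add: n_def add_nonneg_pos)
    \<comment> \<open>Two linearization errors \<open>e' * (s * n)\<close>, multiplied by
      \<open>s\<close> and by \<open>norm u \<le> n\<close>, add up to exactly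
      \<open>e * s\<^sup>2\<close>.\<close>
    define e' where "e' = e / (2 * n * n)"
    have e': "e' > 0" using that n by (simp add: e'_def)
    obtain \<delta>0 where \<delta>0: "\<delta>0 > 0"
      and lin: "\<And>y. norm (y - x) < \<delta>0 \<Longrightarrow> norm (f' y - f' x - B (y - x)) \<le> e' * norm (y - x)"
      using f' e' unfolding has_derivative_at_alt by blast
    show ?thesis
    proof (intro exI[of _ "\<delta>0 / n"] conjI allI impI)
      show "\<delta>0 / n > 0" using \<delta>0 n by simp
      fix s :: real assume s: "0 < s \<and> s < \<delta>0 / n"
      define g where "g r = f (x + r *\<^sub>R u + s *\<^sub>R v) - f (x + r *\<^sub>R u)" for r
      have dg: "(g has_real_derivative (f' (x + r *\<^sub>R u + s *\<^sub>R v) u - f' (x + r *\<^sub>R u) u)) (at r)" for r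
        unfolding g_def has_field_derivative_def
        by (auto intro!: derivative_eq_intros has_derivative_compose[OF _ f] 
            simp: blinfun.scaleR_right algebra_simps fun_eq_iff)
      obtain r where r: "0 < r" "r < s"
        and gr: "g s - g 0 = (s - 0) * (f' (x + r *\<^sub>R u + s *\<^sub>R v) u - f' (x + r *\<^sub>R u) u)"
        using MVT2[of 0 s g "\<lambda>r. f' (x + r *\<^sub>R u + s *\<^sub>R v) u - f' (x + r *\<^sub>R u) u"] dg s by auto
      have b1: "norm (r *\<^sub>R u + s *\<^sub>R v) \<le> s * n"
      proof -
        have "norm (r *\<^sub>R u + s *\<^sub>R v) \<le> r * norm u + s * norm v"
          using norm_triangle_ineq[of "r *\<^sub>R u" "s *\<^sub>R v"] r s by simp
        also have "\<dots> \<le> s * norm u + s * norm v" using r by (simp add: mult_right_mono)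
        also have "\<dots> \<le> s * n" using s by (simp add: n_def algebra_simps)
        finally show ?thesis .
      qed
      have b2: "norm (r *\<^sub>R u) \<le> s * n"
      proof -
        have "norm (r *\<^sub>R u) \<le> s * norm u" using r by (simp add: mult_right_mono)
        also have "\<dots> \<le> s * n" using s by (intro mult_left_mono) (auto simp: n_def)
        finally show ?thesis .
      qed
      have sn: "s * n < \<delta>0" using s n by (simp add: field_simps)
      have "norm (f' (x + r *\<^sub>R u + s *\<^sub>R v) - f' x - B (r *\<^sub>R u + s *\<^sub>R v)) \<le> e' * (s * n)"
      proof -
        have "norm (f' (x + r *\<^sub>R u + s *\<^sub>R v) - f' x - B (r *\<^sub>R u + s *\<^sub>R v))
          \<le> e' * norm (r *\<^sub>R u + s *\<^sub>R v)"
          using lin[of "x + r *\<^sub>R u + s *\<^sub>R v"] b1 sn by (simp add: add.assoc)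
        also have "\<dots> \<le> e' * (s * n)" using b1 e' by simp
        finally show ?thesis .
      qed
      moreover have "norm (f' (x + r *\<^sub>R u) - f' x - B (r *\<^sub>R u)) \<le> e' * (s * n)"
      proof -
        have "norm (f' (x + r *\<^sub>R u) - f' x - B (r *\<^sub>R u)) \<le> e' * norm (r *\<^sub>R u)"
          using lin[of "x + r *\<^sub>R u"] b2 sn by simp
        also have "\<dots> \<le> e' * (s * n)" by (rule mult_left_mono[OF b2]) (use e' in simp)
        finally show ?thesis .
      qed
      ultimately have D: "norm (f' (x + r *\<^sub>R u + s *\<^sub>R v) - f' (x + r *\<^sub>R u) - B (s *\<^sub>R v)) \<le> 2 * e' * (s * n)"
        (is "norm ?D \<le> _")
        using norm_triangle_ineq4[of "f' (x + r *\<^sub>R u + s *\<^sub>R v) - f' x - B (r *\<^sub>R u + s *\<^sub>R v)"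
            "f' (x + r *\<^sub>R u) - f' x - B (r *\<^sub>R u)"]
        by (simp add: blinfun.add_right algebra_simps)
      have "g s - g 0 - s\<^sup>2 * B v u = s * ?D u"
        unfolding gr by (simp add: blinfun.diff_left blinfun.scaleR_right blinfun.scaleR_left power2_eq_square right_diff_distrib)
      then have "\<bar>g s - g 0 - s\<^sup>2 * B v u\<bar> = s * \<bar>?D u\<bar>" using s by (simp add: abs_mult)
      also have "\<dots> \<le> s * (norm ?D * norm u)"
        using norm_blinfun[of ?D u] s by (simp add: mult_left_mono)
      also have "\<dots> \<le> s * (2 * e' * (s * n) * n)"
        using D s n e' by (intro mult_left_mono mult_mono) (auto simp: n_def)
      also have "\<dots> = e * s\<^sup>2" using n by (simp add: e'_def field_simps power2_eq_square)
      finally show "\<bar>f (x + s *\<^sub>R u + s *\<^sub>R v) - f (x + s *\<^sub>R u) - f (x + s *\<^sub>R v) + f x - s\<^sup>2 * B v u\<bar> \<le> e * s\<^sup>2"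
        by (simp add: g_def algebra_simps)
    qed
  qed
  have "\<bar>B u v - B v u\<bar> \<le> e" if "e > 0" for e
  proof -
    obtain \<delta>1 where d1: "\<delta>1 > 0" "\<And>s. 0 < s \<and> s < \<delta>1 \<Longrightarrow>
      \<bar>f (x + s *\<^sub>R u + s *\<^sub>R v) - f (x + s *\<^sub>R u) - f (x + s *\<^sub>R v) + f x - s\<^sup>2 * B v u\<bar> \<le> e/2 * s\<^sup>2"
      using est[of "e/2" u v] \<open>e > 0\<close> by auto
    obtain \<delta>2 where d2: "\<delta>2 > 0" "\<And>s. 0 < s \<and> s < \<delta>2 \<Longrightarrow>
      \<bar>f (x + s *\<^sub>R v + s *\<^sub>R u) - f (x + s *\<^sub>R v) - f (x + s *\<^sub>R u) + f x - s\<^sup>2 * B u v\<bar> \<le> e/2 * s\<^sup>2"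
      using est[of "e/2" v u] \<open>e > 0\<close> by auto
    define s where "s = min \<delta>1 \<delta>2 / 2"
    have s: "0 < s" "s < \<delta>1" "s < \<delta>2" using d1(1) d2(1) by (auto simp: s_def)
    have "\<bar>s\<^sup>2 * B u v - s\<^sup>2 * B v u\<bar> \<le> e * s\<^sup>2"
      using d1(2)[of s] d2(2)[of s] s unfolding add.assoc add.commute[of "s *\<^sub>R v" "s *\<^sub>R u"]
      by linarith
    then have "s\<^sup>2 * \<bar>B u v - B v u\<bar> \<le> s\<^sup>2 * e"
      by (simp add: abs_mult mult.commute[of e] flip: right_diff_distrib)
    then show ?thesis using s by simp
  qed
  then show ?thesis
    by (metis abs_ge_zero abs_le_zero_iff eq_iff_diff_eq_0 field_le_epsilon add_0)
qed

text \<open>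
  A Gronwall inequality for the right upper Dini derivative, with a clock \<open>\<sigma>\<close> in place of time and a
  forcing term that is the increment of a possibly discontinuous monotone function \<open>\<Omega>\<close>.
\<close>

lemma gronwall_right_local:
  fixes \<gamma> \<sigma> \<Omega> :: "real \<Rightarrow> real"
  assumes T: "0 \<le> T" and C: "C \<ge> 0"
    and \<gamma>: "continuous_on {0..T} \<gamma>" and \<gamma>_nonneg: "\<And>t. t \<in> {0..T} \<Longrightarrow> \<gamma> t \<ge> 0"
    and \<sigma>: "continuous_on {0..T} \<sigma>"
    and \<sigma>_mono: "\<And>s t. 0 \<le> s \<Longrightarrow> s \<le> t \<Longrightarrow> t \<le> T \<Longrightarrow> \<sigma> s \<le> \<sigma> t"
    and \<Omega>_mono: "\<And>s t. 0 \<le> s \<Longrightarrow> s \<le> t \<Longrightarrow> t \<le> T \<Longrightarrow> \<Omega> s \<le> \<Omega> t"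
    and step: "\<And>s. 0 \<le> s \<Longrightarrow> s < T \<Longrightarrow> \<exists>\<delta>>0. \<forall>t. s < t \<and> t < s + \<delta> \<and> t \<le> T \<longrightarrow>
      \<gamma> t - \<gamma> s \<le> C * \<gamma> s * (\<sigma> t - \<sigma> s) + C * (\<sigma> t - \<sigma> s)\<^sup>2 + (\<Omega> t - \<Omega> s)"
    and t: "t \<in> {0..T}"
  shows "\<gamma> t \<le> exp (C * (\<sigma> T - \<sigma> 0)) * (\<gamma> 0 + (\<Omega> t - \<Omega> 0))"
proof -
  \<comment> \<open>The slack \<open>e * (\<sigma> t - \<sigma> 0)\<close> absorbs the term
    quadratic in the clock on short steps; it is removed at the end by letting \<open>e\<close> tend
    to 0.\<close>
  have main: "\<gamma> t \<le> exp (C * (\<sigma> t - \<sigma> 0)) * (\<gamma> 0 + (\<Omega> t - \<Omega> 0) + e * (\<sigma> t - \<sigma> 0))"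
    if e: "e > 0" and t: "t \<in> {0..T}" for e t
  proof -
    define f where "f t = exp (C * (\<sigma> t - \<sigma> 0)) * (\<gamma> 0 + (\<Omega> t - \<Omega> 0) + e * (\<sigma> t - \<sigma> 0))" for t
    have f_mono: "f s \<le> f t" if "0 \<le> s" "s \<le> t" "t \<le> T" for s t
      unfolding f_def using \<sigma>_mono[OF that] \<Omega>_mono[OF that] \<sigma>_mono[of 0 s] \<Omega>_mono[of 0 s] \<gamma>_nonneg[of 0] that C e
      by (intro mult_mono add_mono) (auto intro!: mult_left_mono add_nonneg_nonneg)
    define P where "P t \<longleftrightarrow> (\<forall>s\<in>{0..t}. \<gamma> s \<le> f s)" for t
    define A where "A = {t \<in> {0..T}. P t}"
    have A0: "0 \<in> A" using T by (auto simp: A_def P_def f_def)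
    have bdd: "bdd_above A" by (auto simp: A_def bdd_above_def)
    define m where "m = Sup A"
    have m0: "0 \<le> m" using A0 bdd by (auto simp: m_def intro: cSup_upper)
    have mT: "m \<le> T" unfolding m_def using A0 by (intro cSup_least) (auto simp: A_def)
    have below: "\<gamma> s \<le> f s" if s: "0 \<le> s" "s < m" for s
    proof -
      obtain a where "a \<in> A" "s < a"
        using s(2) A0 less_cSup_iff[OF _ bdd] unfolding m_def by auto
      then show ?thesis using s by (auto simp: A_def P_def)
    qed
    have atm: "\<gamma> m \<le> f m"
    proof (cases "m = 0")
      case True
      then show ?thesis by (simp add: f_def)
    next
      case False
      with m0 have m: "m > 0" by simp
      have "(\<gamma> \<longlongrightarrow> \<gamma> m) (at_left m)"
        using continuous_on_Icc_at_leftD[OF continuous_on_subset[OF \<gamma>, of "{0..m}"] m] mT by simp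
      \<comment> \<open>The majorant \<open>f\<close> may jump together with
        \<open>\<Omega>\<close>, so its left limit at \<open>m\<close> can differ from
        \<open>f m\<close>; monotonicity of \<open>f\<close> gives the constant bound
        \<open>f m\<close> on the left.\<close>
      moreover have "\<forall>\<^sub>F s in at_left m. \<gamma> s \<le> f m"
        unfolding eventually_at_left[OF m]
      proof (intro exI[of _ 0] conjI allI impI)
        fix s assume "0 < s" "s < m"
        then show "\<gamma> s \<le> f m" using below[of s] f_mono[of s m] mT by simp
      qed (rule m)
      ultimately show ?thesis by (intro tendsto_upperbound[of \<gamma> "\<gamma> m" "at_left m"]) auto
    qed
    have Pm: "P m" using below atm by (force simp: P_def)
    have "m = T"
    proof (rule ccontr)
      assume "m \<noteq> T"
      with mT have mlT: "m < T" by simp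
      obtain \<delta> where \<delta>: "\<delta> > 0" and st: "\<And>t. m < t \<Longrightarrow> t < m + \<delta> \<Longrightarrow> t \<le> T \<Longrightarrow>
          \<gamma> t - \<gamma> m \<le> C * \<gamma> m * (\<sigma> t - \<sigma> m) + C * (\<sigma> t - \<sigma> m)\<^sup>2 + (\<Omega> t - \<Omega> m)"
        using step[OF m0 mlT] by blast
      \<comment> \<open>With the clock increment \<open>d\<close> below \<open>e / (C + 1)\<close>
        one gets \<open>C * d \<le> e\<close>, also when \<open>C = 0\<close>.\<close>
      have e': "e / (C + 1) > 0" using e C by simp
      obtain \<eta> where \<eta>: "\<eta> > 0" and co: "\<And>t. t \<in> {0..T} \<Longrightarrow> dist t m < \<eta> \<Longrightarrow> dist (\<sigma> t) (\<sigma> m) < e / (C + 1)"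
        using \<sigma> m0 mT e' unfolding continuous_on_iff by (meson atLeastAtMost_iff)
      define t1 where "t1 = min T (m + min \<delta> \<eta> / 2)"
      have t1: "m < t1" "t1 \<le> T" "t1 < m + \<delta>" "t1 < m + \<eta>"
        using mlT \<delta> \<eta> by (auto simp: t1_def min_def)
      have ext: "\<gamma> t \<le> f t" if tt: "m < t" "t \<le> t1" for t
      proof -
        have t': "t < m + \<delta>" "t \<le> T" "0 \<le> t" "dist t m < \<eta>" using tt t1 m0 by (auto simp: dist_real_def)
        define d where "d = \<sigma> t - \<sigma> m"
        have d0: "d \<ge> 0" using \<sigma>_mono[of m t] m0 tt t' by (simp add: d_def)
        have "d < e / (C + 1)" using co[of t] t' d0 by (auto simp: d_def dist_real_def)
        then have "(C + 1) * d \<le> e" using C by (simp add: field_simps)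
        then have Cd: "C * d \<le> e" using d0 by (simp add: algebra_simps)
        have \<Omega>: "\<Omega> t - \<Omega> m \<ge> 0" using \<Omega>_mono[of m t] m0 tt t' by simp
        have s0: "\<sigma> m - \<sigma> 0 \<ge> 0" using \<sigma>_mono[of 0 m] m0 mT by simp
        define E where "E = exp (C * (\<sigma> m - \<sigma> 0))"
        define G where "G = \<gamma> 0 + (\<Omega> m - \<Omega> 0) + e * (\<sigma> m - \<sigma> 0)"
        have fm: "f m = E * G" by (simp add: f_def E_def G_def)
        have E1: "E \<ge> 1" using C s0 by (simp add: E_def)
        have xd: "exp (C * d) \<ge> 1" using C d0 by simp
        have "\<gamma> t \<le> \<gamma> m * (1 + C * d) + C * d * d + (\<Omega> t - \<Omega> m)"
          using st[OF tt(1) t'(1,2)] by (simp add: d_def algebra_simps power2_eq_square)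
        also have "C * d * d \<le> e * d" using Cd d0 by (intro mult_right_mono)
        also have "\<gamma> m * (1 + C * d) \<le> f m * exp (C * d)"
        proof (rule mult_mono)
          show "0 \<le> f m" using atm \<gamma>_nonneg[of m] m0 mT by simp
        qed (use atm C d0 exp_ge_add_one_self[of "C * d"] in auto)
        finally have "\<gamma> t \<le> E * G * exp (C * d) + (e * d + (\<Omega> t - \<Omega> m))" using fm by simp
        also have "e * d + (\<Omega> t - \<Omega> m) \<le> E * exp (C * d) * (e * d + (\<Omega> t - \<Omega> m))"
        proof -
          have "1 \<le> E * exp (C * d)" using E1 xd
            using mult_mono[of 1 E 1 "exp (C * d)"] by simp
          moreover have "0 \<le> e * d + (\<Omega> t - \<Omega> m)" using e d0 \<Omega> by simp
          ultimately show ?thesis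
            using mult_right_mono[of 1 "E * exp (C * d)" "e * d + (\<Omega> t - \<Omega> m)"] by simp
        qed
        also have "E * G * exp (C * d) + E * exp (C * d) * (e * d + (\<Omega> t - \<Omega> m)) =
          (E * exp (C * d)) * (G + e * d + (\<Omega> t - \<Omega> m))" by (simp add: algebra_simps)
        also have "E * exp (C * d) = exp (C * (\<sigma> t - \<sigma> 0))"
          by (simp add: E_def d_def algebra_simps flip: exp_add)
        also have "G + e * d + (\<Omega> t - \<Omega> m) = \<gamma> 0 + (\<Omega> t - \<Omega> 0) + e * (\<sigma> t - \<sigma> 0)"
          by (simp add: G_def d_def algebra_simps)
        finally show ?thesis by (simp add: f_def)
      qed
      have "t1 \<in> A" using ext Pm t1 m0 by (fastforce simp: A_def P_def not_le)
      then have "t1 \<le> m" unfolding m_def using bdd by (rule cSup_upper)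
      with t1 show False by simp
    qed
    then show ?thesis using Pm t by (auto simp: P_def f_def)
  qed
  define E where "E = exp (C * (\<sigma> t - \<sigma> 0))"
  define G where "G = \<gamma> 0 + (\<Omega> t - \<Omega> 0)"
  have "\<gamma> t \<le> E * G + e" if "e > 0" for e
  proof -
    define d where "d = E * (\<sigma> t - \<sigma> 0)"
    have d: "d \<ge> 0" using \<sigma>_mono[of 0 t] t by (simp add: d_def E_def)
    have "\<gamma> t \<le> E * (G + e / (d + 1) * (\<sigma> t - \<sigma> 0))"
      using main[of "e / (d + 1)" t] that d t by (simp add: E_def G_def)
    also have "\<dots> = E * G + e / (d + 1) * d" by (simp add: d_def algebra_simps)
    also have "e / (d + 1) * d \<le> e" using d that by (simp add: field_simps)
    finally show ?thesis by simp
  qed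
  then have "\<gamma> t \<le> E * G" by (rule field_le_epsilon)
  also have "\<dots> \<le> exp (C * (\<sigma> T - \<sigma> 0)) * G"
  proof (rule mult_right_mono)
    show "E \<le> exp (C * (\<sigma> T - \<sigma> 0))" using \<sigma>_mono[of t T] t C by (simp add: E_def mult_left_mono)
    show "0 \<le> G" using \<gamma>_nonneg[of 0] \<Omega>_mono[of 0 t] t by (auto simp: G_def)
  qed
  finally show ?thesis by (simp add: G_def)
qed

section \<open>Gauge integrals of vector-valued functions\<close>

text \<open>The Riemann sum of \<open>f - g n\<close> is bounded in norm by that of
  \<open>norm (f - g n)\<close>, so a gauge that is fine for the two known integrals serves for
  \<open>f\<close>. Integrability is thus reduced to that of real functions.\<close>

lemma has_integral_L1_limit:
  fixes f :: "'n::euclidean_space \<Rightarrow> 'a::real_normed_vector"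
  assumes g: "\<And>n::nat. (g n has_integral I n) (cbox a b)"
    and r: "\<And>n. ((\<lambda>x. norm (f x - g n x)) has_integral r n) (cbox a b)"
    and r0: "r \<longlonglongrightarrow> 0" and IJ: "I \<longlonglongrightarrow> J"
  shows "(f has_integral J) (cbox a b)"
  unfolding has_integral
proof (intro allI impI)
  fix e :: real assume e: "e > 0"
  have "\<forall>\<^sub>F n in sequentially. r n < e/4 \<and> norm (I n - J) < e/4"
    using order_tendstoD(2)[OF r0, of "e/4"] tendstoD[OF IJ, of "e/4"] e
    by (auto simp: dist_norm intro: eventually_conj)
  then obtain n where n: "r n < e/4" "norm (I n - J) < e/4"
    by (auto simp: eventually_sequentially)
  obtain \<gamma>1 where \<gamma>1: "gauge \<gamma>1" "\<And>D. D tagged_division_of cbox a b \<Longrightarrow> \<gamma>1 fine D \<Longrightarrow>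
      norm ((\<Sum>(x,k)\<in>D. measure lborel k *\<^sub>R g n x) - I n) < e/4"
    using g[of n] e unfolding has_integral by (meson divide_pos_pos zero_less_numeral)
  obtain \<gamma>2 where \<gamma>2: "gauge \<gamma>2" "\<And>D. D tagged_division_of cbox a b \<Longrightarrow> \<gamma>2 fine D \<Longrightarrow>
      norm ((\<Sum>(x,k)\<in>D. measure lborel k *\<^sub>R norm (f x - g n x)) - r n) < e/4"
    using r[of n] e unfolding has_integral by (meson divide_pos_pos zero_less_numeral)
  show "\<exists>\<gamma>. gauge \<gamma> \<and> (\<forall>D. D tagged_division_of cbox a b \<and> \<gamma> fine D \<longrightarrow>
      norm ((\<Sum>(x,k)\<in>D. measure lborel k *\<^sub>R f x) - J) < e)"
  proof (intro exI[of _ "\<lambda>x. \<gamma>1 x \<inter> \<gamma>2 x"] conjI allI impI)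
    show "gauge (\<lambda>x. \<gamma>1 x \<inter> \<gamma>2 x)" using \<gamma>1(1) \<gamma>2(1) by (rule gauge_Int)
    fix D assume D: "D tagged_division_of cbox a b \<and> (\<lambda>x. \<gamma>1 x \<inter> \<gamma>2 x) fine D"
    then have f1: "\<gamma>1 fine D" and f2: "\<gamma>2 fine D" by (auto simp: fine_Int)
    have "norm ((\<Sum>(x,k)\<in>D. measure lborel k *\<^sub>R f x) - (\<Sum>(x,k)\<in>D. measure lborel k *\<^sub>R g n x)) =
        norm (\<Sum>(x,k)\<in>D. measure lborel k *\<^sub>R (f x - g n x))"
      by (simp add: sum_subtractf[symmetric] case_prod_unfold scaleR_diff_right)
    also have "\<dots> \<le> (\<Sum>(x,k)\<in>D. measure lborel k *\<^sub>R norm (f x - g n x))"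
      by (rule order_trans[OF norm_sum]) (simp add: case_prod_unfold)
    also have "\<dots> < e/2"
      using \<gamma>2(2)[OF _ f2] D n(1) unfolding real_norm_def by linarith
    finally have 1: "norm ((\<Sum>(x,k)\<in>D. measure lborel k *\<^sub>R f x) - (\<Sum>(x,k)\<in>D. measure lborel k *\<^sub>R g n x)) < e/2" .
    have 2: "norm ((\<Sum>(x,k)\<in>D. measure lborel k *\<^sub>R g n x) - I n) < e/4" using \<gamma>1(2)[OF _ f1] D by blast
    show "norm ((\<Sum>(x,k)\<in>D. measure lborel k *\<^sub>R f x) - J) < e"
      using norm_triangle_lt[OF add_strict_mono[OF norm_triangle_lt[OF add_strict_mono[OF 1 2]] n(2)]] e
      by simp
  qed
qed

text \<open>Every Riemann sum is a combination of values of \<open>f\<close> with nonnegative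
  coefficients, and the integral is a limit of such sums.\<close>

lemma has_integral_in_closed_cone:
  fixes f :: "'n::euclidean_space \<Rightarrow> 'a::real_normed_vector"
  assumes f: "(f has_integral I) (cbox a b)" and fS: "\<And>x. x \<in> cbox a b \<Longrightarrow> f x \<in> S"
    and S: "closed S" "0 \<in> S" "\<And>x y. x \<in> S \<Longrightarrow> y \<in> S \<Longrightarrow> x + y \<in> S"
      "\<And>c x. c \<ge> 0 \<Longrightarrow> x \<in> S \<Longrightarrow> c *\<^sub>R x \<in> S"
  shows "I \<in> S"
proof -
  have "\<exists>y\<in>S. dist y I < e" if e: "e > 0" for e
  proof -
    obtain \<gamma> where \<gamma>: "gauge \<gamma>" "\<And>D. D tagged_division_of cbox a b \<Longrightarrow> \<gamma> fine D \<Longrightarrow>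
      norm ((\<Sum>(x,k)\<in>D. measure lborel k *\<^sub>R f x) - I) < e"
      using f e unfolding has_integral by meson
    obtain D where D: "D tagged_division_of cbox a b" "\<gamma> fine D"
      using fine_division_exists[OF \<gamma>(1)] by blast
    have sum_S: "sum h A \<in> S" if "finite A" "\<And>x. x \<in> A \<Longrightarrow> h x \<in> S" for h :: "'n \<times> 'n set \<Rightarrow> 'a" and A
      using that by (induction A rule: finite_induct) (auto intro: S)
    have "(\<Sum>(x,k)\<in>D. measure lborel k *\<^sub>R f x) \<in> S"
    proof (rule sum_S)
      show "finite D" using D(1) by blast
      fix p assume "p \<in> D"
      then show "(case p of (x, k) \<Rightarrow> measure lborel k *\<^sub>R f x) \<in> S"
        using D(1) fS by (cases p) (auto intro!: S(4) dest: tagged_division_ofD(2,3))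
    qed
    then show ?thesis using \<gamma>(2)[OF D] by (auto simp: dist_norm)
  qed
  then show ?thesis using S(1) closed_approachable by blast
qed

lemma has_integral_subinterval_diff:
  fixes g :: "real \<Rightarrow> 'a::banach"
  assumes "\<And>t. t \<in> {0..T} \<Longrightarrow> (g has_integral (f t - f 0)) {0..t}" and "0 \<le> s" "s \<le> t" "t \<le> T"
  shows "(g has_integral (f t - f s)) {s..t}"
proof -
  have t: "(g has_integral (f t - f 0)) {0..t}" and s: "(g has_integral (f s - f 0)) {0..s}"
    using assms by auto
  have "g integrable_on {s..t}"
    using t assms(2,3) by (auto intro: integrable_on_subinterval has_integral_integrable)
  then obtain j where j: "(g has_integral j) {s..t}" by auto
  have "f s - f 0 + j = f t - f 0"
    using has_integral_combine[OF assms(2,3) s j] t by (rule has_integral_unique)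
  then have "j = f t - f s" by (simp add: algebra_simps)
  with j show ?thesis by simp
qed

section \<open>Functions of bounded variation\<close>

text \<open>\<open>V t\<close> is the total variation of \<open>g\<close> on \<open>[0,t]\<close>:
  every partition of \<open>[0,s]\<close> can be continued by the points \<open>s\<close> and
  \<open>t\<close>.\<close>

lemma bounded_variation_monotone_bound:
  fixes g :: "real \<Rightarrow> 'b::real_normed_vector"
  assumes bv: "bounded_variation_on {0..T} g"
  obtains V where "\<And>s t. 0 \<le> s \<Longrightarrow> s \<le> t \<Longrightarrow> t \<le> T \<Longrightarrow> norm (g t - g s) \<le> V t - V s"
proof -
  obtain M where M: "\<And>(n::nat) p. (\<forall>k\<le>n. p k \<in> {0..T}) \<Longrightarrow> (\<forall>k<n. p k \<le> p (Suc k)) \<Longrightarrow>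
        (\<Sum>k<n. norm (g (p (Suc k)) - g (p k))) \<le> M"
    using bv unfolding bounded_variation_on_def by blast
  define W where "W t = {(\<Sum>k<n. norm (g (p (Suc k)) - g (p k))) | (n::nat) p.
     (\<forall>k\<le>n. p k \<in> {0..t}) \<and> (\<forall>k<n. p k \<le> p (Suc k))}" for t
  have bdd: "bdd_above (W t)" if "t \<le> T" for t
  proof (rule bdd_aboveI)
    fix x assume "x \<in> W t"
    then obtain n p where "x = (\<Sum>k<n. norm (g (p (Suc k)) - g (p k)))"
      "\<forall>k\<le>n. p k \<in> {0..t}" "\<forall>k<n. p k \<le> p (Suc k)"
      unfolding W_def by blast
    then show "x \<le> M" using M[of n p] that by fastforce
  qed
  have "norm (g t - g s) \<le> Sup (W t) - Sup (W s)" if st: "0 \<le> s" "s \<le> t" "t \<le> T" for s t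
  proof -
    have "Sup (W s) \<le> Sup (W t) - norm (g t - g s)"
    proof (rule cSup_least)
      have "(\<Sum>k<0. norm (g ((\<lambda>_. 0) (Suc k)) - g ((\<lambda>_. 0) k))) \<in> W s"
        unfolding W_def using st by (intro CollectI exI[of _ "0::nat"] exI[of _ "\<lambda>_. 0::real"]) auto
      then show "W s \<noteq> {}" by blast
      fix x assume "x \<in> W s"
      then obtain n p where x: "x = (\<Sum>k<n. norm (g (p (Suc k)) - g (p k)))"
        and p: "\<forall>k\<le>n. p k \<in> {0..s}" "\<forall>k<n. p k \<le> p (Suc k)"
        unfolding W_def by blast
      define q where "q k = (if k \<le> n then p k else if k = Suc n then s else t)" for k
      have "(\<Sum>k<Suc (Suc n). norm (g (q (Suc k)) - g (q k))) \<in> W t"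
        unfolding W_def using p st
        by (intro CollectI exI[of _ "Suc (Suc n)"] exI[of _ q])
           (auto simp: q_def le_Suc_eq less_Suc_eq)
      then have "(\<Sum>k<Suc (Suc n). norm (g (q (Suc k)) - g (q k))) \<le> Sup (W t)"
        using bdd[OF st(3)] by (rule cSup_upper)
      moreover have "(\<Sum>k<Suc (Suc n). norm (g (q (Suc k)) - g (q k))) =
          x + norm (g s - g (p n)) + norm (g t - g s)"
        unfolding x by (simp add: q_def)
      ultimately show "x \<le> Sup (W t) - norm (g t - g s)" using norm_ge_zero[of "g s - g (p n)"] by linarith
    qed
    then show ?thesis by simp
  qed
  then show thesis by (rule that)
qed

text \<open>\<open>f t - f s\<close> is the integral of \<open>g\<close>, which stays within
  \<open>V t - V s\<close> of \<open>g c\<close>. As \<open>c\<close> may be either end point,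
  difference quotients of neighbouring intervals can be compared through the value of
  \<open>g\<close> at their common node.\<close>

lemma linearization_bounded_variation:
  fixes f :: "real \<Rightarrow> 'b::banach"
  assumes f: "has_W11_derivative T f g"
    and V: "\<And>s t. 0 \<le> s \<Longrightarrow> s \<le> t \<Longrightarrow> t \<le> T \<Longrightarrow> norm (g t - g s) \<le> V t - V s"
    and c: "0 \<le> s" "s \<le> c" "c \<le> t" "t \<le> T"
  shows "norm (f t - f s - (t - s) *\<^sub>R g c) \<le> (t - s) * (V t - V s)"
proof -
  have "(g has_integral (f t - f s)) {s..t}"
    by (rule has_integral_subinterval_diff[where T=T]) (use f c in \<open>auto simp: has_W11_derivative_def\<close>)
  moreover have "((\<lambda>x. g c) has_integral ((t - s) *\<^sub>R g c)) {s..t}"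
    using has_integral_const_real[of "g c" s t] c by simp
  ultimately have "((\<lambda>x. g x - g c) has_integral (f t - f s - (t - s) *\<^sub>R g c)) (cbox s t)"
    unfolding cbox_interval by (rule has_integral_diff)
  then have "norm (f t - f s - (t - s) *\<^sub>R g c) \<le> (V t - V s) * measure lborel (cbox s t)"
  proof (rule has_integral_bound[rotated])
    show "0 \<le> V t - V s" using V[of s t] c norm_ge_zero[of "g t - g s"] by linarith
    fix x assume x: "x \<in> cbox s t"
    have mono: "V p \<le> V q" if "0 \<le> p" "p \<le> q" "q \<le> T" for p q
      using V[OF that] norm_ge_zero[of "g q - g p"] by linarith
    show "norm (g x - g c) \<le> V t - V s"
    proof (cases "x \<le> c")
      case True
      then show ?thesis using V[of x c] mono[of s x] mono[of c t] x c
        by (auto simp: norm_minus_commute)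
    next
      case False
      then show ?thesis using V[of c x] mono[of s c] mono[of x t] x c by auto
    qed
  qed
  then show ?thesis using c by (simp add: mult.commute)
qed

lemma blinfun_le_norm:
  fixes \<xi> :: "'a::real_normed_vector \<Rightarrow>\<^sub>L real"
  assumes "norm \<xi> \<le> e" "norm v \<le> f"
  shows "\<xi> v \<le> e * f" "- \<xi> v \<le> e * f"
proof -
  have "\<bar>\<xi> v\<bar> \<le> norm \<xi> * norm v" using norm_blinfun[of \<xi> v] by simp
  also have "\<dots> \<le> e * f" using assms order_trans[OF norm_ge_zero assms(1)] by (intro mult_mono) auto
  finally show "\<xi> v \<le> e * f" "- \<xi> v \<le> e * f" by auto
qed

lemma lipschitz_bound_continuous_on:
  fixes m :: "real \<Rightarrow> 'a::real_normed_vector"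
  assumes "0 \<le> L" "\<And>s t. 0 \<le> s \<Longrightarrow> s \<le> t \<Longrightarrow> t \<le> T \<Longrightarrow> norm (m t - m s) \<le> L * (t - s)"
  shows "continuous_on {0..T} m"
proof (rule lipschitz_on_continuous_on)
  show "L-lipschitz_on {0..T} m"
  proof (rule lipschitz_onI)
    fix p q assume "p \<in> {0..T}" "q \<in> {0..T}"
    then show "dist (m p) (m q) \<le> L * dist p q"
      using assms(2)[of p q] assms(2)[of q p] by (cases "p \<le> q") (auto simp: dist_norm norm_minus_commute)
  qed (rule assms(1))
qed

section \<open>Lipschitz curves in Hilbert spaces\<close>

text \<open>The end point \<open>T\<close> is excluded because the index formula would give the
  nonexistent cell \<open>2 ^ n\<close> there.\<close>

definition dyadic_step :: "real \<Rightarrow> nat \<Rightarrow> (nat \<Rightarrow> 'a::zero) \<Rightarrow> real \<Rightarrow> 'a" where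
  "dyadic_step T n c x = (if x \<in> {0..<T} then c (nat \<lfloor>x * 2 ^ n / T\<rfloor>) else 0)"

lemma dyadic_index:
  assumes "T > 0" "x \<in> {0..<T}"
  shows "nat \<lfloor>x * 2 ^ n / T\<rfloor> < 2 ^ n"
    and "real (nat \<lfloor>x * 2 ^ n / T\<rfloor>) * (T / 2 ^ n) \<le> x"
    and "x < real (Suc (nat \<lfloor>x * 2 ^ n / T\<rfloor>)) * (T / 2 ^ n)"
proof -
  have x: "0 \<le> x * 2 ^ n / T" "x * 2 ^ n / T < 2 ^ n" using assms by (auto simp: field_simps)
  define i where "i = nat \<lfloor>x * 2 ^ n / T\<rfloor>"
  have fl: "real (nat \<lfloor>y\<rfloor>) \<le> y \<and> y < real (nat \<lfloor>y\<rfloor>) + 1" if "0 \<le> y" for y :: real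
    using that by linarith
  have i: "real i \<le> x * 2 ^ n / T" "x * 2 ^ n / T < real i + 1"
    using fl[OF x(1)] unfolding i_def by blast+
  show "nat \<lfloor>x * 2 ^ n / T\<rfloor> < 2 ^ n"
  proof -
    have "real i < 2 ^ n" using i(1) x(2) by (rule order.strict_trans1)
    then show ?thesis unfolding i_def[symmetric] by simp
  qed
  show "real (nat \<lfloor>x * 2 ^ n / T\<rfloor>) * (T / 2 ^ n) \<le> x"
    and "x < real (Suc (nat \<lfloor>x * 2 ^ n / T\<rfloor>)) * (T / 2 ^ n)"
    using i assms(1) unfolding i_def[symmetric] by (auto simp: field_simps)
qed

lemma dyadic_index_eq_iff:
  assumes "T > 0"
  shows "x \<in> {0..<T} \<and> nat \<lfloor>x * 2 ^ n / T\<rfloor> = i \<longleftrightarrow>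
    i < 2 ^ n \<and> x \<in> {real i * (T / 2 ^ n)..<real (Suc i) * (T / 2 ^ n)}"
proof
  assume "x \<in> {0..<T} \<and> nat \<lfloor>x * 2 ^ n / T\<rfloor> = i"
  then show "i < 2 ^ n \<and> x \<in> {real i * (T / 2 ^ n)..<real (Suc i) * (T / 2 ^ n)}"
    using dyadic_index[OF assms, of x n] by (metis atLeastLessThan_iff)
next
  assume *: "i < 2 ^ n \<and> x \<in> {real i * (T / 2 ^ n)..<real (Suc i) * (T / 2 ^ n)}"
  then have b: "real i \<le> x * 2 ^ n / T" "x * 2 ^ n / T < real i + 1"
    using assms by (auto simp: field_simps)
  have "real (Suc i) \<le> real (2 ^ n)" using * by (intro of_nat_mono) simp
  then have "x * 2 ^ n / T < 2 ^ n" using b by simp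
  moreover have "0 \<le> x * 2 ^ n / T" using b(1) by (rule order_trans[OF of_nat_0_le_iff])
  moreover have "\<not> x < 0"
  proof
    assume "x < 0"
    then have "x * 2 ^ n / T < 0" using assms by (intro divide_neg_pos mult_neg_pos) auto
    with \<open>0 \<le> x * 2 ^ n / T\<close> show False by simp
  qed
  ultimately have "x \<in> {0..<T}" using assms by (simp add: pos_divide_less_eq)
  moreover have "\<lfloor>x * 2 ^ n / T\<rfloor> = int i" using b by (intro floor_unique) simp_all
  then have "nat \<lfloor>x * 2 ^ n / T\<rfloor> = i" by simp
  ultimately show "x \<in> {0..<T} \<and> nat \<lfloor>x * 2 ^ n / T\<rfloor> = i" ..
qed

text \<open>Integer division commutes with the floor. This makes step functions of different levels
  comparable on the cells of the finer one.\<close>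

lemma dyadic_index_coarsen:
  fixes T x :: real
  assumes "T > 0" "x \<in> {0..<T}"
  shows "nat \<lfloor>x * 2 ^ n / T\<rfloor> = nat \<lfloor>x * 2 ^ (n + p) / T\<rfloor> div 2 ^ p"
proof -
  have "\<lfloor>x * 2 ^ n / T\<rfloor> = \<lfloor>(x * 2 ^ (n + p) / T) / real_of_int (2 ^ p)\<rfloor>"
    by (simp add: power_add)
  also have "\<dots> = \<lfloor>x * 2 ^ (n + p) / T\<rfloor> div 2 ^ p" by (rule floor_divide_real_eq_div) simp
  finally show ?thesis using assms by (simp add: nat_div_distrib nat_power_eq)
qed

text \<open>The sum of indicators is the form that can be integrated by linearity, whereas the floor
  index is better suited to pointwise comparison of levels.\<close>

lemma dyadic_step_altdef:
  fixes c :: "nat \<Rightarrow> 'a::real_vector"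
  assumes "T > 0"
  shows "dyadic_step T n c x =
    (\<Sum>i<2 ^ n. indicator {real i * (T / 2 ^ n)..<real (Suc i) * (T / 2 ^ n)} x *\<^sub>R c i)"
proof (cases "x \<in> {0..<T}")
  case True
  define k where "k = nat \<lfloor>x * 2 ^ n / T\<rfloor>"
  have k: "k < 2 ^ n" using dyadic_index(1)[OF assms True] by (simp add: k_def)
  have ind: "indicator {real i * (T / 2 ^ n)..<real (Suc i) * (T / 2 ^ n)} x = (if i = k then 1 else (0::real))"
    if "i < 2 ^ n" for i
    using dyadic_index_eq_iff[OF assms, of x n i] that True unfolding k_def indicator_def by auto
  have "(\<Sum>i<2 ^ n. indicator {real i * (T / 2 ^ n)..<real (Suc i) * (T / 2 ^ n)} x *\<^sub>R c i) =
    (\<Sum>i<2 ^ n. if i = k then c i else 0)"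
    by (rule sum.cong) (simp_all add: ind del: of_nat_Suc times_divide_eq_right)
  also have "\<dots> = c k" using k by simp
  finally show ?thesis using True by (simp add: dyadic_step_def k_def)
next
  case False
  have "indicator {real i * (T / 2 ^ n)..<real (Suc i) * (T / 2 ^ n)} x = (0::real)"
    if "i < 2 ^ n" for i
    using dyadic_index_eq_iff[OF assms, of x n i] that False unfolding indicator_def by auto
  then show ?thesis using False by (auto simp: dyadic_step_def simp del: of_nat_Suc intro!: sum.neutral[symmetric])
qed

text \<open>\<open>min s b - min s a\<close> is the length of the interval cut off at
  \<open>s\<close>; this form needs no case distinction on the position of \<open>s\<close>.\<close>

lemma has_integral_indicator_Ico:
  fixes c :: "'a::banach"
  assumes "0 \<le> a" "a \<le> b" "0 \<le> s"
  shows "((\<lambda>x. indicator {a..<b} x *\<^sub>R c) has_integral ((min s b - min s a) *\<^sub>R c)) {0..s}"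
proof -
  have "((\<lambda>x::real. c) has_integral ((min s b - min s a) *\<^sub>R c)) {min s a..min s b}"
    using has_integral_const_real[of c "min s a" "min s b"] min.mono[OF order_refl assms(2), of s] by simp
  then have "((\<lambda>x. if x \<in> {min s a..min s b} then c else 0) has_integral ((min s b - min s a) *\<^sub>R c)) {0..s}"
    by (rule iffD2[OF has_integral_restrict, rotated]) (use assms in auto)
  then show ?thesis
    by (rule has_integral_spike_finite[of "{a, b, s}", rotated 2])
       (auto simp: min_def indicator_def)
qed

lemma dyadic_step_has_integral:
  fixes c :: "nat \<Rightarrow> 'a::banach"
  assumes "T > 0" "0 \<le> s"
  shows "(dyadic_step T n c has_integral
    (\<Sum>i<2 ^ n. (min s (real (Suc i) * (T / 2 ^ n)) - min s (real i * (T / 2 ^ n))) *\<^sub>R c i)) {0..s}"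
  unfolding dyadic_step_altdef[OF assms(1), abs_def]
proof (intro has_integral_sum has_integral_indicator_Ico)
  have h: "T / 2 ^ n \<ge> 0" using assms by simp
  show "0 \<le> real i * (T / 2 ^ n)" for i by (rule mult_nonneg_nonneg[OF _ h]) simp
  show "real i * (T / 2 ^ n) \<le> real (Suc i) * (T / 2 ^ n)" for i by (rule mult_right_mono[OF _ h]) simp
qed (use assms in simp_all)

lemma dyadic_step_has_integral_full:
  fixes c :: "nat \<Rightarrow> 'a::banach"
  assumes "T > 0"
  shows "(dyadic_step T n c has_integral (T / 2 ^ n) *\<^sub>R (\<Sum>i<2 ^ n. c i)) {0..T}"
proof -
  have "(\<Sum>i<2 ^ n. (min T (real (Suc i) * (T / 2 ^ n)) - min T (real i * (T / 2 ^ n))) *\<^sub>R c i) =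
    (\<Sum>i<2 ^ n. (T / 2 ^ n) *\<^sub>R c i)"
  proof (rule sum.cong)
    fix i :: nat assume "i \<in> {..<2 ^ n}"
    then have "real (Suc i) \<le> real (2 ^ n)" by (intro of_nat_mono) simp
    then have "real (Suc i) * (T / 2 ^ n) \<le> real (2 ^ n) * (T / 2 ^ n)"
      using assms by (intro mult_right_mono) auto
    also have "\<dots> = T" by simp
    finally have "real (Suc i) * (T / 2 ^ n) \<le> T" .
    moreover have "real i * (T / 2 ^ n) \<le> real (Suc i) * (T / 2 ^ n)"
      using assms by (intro mult_right_mono) auto
    ultimately have "real (Suc i) * (T / 2 ^ n) \<le> T" "real i * (T / 2 ^ n) \<le> T" by linarith+
    then show "(min T (real (Suc i) * (T / 2 ^ n)) - min T (real i * (T / 2 ^ n))) *\<^sub>R c i = (T / 2 ^ n) *\<^sub>R c i"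
      by (simp add: min.absorb2 add_divide_distrib distrib_right)
  qed simp
  then show ?thesis
    using dyadic_step_has_integral[OF assms, of T n c] assms unfolding scaleR_sum_right by (simp only: less_imp_le)
qed

lemma simple_function_dyadic_step:
  assumes "T > 0"
  shows "simple_function (lebesgue_on {0..T}) (dyadic_step T n c)"
  unfolding simple_function_def
proof (intro conjI ballI)
  have "range (dyadic_step T n c) \<subseteq> insert 0 (c ` {..<2 ^ n})"
    using dyadic_index(1)[OF assms] by (auto simp: dyadic_step_def)
  then show "finite (dyadic_step T n c ` space (lebesgue_on {0..T}))"
    by (rule finite_subset[OF subset_trans[OF image_mono[OF subset_UNIV]]]) simp
next
  fix y
  define k where "k = (\<lambda>x::real. nat \<lfloor>x * 2 ^ n / T\<rfloor>)"
  define A where "A = k -` {i. c i = y}"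
  have "k \<in> borel \<rightarrow>\<^sub>M count_space UNIV" unfolding k_def by measurable
  then have A: "A \<in> sets borel" unfolding A_def by (rule measurable_sets_borel) simp
  have step: "dyadic_step T n c = (\<lambda>x. if x \<in> {0..<T} then c (k x) else 0)"
    by (simp add: fun_eq_iff dyadic_step_def k_def)
  define X where "X = {0..T} \<inter> (if y = 0 then ({0..<T} \<inter> A) \<union> - {0..<T} else {0..<T} \<inter> A)"
  have eq: "dyadic_step T n c -` {y} \<inter> space (lebesgue_on {0..T}) = X"
    unfolding step X_def by (auto simp: A_def space_restrict_space split: if_splits)
  have 1: "{0..<T} \<inter> A \<in> sets borel" using A by (intro sets.Int) auto
  have 2: "({0..<T} \<inter> A) \<union> - {0..<T} \<in> sets borel" using 1 by (intro sets.Un borel_comp) auto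
  have "X \<in> sets borel" unfolding X_def using 1 2 by (intro sets.Int) (auto split: if_split)
  then have "X \<in> sets lebesgue" using sets_completionI_sets[of X lborel] by simp
  moreover have "{0..T} \<inter> space lebesgue \<in> sets lebesgue" by simp
  moreover have "X \<subseteq> {0..T}" by (simp add: X_def)
  ultimately show "dyadic_step T n c -` {y} \<inter> space (lebesgue_on {0..T}) \<in> sets (lebesgue_on {0..T})"
    unfolding eq using sets_restrict_space_iff[of "{0..T}" lebesgue X] by blast
qed

lemma AE_lebesgue_on_negligible:
  assumes "AE x in lebesgue_on {a..b::real}. P x"
  obtains N where "negligible N" "\<And>x. x \<in> {a..b} - N \<Longrightarrow> P x"
proof -
  have "AE x in lebesgue. x \<in> {a..b} \<longrightarrow> P x"
    using assms by (subst (asm) AE_restrict_space_iff) auto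
  then obtain N where "N \<in> null_sets lebesgue" "{x \<in> space lebesgue. \<not> (x \<in> {a..b} \<longrightarrow> P x)} \<subseteq> N"
    unfolding eventually_ae_filter by blast
  then show thesis by (intro that[of N]) (auto simp: negligible_iff_null_sets)
qed

text \<open>
  The codomain is not assumed to be second countable, so the completeness of the Bochner space is
  not available from the library; the norms of the differences are real valued and can be handled there.
\<close>

lemma L1_limit_of_simple_functions:
  fixes G :: "nat \<Rightarrow> real \<Rightarrow> 'a::banach"
  assumes simple: "\<And>n. simple_function (lebesgue_on {0..T}) (G n)"
    and bound: "\<And>n x. x \<in> {0..T} \<Longrightarrow> norm (G n x) \<le> M"
    and diff: "\<And>n. (\<integral>x. norm (G (Suc n) x - G n x) \<partial>lebesgue_on {0..T}) \<le> b n"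
    and b: "summable b"
  obtains g where "AE x in lebesgue_on {0..T}. (\<lambda>n. G n x) \<longlonglongrightarrow> g x"
    and "bochner_integrable (lebesgue_on {0..T}) g"
    and "\<And>t J j. t \<in> {0..T} \<Longrightarrow> (\<And>n. (G n has_integral J n) {0..t}) \<Longrightarrow> J \<longlonglongrightarrow> j \<Longrightarrow>
      (g has_integral j) {0..t}"
proof -
  let ?L = "lebesgue_on {0..T}"
  interpret finite_measure ?L by (rule finite_measure_lebesgue_on) simp
  have sp: "space ?L = {0..T}" by (simp add: space_restrict_space)
  have meas: "(\<lambda>x. norm (G n x - G m x)) \<in> borel_measurable ?L" for n m
    by (rule borel_measurable_simple_function, rule simple_function_compose2[OF simple simple])
  have meas0: "(\<lambda>x. norm (G n x)) \<in> borel_measurable ?L" for n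
    by (rule borel_measurable_simple_function, rule simple_function_compose1[OF simple])
  have bd: "norm (G n x - G m x) \<le> 2 * M" if "x \<in> {0..T}" for n m x
    using norm_triangle_ineq4[of "G n x" "G m x"] bound[OF that, of n] bound[OF that, of m] by linarith
  have int: "integrable ?L (\<lambda>x. norm (G n x - G m x))" for n m
    by (rule integrable_const_bound[of _ "2 * M"]) (use bd meas in \<open>auto simp: sp intro!: AE_I2\<close>)
  \<comment> \<open>Total length of the path \<open>G 0 x, G 1 x, ...\<close>, possibly infinite.
    Its integral is at most the sum of \<open>b\<close>, so it is finite almost everywhere, and
    there completeness gives the limit.\<close>
  define D where "D x = (\<Sum>n. ennreal (norm (G (Suc n) x - G n x)))" for x
  have D_meas: "D \<in> borel_measurable ?L"
    unfolding D_def by (intro borel_measurable_suminf_order measurable_compose[OF meas] measurable_ennreal)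
  have "(\<integral>\<^sup>+x. D x \<partial>?L) = (\<Sum>n. \<integral>\<^sup>+x. ennreal (norm (G (Suc n) x - G n x)) \<partial>?L)"
    unfolding D_def by (intro nn_integral_suminf measurable_compose[OF meas] measurable_ennreal)
  also have "\<dots> = (\<Sum>n. ennreal (\<integral>x. norm (G (Suc n) x - G n x) \<partial>?L))"
    by (intro suminf_cong nn_integral_eq_integral int) auto
  also have "\<dots> \<le> (\<Sum>n. ennreal (b n))" by (intro suminf_le ennreal_leI diff) auto
  also have "\<dots> < \<infinity>"
  proof -
    have "0 \<le> b n" for n using diff[of n] by (rule order_trans[rotated]) simp
    then show ?thesis using b by (subst suminf_ennreal2) auto
  qed
  finally have "(\<integral>\<^sup>+x. D x \<partial>?L) \<noteq> \<infinity>" by simp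
  then have AE_D: "AE x in ?L. D x \<noteq> \<infinity>" by (rule nn_integral_PInf_AE[OF D_meas])
  define S where "S = {x \<in> space ?L. D x \<noteq> \<infinity>}"
  have [measurable]: "D \<in> borel_measurable ?L" by (rule D_meas)
  have S: "S \<in> sets ?L" unfolding S_def by measurable
  have AE_S: "AE x in ?L. x \<in> S" using AE_D AE_space by eventually_elim (simp add: S_def)
  have conv: "convergent (\<lambda>n. G n x)" if "x \<in> S" for x
  proof -
    have "summable (\<lambda>n. norm (G (Suc n) x - G n x))"
      using that by (intro summable_suminf_not_top) (auto simp: S_def D_def)
    then have "summable (\<lambda>n. G (Suc n) x - G n x)" by (rule summable_norm_cancel)
    then have "convergent (\<lambda>n. \<Sum>i<n. G (Suc i) x - G i x)"
      by (simp add: summable_iff_convergent)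
    then have "convergent (\<lambda>n. G n x - G 0 x)" by (simp only: sum_lessThan_telescope[of "\<lambda>i. G i x"])
    then have "convergent (\<lambda>n. (G n x - G 0 x) + G 0 x)" by (intro convergent_add convergent_const)
    then show ?thesis by simp
  qed
  define g where "g x = (if x \<in> S then lim (\<lambda>n. G n x) else 0)" for x
  have lim: "(\<lambda>n. G n x) \<longlonglongrightarrow> g x" if "x \<in> S" for x
    using conv[OF that] that by (simp add: g_def convergent_LIMSEQ_iff)
  have AE_lim: "AE x in ?L. (\<lambda>n. G n x) \<longlonglongrightarrow> g x" using AE_S by eventually_elim (rule lim)
  have M0: "0 \<le> M" if "x \<in> {0..T}" for x using bound[OF that, of 0] norm_ge_zero order_trans by blast
  have g_bound: "norm (g x) \<le> M" if "x \<in> {0..T}" for x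
  proof (cases "x \<in> S")
    case True
    show ?thesis by (rule Lim_bounded[OF tendsto_norm[OF lim[OF True]]]) (use bound that in auto)
  qed (use M0[OF that] in \<open>simp add: g_def\<close>)
  \<comment> \<open>Measurability of \<open>norm (g x)\<close> is obtained from a limit of real
    functions; the indicator of \<open>S\<close> makes this limit exist at every point.\<close>
  have lim_ind: "(\<lambda>n. indicator S x * norm (G n x)) \<longlonglongrightarrow> norm (g x)" for x
  proof (cases "x \<in> S")
    case True
    then show ?thesis using tendsto_norm[OF lim[OF True]] by simp
  qed (simp add: g_def)
  have g_meas: "(\<lambda>x. norm (g x)) \<in> borel_measurable ?L"
    by (rule borel_measurable_LIMSEQ_real[OF lim_ind]) (use S meas0 in measurable)
  have g_int: "integrable ?L (\<lambda>x. norm (g x))"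
    by (rule integrable_const_bound[of _ M]) (use g_bound g_meas in \<open>auto simp: sp intro!: AE_I2\<close>)
  have bochner: "bochner_integrable ?L g"
    unfolding bochner_integrable_def strongly_measurable_def
    using simple AE_lim g_int by blast
  \<comment> \<open>Agrees with \<open>norm (g x - G n x)\<close> on \<open>S\<close>, hence almost
    everywhere, and vanishes elsewhere, so that it converges to 0 at every point.\<close>
  define u where "u n x = indicator S x * norm (g x - G n x)" for n x
  have lim_u: "(\<lambda>m. indicator S x * norm (G m x - G n x)) \<longlonglongrightarrow> u n x" for n x
    by (cases "x \<in> S") (auto simp: u_def intro!: tendsto_norm tendsto_diff lim)
  have u_meas: "u n \<in> borel_measurable ?L" for n
    by (rule borel_measurable_LIMSEQ_real[OF lim_u]) (use S meas in measurable)
  have u_bound: "norm (u n x) \<le> 2 * M" if "x \<in> {0..T}" for n x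
    using norm_triangle_ineq4[of "g x" "G n x"] bound[OF that, of n] g_bound[OF that] M0[OF that]
    by (auto simp: u_def indicator_def)
  have u_int: "integrable ?L (u n)" for n
    by (rule integrable_const_bound[of _ "2 * M"]) (use u_bound u_meas in \<open>auto simp: sp intro!: AE_I2\<close>)
  have u_lim: "(\<lambda>n. u n x) \<longlonglongrightarrow> 0" for x
  proof (cases "x \<in> S")
    case True
    have "(\<lambda>n. norm (g x - G n x)) \<longlonglongrightarrow> norm (g x - g x)"
      by (intro tendsto_intros lim True)
    then show ?thesis using True by (simp add: u_def)
  qed (simp add: u_def)
  have "(\<lambda>n. \<integral>x. u n x \<partial>?L) \<longlonglongrightarrow> (\<integral>x. 0 \<partial>?L)"
    by (rule integral_dominated_convergence[where w="\<lambda>_. 2 * M"])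
       (use u_meas u_lim u_bound in \<open>auto simp: sp intro!: AE_I2\<close>)
  then have u_to_0: "(\<lambda>n. \<integral>x. u n x \<partial>?L) \<longlonglongrightarrow> 0" by simp
  have u_hk: "u n integrable_on {0..T}" "integral {0..T} (u n) = (\<integral>x. u n x \<partial>?L)" for n
    using integrable_on_lebesgue_on[OF u_int[of n]] lebesgue_integral_eq_integral[OF u_int[of n]] by simp_all
  obtain N where N: "negligible N" "\<And>x. x \<in> {0..T} - N \<Longrightarrow> x \<in> S"
    using AE_lebesgue_on_negligible[OF AE_S] by blast
  have "(g has_integral j) {0..t}"
    if t: "t \<in> {0..T}" and J: "\<And>n. (G n has_integral J n) {0..t}" "J \<longlonglongrightarrow> j" for t J j
  proof -
    have sub: "u n integrable_on {0..t}" for n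
      using u_hk(1) by (rule integrable_on_subinterval) (use t in auto)
    have le: "integral {0..t} (u n) \<le> (\<integral>x. u n x \<partial>?L)" for n
      unfolding u_hk(2)[symmetric]
      by (rule integral_subset_le) (use sub u_hk(1) t in \<open>auto simp: u_def\<close>)
    have ge: "0 \<le> integral {0..t} (u n)" for n
      by (rule integral_nonneg[OF sub]) (simp add: u_def)
    have "(g has_integral j) (cbox 0 t)"
    proof (rule has_integral_L1_limit)
      show "(G n has_integral J n) (cbox 0 t)" for n using J(1) by simp
      show "((\<lambda>x. norm (g x - G n x)) has_integral integral {0..t} (u n)) (cbox 0 t)" for n
      proof (rule has_integral_spike[OF N(1)])
        show "(u n has_integral integral {0..t} (u n)) (cbox 0 t)"
          using integrable_integral[OF sub] by simp
        fix x assume "x \<in> cbox 0 t - N"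
        then have "x \<in> S" using N(2) t by auto
        then show "norm (g x - G n x) = u n x" by (simp add: u_def)
      qed
      show "(\<lambda>n. integral {0..t} (u n)) \<longlonglongrightarrow> 0"
        by (rule tendsto_sandwich[OF _ _ tendsto_const u_to_0]) (use le ge in auto)
      show "J \<longlonglongrightarrow> j" by fact
    qed
    then show ?thesis by simp
  qed
  with AE_lim bochner show thesis by (rule that)
qed

section \<open>Dyadic difference quotients as a martingale\<close>

definition dyadic_slope :: "real \<Rightarrow> (real \<Rightarrow> 'a::real_vector) \<Rightarrow> nat \<Rightarrow> nat \<Rightarrow> 'a" where
  "dyadic_slope T f n i = (2 ^ n / T) *\<^sub>R (f (real (Suc i) * (T / 2 ^ n)) - f (real i * (T / 2 ^ n)))"

lemma dyadic_node_le:
  assumes "T > 0" "i \<le> 2 ^ n"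
  shows "real i * (T / 2 ^ n) \<le> T" "0 \<le> real i * (T / 2 ^ n)"
proof -
  have "real i \<le> real (2 ^ n)" using assms(2) by (rule of_nat_mono)
  then have "real i * (T / 2 ^ n) \<le> real (2 ^ n) * (T / 2 ^ n)"
    using assms(1) by (intro mult_right_mono) auto
  also have "\<dots> = T" by simp
  finally show "real i * (T / 2 ^ n) \<le> T" .
  show "0 \<le> real i * (T / 2 ^ n)" using assms(1) by (intro mult_nonneg_nonneg) auto
qed

lemma dyadic_slope_bound:
  fixes f :: "real \<Rightarrow> 'a::real_normed_vector"
  assumes T: "T > 0" and lip: "\<And>s t. 0 \<le> s \<Longrightarrow> s \<le> t \<Longrightarrow> t \<le> T \<Longrightarrow> norm (f t - f s) \<le> M * (t - s)"
    and i: "i < 2 ^ n"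
  shows "norm (dyadic_slope T f n i) \<le> M"
proof -
  let ?s = "real i * (T / 2 ^ n)" and ?t = "real (Suc i) * (T / 2 ^ n)"
  have d: "?t - ?s = T / 2 ^ n" by (simp add: algebra_simps add_divide_distrib)
  have "norm (f ?t - f ?s) \<le> M * (?t - ?s)"
    using dyadic_node_le[OF T, of i n] dyadic_node_le[OF T, of "Suc i" n] i d T
    by (intro lip) (auto simp: algebra_simps add_divide_distrib)
  then have "(2 ^ n / T) * norm (f ?t - f ?s) \<le> (2 ^ n / T) * (M * (T / 2 ^ n))"
    unfolding d using T by (intro mult_left_mono) auto
  moreover have "norm (dyadic_slope T f n i) = (2 ^ n / T) * norm (f ?t - f ?s)"
    unfolding dyadic_slope_def norm_scaleR using T by simp
  ultimately have "norm (dyadic_slope T f n i) \<le> (2 ^ n / T) * (M * (T / 2 ^ n))" by (simp only:)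
  also have "\<dots> = M" using T by simp
  finally show ?thesis .
qed

text \<open>The increments of \<open>f\<close> telescope over the subcells. This is the martingale
  property of the slopes.\<close>

lemma dyadic_slope_average:
  assumes T: "T > 0"
  shows "(\<Sum>k<2 ^ p. dyadic_slope T f (n + p) (j * 2 ^ p + k)) = 2 ^ p *\<^sub>R dyadic_slope T f n j"
proof -
  have node: "real (i * 2 ^ p) * (T / 2 ^ (n + p)) = real i * (T / 2 ^ n)" for i
    by (simp add: power_add field_simps)
  define F where "F k = f (real (j * 2 ^ p + k) * (T / 2 ^ (n + p)))" for k
  have "(\<Sum>k<2 ^ p. dyadic_slope T f (n + p) (j * 2 ^ p + k)) =
    (2 ^ (n + p) / T) *\<^sub>R (\<Sum>k<2 ^ p. F (Suc k) - F k)"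
    unfolding scaleR_sum_right dyadic_slope_def F_def add_Suc_right ..
  also have "(\<Sum>k<2 ^ p. F (Suc k) - F k) = F (2 ^ p) - F 0" by (rule sum_lessThan_telescope)
  also have "F (2 ^ p) = f (real (Suc j) * (T / 2 ^ n))"
    unfolding F_def node[of "Suc j", symmetric] by (simp add: algebra_simps)
  also have "F 0 = f (real j * (T / 2 ^ n))"
    unfolding F_def node[of j, symmetric] by simp
  finally show ?thesis by (simp add: dyadic_slope_def power_add)
qed

text \<open>Variance identity: after expanding the squares, the mixed term is determined by the
  mean. The Hilbert structure enters here.\<close>

lemma sum_norm_diff_average:
  fixes x :: "nat \<Rightarrow> 'a::real_inner"
  assumes "(\<Sum>k<N. x k) = real N *\<^sub>R m"
  shows "(\<Sum>k<N. (norm (x k - m))\<^sup>2) = (\<Sum>k<N. (norm (x k))\<^sup>2) - real N * (norm m)\<^sup>2"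
proof -
  have "(norm (x k - m))\<^sup>2 = (norm (x k))\<^sup>2 - 2 * (x k \<bullet> m) + (norm m)\<^sup>2" for k
    by (simp add: power2_norm_eq_inner inner_diff_left inner_diff_right inner_commute)
  then have "(\<Sum>k<N. (norm (x k - m))\<^sup>2) =
    (\<Sum>k<N. (norm (x k))\<^sup>2) - 2 * ((\<Sum>k<N. x k) \<bullet> m) + real N * (norm m)\<^sup>2"
    by (simp add: sum.distrib sum_subtractf inner_sum_left sum_distrib_left)
  also have "(\<Sum>k<N. x k) \<bullet> m = real N * (norm m)\<^sup>2"
    unfolding assms by (simp add: power2_norm_eq_inner)
  finally show ?thesis by simp
qed

text \<open>The squared \<open>L\<^sup>2\<close> norm of the step function formed from the slopes of
  level \<open>n\<close>.\<close>

definition dyadic_energy :: "real \<Rightarrow> (real \<Rightarrow> 'a::real_normed_vector) \<Rightarrow> nat \<Rightarrow> real" where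
  "dyadic_energy T f n = (T / 2 ^ n) * (\<Sum>i<2 ^ n. (norm (dyadic_slope T f n i))\<^sup>2)"

text \<open>Orthogonality of martingale increments, obtained from the variance identity on each
  coarse cell: the left side is the squared \<open>L\<^sup>2\<close> distance of two levels.\<close>

lemma dyadic_energy_diff:
  fixes f :: "real \<Rightarrow> 'a::real_inner"
  assumes T: "T > 0"
  shows "(T / 2 ^ (n + p)) * (\<Sum>i<2 ^ (n + p).
      (norm (dyadic_slope T f (n + p) i - dyadic_slope T f n (i div 2 ^ p)))\<^sup>2) =
    dyadic_energy T f (n + p) - dyadic_energy T f n"
proof -
  let ?d = "dyadic_slope T f (n + p)"
  have split: "(\<Sum>i<2 ^ (n + p). g i) = (\<Sum>j<2 ^ n. \<Sum>k<2 ^ p. g (j * 2 ^ p + k))" for g :: "nat \<Rightarrow> real"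
  proof -
    have "(\<Sum>i<2 ^ (n + p). g i) = (\<Sum>j<2 ^ n. sum g {j * 2 ^ p..<j * 2 ^ p + 2 ^ p})"
      unfolding power_add by (rule sum.nat_group[symmetric])
    also have "\<dots> = (\<Sum>j<2 ^ n. \<Sum>k<2 ^ p. g (j * 2 ^ p + k))"
    proof (rule sum.cong)
      fix j
      show "sum g {j * 2 ^ p..<j * 2 ^ p + 2 ^ p} = (\<Sum>k<2 ^ p. g (j * 2 ^ p + k))"
        using sum.atLeastLessThan_shift_0[of g "j * 2 ^ p" "j * 2 ^ p + 2 ^ p"]
        by (simp only: o_def add_diff_cancel_left' lessThan_atLeast0)
    qed simp
    finally show ?thesis .
  qed
  have "(\<Sum>i<2 ^ (n + p). (norm (?d i - dyadic_slope T f n (i div 2 ^ p)))\<^sup>2) =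
    (\<Sum>j<2 ^ n. \<Sum>k<2 ^ p. (norm (?d (j * 2 ^ p + k) - dyadic_slope T f n j))\<^sup>2)"
    unfolding split by (intro sum.cong) simp_all
  also have "\<dots> = (\<Sum>j<2 ^ n. (\<Sum>k<2 ^ p. (norm (?d (j * 2 ^ p + k)))\<^sup>2) - 2 ^ p * (norm (dyadic_slope T f n j))\<^sup>2)"
    using sum_norm_diff_average[of "\<lambda>k. ?d (_ * 2 ^ p + k)" "2 ^ p"] dyadic_slope_average[OF T, of f n p]
    by (intro sum.cong) simp_all
  also have "\<dots> = (\<Sum>i<2 ^ (n + p). (norm (?d i))\<^sup>2) - 2 ^ p * (\<Sum>j<2 ^ n. (norm (dyadic_slope T f n j))\<^sup>2)"
    by (simp only: split sum_subtractf sum_distrib_left)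
  finally have eq: "(\<Sum>i<2 ^ (n + p). (norm (?d i - dyadic_slope T f n (i div 2 ^ p)))\<^sup>2) =
    (\<Sum>i<2 ^ (n + p). (norm (?d i))\<^sup>2) - 2 ^ p * (\<Sum>j<2 ^ n. (norm (dyadic_slope T f n j))\<^sup>2)" .
  have "T / 2 ^ (n + p) * (2 ^ p * X) = T / 2 ^ n * X" for X :: real by (simp add: power_add)
  then show ?thesis unfolding eq dyadic_energy_def right_diff_distrib by simp
qed

lemma dyadic_energy_bound:
  fixes f :: "real \<Rightarrow> 'a::real_normed_vector"
  assumes T: "T > 0" and lip: "\<And>s t. 0 \<le> s \<Longrightarrow> s \<le> t \<Longrightarrow> t \<le> T \<Longrightarrow> norm (f t - f s) \<le> M * (t - s)"
  shows "dyadic_energy T f n \<le> T * M\<^sup>2"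
proof -
  have "(\<Sum>i<2 ^ n. (norm (dyadic_slope T f n i))\<^sup>2) \<le> (\<Sum>i<2 ^ n::nat. M\<^sup>2)"
    using dyadic_slope_bound[OF T lip] by (intro sum_mono power_mono) auto
  then have "dyadic_energy T f n \<le> (T / 2 ^ n) * (\<Sum>i<2 ^ n::nat. M\<^sup>2)"
    unfolding dyadic_energy_def using T by (intro mult_left_mono) auto
  then show ?thesis by simp
qed

lemma sum_le_sqrt:
  fixes x :: "nat \<Rightarrow> real"
  shows "(\<Sum>k<N. x k) \<le> sqrt (real N * (\<Sum>k<N. (x k)\<^sup>2))"
  using sum_squared_le_sum_of_squares[of x "{..<N}"] by (intro real_le_rsqrt) (simp add: mult.commute)

text \<open>The Cauchy-Schwarz inequality on an interval of length \<open>T\<close> converts the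
  energy gap into an \<open>L\<^sup>1\<close> bound.\<close>

lemma dyadic_step_diff_integral:
  fixes f :: "real \<Rightarrow> 'a::{real_inner, banach}"
  assumes T: "T > 0"
  defines "G \<equiv> \<lambda>n. dyadic_step T n (dyadic_slope T f n)"
  assumes int: "integrable (lebesgue_on {0..T}) (\<lambda>x. norm (G (n + p) x - G n x))"
  shows "(\<integral>x. norm (G (n + p) x - G n x) \<partial>lebesgue_on {0..T}) \<le>
    sqrt (T * (dyadic_energy T f (n + p) - dyadic_energy T f n))"
proof -
  define c where "c i = norm (dyadic_slope T f (n + p) i - dyadic_slope T f n (i div 2 ^ p))" for i
  have "(\<lambda>x. norm (G (n + p) x - G n x)) = dyadic_step T (n + p) c"
    unfolding G_def dyadic_step_def c_def using dyadic_index_coarsen[OF T, of _ n p] by auto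
  then have "(\<integral>x. norm (G (n + p) x - G n x) \<partial>lebesgue_on {0..T}) =
      T / 2 ^ (n + p) * (\<Sum>i<2 ^ (n + p). c i)"
    using has_integral_unique[OF has_integral_integral_lebesgue_on[OF int]] dyadic_step_has_integral_full[OF T, of "n + p" c]
    by simp
  also have "\<dots> \<le> T / 2 ^ (n + p) * sqrt (2 ^ (n + p) * (\<Sum>i<2 ^ (n + p). (c i)\<^sup>2))"
    using sum_le_sqrt[of c "2 ^ (n + p)"] T by (intro mult_left_mono) auto
  also have "\<dots> = sqrt ((T / 2 ^ (n + p))\<^sup>2 * (2 ^ (n + p) * (\<Sum>i<2 ^ (n + p). (c i)\<^sup>2)))"
    using T by (simp only: real_sqrt_mult real_sqrt_abs) simp
  also have "(T / 2 ^ (n + p))\<^sup>2 * (2 ^ (n + p) * (\<Sum>i<2 ^ (n + p). (c i)\<^sup>2)) =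
    T * (T / 2 ^ (n + p) * (\<Sum>i<2 ^ (n + p). (c i)\<^sup>2))"
  proof -
    have *: "(T / N)\<^sup>2 * (N * X) = T * (T / N * X)" if "N \<noteq> 0" for N X :: real
      using that by (simp add: power2_eq_square)
    show ?thesis by (rule *) simp
  qed
  also have "T / 2 ^ (n + p) * (\<Sum>i<2 ^ (n + p). (c i)\<^sup>2) = dyadic_energy T f (n + p) - dyadic_energy T f n"
    unfolding c_def by (rule dyadic_energy_diff[OF T])
  finally show ?thesis .
qed

text \<open>
  The Radon-Nikodym property of Hilbert spaces for Lipschitz curves: the dyadic difference quotients are
  a bounded martingale, hence Cauchy in \<open>L\<^sup>2\<close> by orthogonality of increments, and a subsequence converges
  almost everywhere.
\<close>

theorem lipschitz_curve_has_W11_derivative: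
  fixes f :: "real \<Rightarrow> 'a::{real_inner, banach}"
  assumes T: "T > 0" and lip: "\<And>s t. 0 \<le> s \<Longrightarrow> s \<le> t \<Longrightarrow> t \<le> T \<Longrightarrow> norm (f t - f s) \<le> M * (t - s)"
  obtains g r where "has_W11_derivative T f g" and "strict_mono (r :: nat \<Rightarrow> nat)"
    and "AE x in lebesgue_on {0..T}. (\<lambda>j. dyadic_step T (r j) (dyadic_slope T f (r j)) x) \<longlonglongrightarrow> g x"
proof -
  define e where "e = dyadic_energy T f"
  define G where "G n = dyadic_step T n (dyadic_slope T f n)" for n
  have "norm (f T - f 0) \<le> M * T" using lip[of 0 T] T by simp
  then have "0 \<le> M * T" by (rule order_trans[OF norm_ge_zero])
  then have M: "M \<ge> 0" using T by (simp add: zero_le_mult_iff)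
  have inc: "incseq e"
  proof (rule incseq_SucI)
    fix n
    have "0 \<le> (T / 2 ^ (n + 1)) * (\<Sum>i<2 ^ (n + 1).
      (norm (dyadic_slope T f (n + 1) i - dyadic_slope T f n (i div 2 ^ 1)))\<^sup>2)"
      using T by (intro mult_nonneg_nonneg sum_nonneg) auto
    then show "e n \<le> e (Suc n)" unfolding dyadic_energy_diff[OF T] e_def by simp
  qed
  obtain E where E: "e \<longlonglongrightarrow> E" "\<And>n. e n \<le> E"
    using incseq_convergent[OF inc, of "T * M\<^sup>2"] dyadic_energy_bound[OF T lip] unfolding e_def by blast
  \<comment> \<open>The energies increase to \<open>E\<close>. A gap below \<open>(1/4) ^ j\<close>
    makes the \<open>L\<^sup>1\<close> distance of consecutive selected levels at most
    \<open>sqrt T * (1/2) ^ j\<close>, which is summable.\<close>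
  have ex: "\<exists>n>m. E - e n < (1/4) ^ j" for m j
  proof -
    have "\<forall>\<^sub>F n in sequentially. e n > E - (1/4) ^ j" using E(1) by (rule order_tendstoD) simp
    then obtain N where "\<And>n. n \<ge> N \<Longrightarrow> e n > E - (1/4) ^ j" by (auto simp: eventually_sequentially)
    from this[of "max N (Suc m)"] show ?thesis by (intro exI[of _ "max N (Suc m)"]) auto
  qed
  have "\<exists>r. \<forall>j. E - e (r j) < (1/4) ^ j \<and> r j < r (Suc j)"
    by (rule dependent_nat_choice) (use ex in blast)+
  then obtain r where r: "\<And>j. E - e (r j) < (1/4) ^ j" "\<And>j. r j < r (Suc j)" by blast
  have simple: "simple_function (lebesgue_on {0..T}) (G n)" for n
    unfolding G_def by (rule simple_function_dyadic_step[OF T])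
  have bound: "norm (G n x) \<le> M" for n x
    unfolding G_def dyadic_step_def using dyadic_slope_bound[OF T lip dyadic_index(1)[OF T]] M by auto
  have int: "integrable (lebesgue_on {0..T}) (\<lambda>x. norm (G n x - G m x))" for n m
  proof (rule finite_measure.integrable_const_bound[of _ _ "2 * M"])
    show "finite_measure (lebesgue_on {0..T})" by (rule finite_measure_lebesgue_on) simp
    show "(\<lambda>x. norm (G n x - G m x)) \<in> borel_measurable (lebesgue_on {0..T})"
      by (rule borel_measurable_simple_function, rule simple_function_compose2[OF simple simple])
    show "AE x in lebesgue_on {0..T}. norm (norm (G n x - G m x)) \<le> 2 * M"
    proof (rule AE_I2)
      fix x show "norm (norm (G n x - G m x)) \<le> 2 * M"
        using norm_triangle_ineq4[of "G n x" "G m x"] bound[of n x] bound[of m x] by simp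
    qed
  qed
  have diff: "(\<integral>x. norm (G (r (Suc j)) x - G (r j) x) \<partial>lebesgue_on {0..T}) \<le> sqrt T * (1/2) ^ j" for j
  proof -
    define p where "p = r (Suc j) - r j"
    have p: "r (Suc j) = r j + p" using r(2)[of j] by (simp add: p_def)
    have "(\<integral>x. norm (G (r (Suc j)) x - G (r j) x) \<partial>lebesgue_on {0..T}) \<le> sqrt (T * (e (r (Suc j)) - e (r j)))"
      using dyadic_step_diff_integral[OF T, of "r j" p f] int[of "r (Suc j)" "r j"] unfolding p G_def e_def by blast
    also have "\<dots> \<le> sqrt (T * (1/4) ^ j)"
      using r(1)[of j] E(2)[of "r (Suc j)"] T by (intro real_sqrt_le_mono mult_left_mono) auto
    also have "\<dots> = sqrt T * (1/2) ^ j"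
    proof -
      have "sqrt ((1/4) ^ j) = sqrt (1/4) ^ j" by (rule real_sqrt_power)
      also have "sqrt (1/4) = 1/2" by (rule real_sqrt_unique) (auto simp: power2_eq_square)
      finally show ?thesis by (simp add: real_sqrt_mult)
    qed
    finally show ?thesis .
  qed
  have "summable (\<lambda>j. sqrt T * (1/2) ^ j)" by (intro summable_mult summable_geometric) simp
  from L1_limit_of_simple_functions[of T "\<lambda>j. G (r j)" M, OF simple bound diff this]
  obtain g where AE: "AE x in lebesgue_on {0..T}. (\<lambda>j. G (r j) x) \<longlonglongrightarrow> g x"
    and boch: "bochner_integrable (lebesgue_on {0..T}) g"
    and int_lim: "\<And>t J j. t \<in> {0..T} \<Longrightarrow> (\<And>n. (G (r n) has_integral J n) {0..t}) \<Longrightarrow> J \<longlonglongrightarrow> j \<Longrightarrow>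
      (g has_integral j) {0..t}"
    by blast
  have sm: "strict_mono r" using r(2) by (rule strict_monoI_Suc)
  have "(g has_integral (f t - f 0)) {0..t}" if t: "t \<in> {0..T}" for t
  proof -
    \<comment> \<open>\<open>f 0 + J n\<close> is the piecewise affine interpolant of
      \<open>f\<close> at the nodes of level \<open>n\<close>, evaluated at
      \<open>t\<close>.\<close>
    define J where "J n = (\<Sum>i<2 ^ n. (min t (real (Suc i) * (T / 2 ^ n)) - min t (real i * (T / 2 ^ n))) *\<^sub>R
      dyadic_slope T f n i)" for n :: nat
    have near: "norm (J n - (f t - f 0)) \<le> 2 * M * (T / 2 ^ n)" for n
    proof -
      define h where "h = T / 2 ^ n"
      have h: "h > 0" using T by (simp add: h_def)
      have Th: "T = real (2 ^ n) * h" by (simp add: h_def)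
      \<comment> \<open>Index of a cell containing \<open>t\<close>; for \<open>t = T\<close> this
        has to be the last one.\<close>
      define q where "q = (if t < T then nat \<lfloor>t * 2 ^ n / T\<rfloor> else 2 ^ n - 1)"
      have q: "q < 2 ^ n" "real q * h \<le> t" "t \<le> real (Suc q) * h"
      proof -
        show "q < 2 ^ n" using dyadic_index(1)[OF T, of t n] t by (auto simp: q_def)
        show "real q * h \<le> t"
        proof (cases "t < T")
          case True
          then show ?thesis using dyadic_index(2)[OF T, of t n] t by (simp add: q_def h_def)
        next
          case False
          then show ?thesis using dyadic_node_le(1)[OF T, of q n] t by (simp add: q_def h_def)
        qed
        show "t \<le> real (Suc q) * h"
        proof (cases "t < T")
          case True
          then show ?thesis using dyadic_index(3)[OF T, of t n] t by (simp add: q_def h_def)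
        next
          case False
          then have "Suc q = 2 ^ n" by (simp add: q_def)
          then show ?thesis using t Th by auto
        qed
      qed
      define c where "c i = (min t (real (Suc i) * h) - min t (real i * h)) *\<^sub>R dyadic_slope T f n i" for i
      have Jc: "J n = (\<Sum>i<2 ^ n. c i)" unfolding J_def c_def h_def ..
      have "(\<Sum>i<2 ^ n. c i) = (\<Sum>i<Suc q. c i)"
      proof (rule sum.mono_neutral_right)
        show "\<forall>i\<in>{..<2 ^ n} - {..<Suc q}. c i = 0"
        proof
          fix i assume "i \<in> {..<2 ^ n} - {..<Suc q}"
          then have "real (Suc q) * h \<le> real i * h" using h by (intro mult_right_mono of_nat_mono) auto
          moreover have "real i * h \<le> real (Suc i) * h" using h by (intro mult_right_mono of_nat_mono) auto
          ultimately show "c i = 0" using q(3) by (simp add: c_def)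
        qed
      qed (use q(1) in auto)
      also have "\<dots> = (\<Sum>i<q. c i) + c q" by simp
      also have "(\<Sum>i<q. c i) = (\<Sum>i<q. f (real (Suc i) * h) - f (real i * h))"
      proof (rule sum.cong)
        fix i assume "i \<in> {..<q}"
        then have "real (Suc i) * h \<le> real q * h" using h by (intro mult_right_mono of_nat_mono) auto
        moreover have i: "real i * h \<le> real (Suc i) * h" using h by (intro mult_right_mono of_nat_mono) auto
        ultimately have "min t (real (Suc i) * h) - min t (real i * h) = h"
          using q(2) by (simp add: algebra_simps)
        then have "c i = h *\<^sub>R dyadic_slope T f n i" by (simp only: c_def)
        then show "c i = f (real (Suc i) * h) - f (real i * h)"
          using T by (simp add: dyadic_slope_def h_def)
      qed simp
      also have "\<dots> = f (real q * h) - f 0"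
        using sum_lessThan_telescope[of "\<lambda>i. f (real i * h)" q] by simp
      finally have J: "J n - (f t - f 0) = c q - (f t - f (real q * h))" using Jc by simp
      have len: "t - real q * h \<le> h" "0 \<le> t - real q * h" using q(2,3) by (auto simp: algebra_simps)
      have "norm (c q) \<le> h * M"
      proof -
        have "c q = (t - real q * h) *\<^sub>R dyadic_slope T f n q" using q(2,3) by (simp add: c_def)
        then have "norm (c q) = (t - real q * h) * norm (dyadic_slope T f n q)" using len by simp
        also have "\<dots> \<le> h * M" using len h dyadic_slope_bound[OF T lip q(1)] by (intro mult_mono) auto
        finally show ?thesis .
      qed
      moreover have "norm (f t - f (real q * h)) \<le> M * h"
      proof -
        have "norm (f t - f (real q * h)) \<le> M * (t - real q * h)" using q(2) h t by (intro lip) auto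
        also have "\<dots> \<le> M * h" using len M by (intro mult_left_mono) auto
        finally show ?thesis .
      qed
      ultimately show ?thesis
        unfolding J h_def[symmetric] using norm_triangle_ineq4[of "c q" "f t - f (real q * h)"]
        by (simp add: algebra_simps)
    qed
    have "(\<lambda>n. 2 * M * (T / 2 ^ n)) \<longlonglongrightarrow> 0"
    proof -
      have "(\<lambda>n. 2 * M * T * (1 / 2) ^ n) \<longlonglongrightarrow> 2 * M * T * 0"
        by (intro tendsto_intros LIMSEQ_power_zero) simp
      then show ?thesis by (simp add: power_divide)
    qed
    then have "(\<lambda>n. J n - (f t - f 0)) \<longlonglongrightarrow> 0"
      by (rule Lim_null_comparison[rotated]) (use near in auto)
    then have "J \<longlonglongrightarrow> f t - f 0" by (simp add: LIM_zero_iff)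
    then have Jr: "(\<lambda>j. J (r j)) \<longlonglongrightarrow> f t - f 0"
      using LIMSEQ_subseq_LIMSEQ[OF _ sm] by (simp add: o_def)
    have "(G (r j) has_integral J (r j)) {0..t}" for j
      unfolding G_def J_def using t by (intro dyadic_step_has_integral[OF T]) auto
    then show ?thesis using Jr by (rule int_lim[OF t])
  qed
  then have "has_W11_derivative T f g" using boch by (simp add: has_W11_derivative_def)
  then show thesis using sm AE unfolding G_def by (rule that)
qed

section \<open>Comparison of approximate solutions\<close>

text \<open>\<open>E\<close> is the energy without the load, with first and second derivatives
  \<open>\<Phi>\<close> and \<open>B\<close>; the load is a curve \<open>m\<close> in the dual and
  appears later as \<open>\<Phi> z - m t\<close>. \<open>S\<close> is the dissipation pulled back to
  Z, and \<open>\<rho>\<close> provides its continuity.\<close>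

locale convex_rate_independent =
  fixes E :: "'z::banach \<Rightarrow> real" and \<Phi> :: "'z \<Rightarrow> ('z \<Rightarrow>\<^sub>L real)" and B :: "'z \<Rightarrow> ('z \<Rightarrow>\<^sub>L 'z \<Rightarrow>\<^sub>L real)"
    and S :: "'z \<Rightarrow> real" and \<kappa> \<rho> :: real
  assumes E_deriv: "\<And>z. (E has_derivative blinfun_apply (\<Phi> z)) (at z)"
    and \<Phi>_deriv: "\<And>z. (\<Phi> has_derivative blinfun_apply (B z)) (at z)"
    and \<kappa>: "\<kappa> > 0" and B_coercive: "\<And>z v. B z v v \<ge> \<kappa> * (norm v)\<^sup>2"
    and S_add: "\<And>u v. S (u + v) \<le> S u + S v"
    and S_scale: "\<And>c v. c \<ge> 0 \<Longrightarrow> S (c *\<^sub>R v) = c * S v"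
    and S_nonneg: "\<And>v. S v \<ge> 0" and S_bound: "\<And>v. S v \<le> \<rho> * norm v"
begin

lemma B_symmetric: "B z u v = B z v u"
  by (rule symmetric_second_derivative[OF E_deriv \<Phi>_deriv])

lemma S_zero [simp]: "S 0 = 0"
  using S_scale[of 0 0] by simp

lemma S_lipschitz: "\<bar>S u - S v\<bar> \<le> \<rho> * norm (u - v)"
  using S_add[of "u - v" v] S_add[of "v - u" u] S_bound[of "u - v"] S_bound[of "v - u"]
  by (simp add: norm_minus_commute)

lemma continuous_on_S: "continuous_on A S"
proof -
  have "\<bar>\<rho>\<bar>-lipschitz_on UNIV S"
    unfolding lipschitz_on_def dist_norm real_norm_def
    using order_trans[OF S_lipschitz mult_right_mono[OF abs_ge_self norm_ge_zero]] by simp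
  then show ?thesis using continuous_on_subset lipschitz_on_continuous_on by blast
qed

lemma continuous_on_\<Phi>: "continuous_on A \<Phi>"
  by (rule has_derivative_continuous_on[OF has_derivative_at_withinI[OF \<Phi>_deriv]])

lemma \<Phi>_strongly_monotone: "(\<Phi> y - \<Phi> x) (y - x) \<ge> \<kappa> * (norm (y - x))\<^sup>2"
proof -
  define g where "g s = \<Phi> (x + s *\<^sub>R (y - x)) (y - x)" for s
  have dg: "(g has_real_derivative B (x + s *\<^sub>R (y - x)) (y - x) (y - x)) (at s)" for s
    unfolding g_def has_field_derivative_def
    by (auto intro!: derivative_eq_intros has_derivative_compose[OF _ \<Phi>_deriv]
        simp: blinfun.scaleR_right blinfun.scaleR_left fun_eq_iff)
  obtain s where "0 < s" "s < 1" "g 1 - g 0 = (1 - 0) * B (x + s *\<^sub>R (y - x)) (y - x) (y - x)"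
    using MVT2[of 0 1 g "\<lambda>s. B (x + s *\<^sub>R (y - x)) (y - x) (y - x)"] dg by auto
  then show ?thesis using B_coercive by (simp add: g_def blinfun.diff_left)
qed

lemma E_strongly_convex: "E y \<ge> E x + \<Phi> x (y - x) + \<kappa> / 2 * (norm (y - x))\<^sup>2"
proof -
  define v where "v = y - x"
  define g where "g s = E (x + s *\<^sub>R v) - s * \<Phi> x v - \<kappa> / 2 * s\<^sup>2 * (norm v)\<^sup>2" for s
  define g' where "g' s = \<Phi> (x + s *\<^sub>R v) v - \<Phi> x v - \<kappa> * s * (norm v)\<^sup>2" for s
  have dg: "(g has_real_derivative g' s) (at s)" for s
    unfolding g_def g'_def has_field_derivative_def
    by (auto intro!: derivative_eq_intros has_derivative_compose[OF _ E_deriv]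
        simp: blinfun.scaleR_right algebra_simps fun_eq_iff power2_eq_square)
  obtain s where s: "0 < s" "s < 1" "g 1 - g 0 = (1 - 0) * g' s"
    using MVT2[of 0 1 g g'] dg by auto
  \<comment> \<open>Strong monotonicity between \<open>x\<close> and
    \<open>x + s *\<^sub>R v\<close>; the difference \<open>s *\<^sub>R v\<close> is the origin of
    the extra factor \<open>s\<close>.\<close>
  have "s * (g' s) \<ge> 0"
    using \<Phi>_strongly_monotone[where x=x and y="x + s *\<^sub>R v"] s
    by (simp add: g'_def blinfun.scaleR_right blinfun.diff_left algebra_simps power2_eq_square)
  then have "g 1 \<ge> g 0" using s by (simp add: zero_le_mult_iff)
  then show ?thesis by (simp add: g_def v_def)
qed

definition incl :: "'z \<Rightarrow> ('z \<Rightarrow>\<^sub>L real) \<Rightarrow> bool" where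
  "incl w \<xi> \<longleftrightarrow> (\<forall>v. S v \<ge> S w - \<xi> (v - w))"

text \<open>For a functional of degree one the inclusion splits into stability (test with
  \<open>w + v\<close> and use subadditivity) and energy balance (test with 0). Most later arguments
  use this form.\<close>

lemma incl_iff: "incl w \<xi> \<longleftrightarrow> (\<forall>v. \<xi> v + S v \<ge> 0) \<and> S w + \<xi> w \<le> 0"
proof
  assume i: "incl w \<xi>"
  have "\<xi> v + S v \<ge> 0" for v
    using i[unfolded incl_def, rule_format, of "w + v"] S_add[of w v] by simp
  moreover have "S w + \<xi> w \<le> 0"
    using i[unfolded incl_def, rule_format, of 0] by (simp add: blinfun.minus_right)
  ultimately show "(\<forall>v. \<xi> v + S v \<ge> 0) \<and> S w + \<xi> w \<le> 0" by blast
next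
  assume "(\<forall>v. \<xi> v + S v \<ge> 0) \<and> S w + \<xi> w \<le> 0"
  then show "incl w \<xi>" unfolding incl_def by (smt (verit) blinfun.diff_right)
qed

definition regular_on_ball :: "real \<Rightarrow> real \<Rightarrow> real \<Rightarrow> bool" where
  "regular_on_ball r b c \<longleftrightarrow> b \<ge> 0 \<and> c \<ge> 0 \<and> (\<forall>z\<in>ball 0 r. norm (B z) \<le> b) \<and>
     (\<forall>z1\<in>ball 0 r. \<forall>z2\<in>ball 0 r. norm (B z1 - B z2) \<le> c * norm (z1 - z2))"

lemma \<Phi>_lipschitz:
  assumes "regular_on_ball r b c" "x \<in> ball 0 r" "y \<in> ball 0 r"
  shows "norm (\<Phi> x - \<Phi> y) \<le> b * norm (x - y)"
proof (rule differentiable_bound)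
  show "convex (ball (0::'z) r)" by simp
  show "(\<Phi> has_derivative blinfun_apply (B z)) (at z within ball 0 r)" for z
    using \<Phi>_deriv by (rule has_derivative_at_withinI)
  show "onorm (blinfun_apply (B z)) \<le> b" if "z \<in> ball 0 r" for z
    using assms(1) that by (simp add: regular_on_ball_def flip: norm_blinfun.rep_eq)
qed (use assms in auto)

lemma \<Phi>_taylor:
  assumes r: "regular_on_ball r b c" "x \<in> ball 0 r" "y \<in> ball 0 r"
  shows "norm (\<Phi> y - \<Phi> x - B x (y - x)) \<le> c * (norm (y - x))\<^sup>2"
proof -
  have seg: "closed_segment x y \<subseteq> ball 0 r"
    using r by (simp add: closed_segment_subset)
  have "norm (\<Phi> y - \<Phi> x - B x (y - x)) \<le> norm (y - x) * (c * norm (y - x))"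
  proof (rule differentiable_bound_linearization[where S="closed_segment x y" and f'="\<lambda>z. blinfun_apply (B z)"])
    show "x + t *\<^sub>R (y - x) \<in> closed_segment x y" if "t \<in> {0..1}" for t
      using that by (auto simp: closed_segment_def algebra_simps intro!: exI[of _ t])
    show "(\<Phi> has_derivative blinfun_apply (B z)) (at z within closed_segment x y)" for z
      using \<Phi>_deriv by (rule has_derivative_at_withinI)
    fix z assume z: "z \<in> closed_segment x y"
    have "norm (B z - B x) \<le> c * norm (z - x)"
      using r z seg by (auto simp: regular_on_ball_def)
    also have "\<dots> \<le> c * norm (y - x)"
      using segment_bound(1)[OF z] r by (intro mult_left_mono) (auto simp: regular_on_ball_def)
    finally show "onorm (blinfun_apply (B z) - blinfun_apply (B x)) \<le> c * norm (y - x)"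
      by (simp add: norm_blinfun.rep_eq minus_blinfun.rep_eq fun_diff_def)
  qed simp
  then show ?thesis by (simp add: power2_eq_square mult.left_commute)
qed

text \<open>
  Curves satisfying stability up to \<open>\<omega>\<close> and the energy balance up to the increments of \<open>\<Omega>\<close> and
  to second order in the clock \<open>\<sigma>\<close>. Both solutions and interpolated discrete solutions are of this kind,
  and any two of them can be compared.
\<close>

definition approx_solution ::
  "real \<Rightarrow> (real \<Rightarrow> ('z \<Rightarrow>\<^sub>L real)) \<Rightarrow> (real \<Rightarrow> real) \<Rightarrow> real \<Rightarrow> (real \<Rightarrow> real) \<Rightarrow> (real \<Rightarrow> real) \<Rightarrow> (real \<Rightarrow> 'z) \<Rightarrow> bool"
  where
  "approx_solution T m \<sigma> k \<omega> \<Omega> u \<longleftrightarrow>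
     (\<forall>s t. 0 \<le> s \<and> s \<le> t \<and> t \<le> T \<longrightarrow> norm (u t - u s) \<le> \<sigma> t - \<sigma> s \<and> \<Omega> s \<le> \<Omega> t) \<and>
     (\<forall>s v. 0 \<le> s \<and> s < T \<longrightarrow> 0 \<le> \<omega> s \<and> (\<Phi> (u s) - m s) v + S v \<ge> - \<omega> s * norm v) \<and>
     (\<forall>s. 0 \<le> s \<and> s < T \<longrightarrow> (\<exists>\<delta>>0. \<forall>t. s < t \<and> t < s + \<delta> \<and> t \<le> T \<longrightarrow>
        S (u t - u s) + (\<Phi> (u s) - m s) (u t - u s) \<le> k * (\<sigma> t - \<sigma> s)\<^sup>2 + (\<Omega> t - \<Omega> s) \<and>
        \<omega> s * (\<sigma> t - \<sigma> s) \<le> \<Omega> t - \<Omega> s))"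

lemma approx_solutionD:
  assumes "approx_solution T m \<sigma> k \<omega> \<Omega> u"
  shows "0 \<le> s \<Longrightarrow> s \<le> t \<Longrightarrow> t \<le> T \<Longrightarrow> norm (u t - u s) \<le> \<sigma> t - \<sigma> s"
    and "0 \<le> s \<Longrightarrow> s \<le> t \<Longrightarrow> t \<le> T \<Longrightarrow> \<Omega> s \<le> \<Omega> t"
    and "0 \<le> s \<Longrightarrow> s < T \<Longrightarrow> 0 \<le> \<omega> s"
    and "0 \<le> s \<Longrightarrow> s < T \<Longrightarrow> (\<Phi> (u s) - m s) v + S v \<ge> - \<omega> s * norm v"
    and "0 \<le> s \<Longrightarrow> s < T \<Longrightarrow> \<exists>\<delta>>0. \<forall>t. s < t \<and> t < s + \<delta> \<and> t \<le> T \<longrightarrow>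
        S (u t - u s) + (\<Phi> (u s) - m s) (u t - u s) \<le> k * (\<sigma> t - \<sigma> s)\<^sup>2 + (\<Omega> t - \<Omega> s) \<and>
        \<omega> s * (\<sigma> t - \<sigma> s) \<le> \<Omega> t - \<Omega> s"
  using assms[unfolded approx_solution_def, THEN conjunct1, rule_format, of s t]
    assms[unfolded approx_solution_def, THEN conjunct2, THEN conjunct1, rule_format, of s v]
    assms[unfolded approx_solution_def, THEN conjunct2, THEN conjunct2, rule_format, of s]
  by simp_all

text \<open>Symmetry of \<open>B\<close> and Taylor bounds replace the change of
  \<open>\<Phi> (u) - \<Phi> (w)\<close> paired with \<open>u - w\<close> by
  \<open>\<Phi> (u) - \<Phi> (w)\<close> paired with the change of \<open>u - w\<close>. The latter
  is bounded by testing the energy balance of each curve against the stability of the other, and a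
  Gronwall inequality in the clock remains.\<close>

theorem approx_solution_comparison:
  assumes T: "0 \<le> T" and reg: "regular_on_ball r b c" and k: "0 \<le> k"
    and \<sigma>: "continuous_on {0..T} \<sigma>"
    and u: "approx_solution T m \<sigma> k \<omega>1 \<Omega>1 u" and w: "approx_solution T m \<sigma> k \<omega>2 \<Omega>2 w"
    and ur: "\<And>t. t \<in> {0..T} \<Longrightarrow> u t \<in> ball 0 r" and wr: "\<And>t. t \<in> {0..T} \<Longrightarrow> w t \<in> ball 0 r"
    and init: "u 0 = w 0" and t: "t \<in> {0..T}"
  shows "\<kappa> * (norm (u t - w t))\<^sup>2 \<le> exp ((2 * c / \<kappa> + 4 * r * c + 4 * b + 4 * k) * (\<sigma> T - \<sigma> 0)) *
    (4 * ((\<Omega>1 t - \<Omega>1 0) + (\<Omega>2 t - \<Omega>2 0)))"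
proof -
  \<comment> \<open>\<open>2 * c / \<kappa>\<close> stems from the Taylor errors
    \<open>c * (norm x)\<^sup>2 * d\<close> with
    \<open>(norm x)\<^sup>2 \<le> \<gamma> / \<kappa>\<close>, \<open>4 * r * c\<close> from those
    of order \<open>d\<^sup>2\<close> paired with \<open>x\<close> of norm at most
    \<open>2 * r\<close>, \<open>4 * b\<close> from the product of increments, and
    \<open>4 * k\<close> from the quadratic error of the energy balance.\<close>
  define C where "C = 2 * c / \<kappa> + 4 * r * c + 4 * b + 4 * k"
  define \<gamma> where "\<gamma> t = (\<Phi> (u t) - \<Phi> (w t)) (u t - w t)" for t
  have b0: "b \<ge> 0" and c0: "c \<ge> 0" using reg by (auto simp: regular_on_ball_def)
  have r0: "r > 0" using ur[of 0] T by (auto intro: le_less_trans[OF norm_ge_zero])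
  have \<gamma>_ge: "\<gamma> s \<ge> \<kappa> * (norm (u s - w s))\<^sup>2" for s
    unfolding \<gamma>_def by (rule \<Phi>_strongly_monotone)
  have \<gamma>0: "\<gamma> s \<ge> 0" for s using \<gamma>_ge[of s] \<kappa> by (meson mult_nonneg_nonneg less_imp_le order_trans zero_le_power2)
  have clock: "norm (u t - u s) \<le> \<sigma> t - \<sigma> s" "norm (w t - w s) \<le> \<sigma> t - \<sigma> s" "\<Omega>1 s \<le> \<Omega>1 t" "\<Omega>2 s \<le> \<Omega>2 t"
    if "0 \<le> s" "s \<le> t" "t \<le> T" for s t
    using approx_solutionD(1,2)[OF u that] approx_solutionD(1,2)[OF w that] by simp_all
  have \<sigma>_mono: "\<sigma> s \<le> \<sigma> t" if "0 \<le> s" "s \<le> t" "t \<le> T" for s t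
    using clock(1)[OF that] norm_ge_zero[of "u t - u s"] by linarith
  have cont: "continuous_on {0..T} v" if v: "\<And>s t. 0 \<le> s \<Longrightarrow> s \<le> t \<Longrightarrow> t \<le> T \<Longrightarrow> norm (v t - v s) \<le> \<sigma> t - \<sigma> s"
    for v :: "real \<Rightarrow> 'z"
    unfolding continuous_on_iff
  proof (intro ballI allI impI)
    fix x e :: real assume x: "x \<in> {0..T}" and e: "e > 0"
    obtain d where d: "d > 0" "\<And>y. y \<in> {0..T} \<Longrightarrow> dist y x < d \<Longrightarrow> dist (\<sigma> y) (\<sigma> x) < e"
      using \<sigma> x e unfolding continuous_on_iff by blast
    have "dist (v y) (v x) < e" if y: "y \<in> {0..T}" "dist y x < d" for y
    proof -
      have "dist (v y) (v x) \<le> dist (\<sigma> y) (\<sigma> x)"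
      proof (cases "x \<le> y")
        case True
        then show ?thesis using v[of x y] x y by (simp add: dist_norm)
      next
        case False
        then show ?thesis using v[of y x] x y by (simp add: dist_norm norm_minus_commute)
      qed
      then show ?thesis using d(2)[OF y] by simp
    qed
    then show "\<exists>d>0. \<forall>x'\<in>{0..T}. dist x' x < d \<longrightarrow> dist (v x') (v x) < e" using d(1) by blast
  qed
  have cu: "continuous_on {0..T} u" and cw: "continuous_on {0..T} w" using cont clock by blast+
  have c\<Phi>: "continuous_on UNIV \<Phi>" by (rule continuous_on_\<Phi>)
  have c\<gamma>: "continuous_on {0..T} \<gamma>"
    unfolding \<gamma>_def
    by (intro continuous_intros cu cw continuous_on_compose2[OF c\<Phi> cu] continuous_on_compose2[OF c\<Phi> cw]) auto
  have "\<gamma> t \<le> exp (C * (\<sigma> T - \<sigma> 0)) * (\<gamma> 0 + ((4 * \<Omega>1 t + 4 * \<Omega>2 t) - (4 * \<Omega>1 0 + 4 * \<Omega>2 0)))"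
  proof (rule gronwall_right_local[OF T _ c\<gamma> \<gamma>0 \<sigma> \<sigma>_mono _ _ t])
    show "0 \<le> C" using b0 c0 \<kappa> k r0 by (simp add: C_def)
    show "4 * \<Omega>1 s + 4 * \<Omega>2 s \<le> 4 * \<Omega>1 t + 4 * \<Omega>2 t" if "0 \<le> s" "s \<le> t" "t \<le> T" for s t
      using clock(3,4)[OF that] by simp
    fix s assume s: "0 \<le> s" "s < T"
    obtain \<delta>1 where \<delta>1: "\<delta>1 > 0" "\<forall>t. s < t \<and> t < s + \<delta>1 \<and> t \<le> T \<longrightarrow>
        S (u t - u s) + (\<Phi> (u s) - m s) (u t - u s) \<le> k * (\<sigma> t - \<sigma> s)\<^sup>2 + (\<Omega>1 t - \<Omega>1 s) \<and>
        \<omega>1 s * (\<sigma> t - \<sigma> s) \<le> \<Omega>1 t - \<Omega>1 s"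
      using approx_solutionD(5)[OF u s] by blast
    obtain \<delta>2 where \<delta>2: "\<delta>2 > 0" "\<forall>t. s < t \<and> t < s + \<delta>2 \<and> t \<le> T \<longrightarrow>
        S (w t - w s) + (\<Phi> (w s) - m s) (w t - w s) \<le> k * (\<sigma> t - \<sigma> s)\<^sup>2 + (\<Omega>2 t - \<Omega>2 s) \<and>
        \<omega>2 s * (\<sigma> t - \<sigma> s) \<le> \<Omega>2 t - \<Omega>2 s"
      using approx_solutionD(5)[OF w s] by blast
    have stab: "0 \<le> \<omega>1 s" "0 \<le> \<omega>2 s" "(\<Phi> (u s) - m s) v + S v \<ge> - \<omega>1 s * norm v"
      "(\<Phi> (w s) - m s) v + S v \<ge> - \<omega>2 s * norm v" for v
      using approx_solutionD(3,4)[OF u s] approx_solutionD(3,4)[OF w s] by simp_all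
    show "\<exists>\<delta>>0. \<forall>t. s < t \<and> t < s + \<delta> \<and> t \<le> T \<longrightarrow>
      \<gamma> t - \<gamma> s \<le> C * \<gamma> s * (\<sigma> t - \<sigma> s) + C * (\<sigma> t - \<sigma> s)\<^sup>2 +
        ((4 * \<Omega>1 t + 4 * \<Omega>2 t) - (4 * \<Omega>1 s + 4 * \<Omega>2 s))"
    proof (intro exI[of _ "min \<delta>1 \<delta>2"] conjI allI impI)
      show "min \<delta>1 \<delta>2 > 0" using \<delta>1(1) \<delta>2(1) by simp
      fix t assume "s < t \<and> t < s + min \<delta>1 \<delta>2 \<and> t \<le> T"
      then have t: "s < t" "t < s + \<delta>1" "t < s + \<delta>2" "t \<le> T" by auto
      define x X \<Delta>u \<Delta>w P Q d where "x = u s - w s" and "X = \<Phi> (u s) - \<Phi> (w s)"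
        and "\<Delta>u = u t - u s" and "\<Delta>w = w t - w s"
        and "P = \<Phi> (u t) - \<Phi> (u s)" and "Q = \<Phi> (w t) - \<Phi> (w s)" and "d = \<sigma> t - \<sigma> s"
      note defs = x_def X_def \<Delta>u_def \<Delta>w_def P_def Q_def d_def
      have e1: "S \<Delta>u + (\<Phi> (u s) - m s) \<Delta>u \<le> k * d\<^sup>2 + (\<Omega>1 t - \<Omega>1 s)" "\<omega>1 s * d \<le> \<Omega>1 t - \<Omega>1 s"
        using \<delta>1(2) t unfolding defs by blast+
      have e2: "S \<Delta>w + (\<Phi> (w s) - m s) \<Delta>w \<le> k * d\<^sup>2 + (\<Omega>2 t - \<Omega>2 s)" "\<omega>2 s * d \<le> \<Omega>2 t - \<Omega>2 s"
        using \<delta>2(2) t unfolding defs by blast+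
      have in_ball: "u s \<in> ball 0 r" "w s \<in> ball 0 r" "u t \<in> ball 0 r" "w t \<in> ball 0 r"
        using ur[of s] wr[of s] ur[of t] wr[of t] s t by simp_all
      have nu: "norm \<Delta>u \<le> d" and nw: "norm \<Delta>w \<le> d" using clock(1,2)[of s t] s t by (auto simp: defs)
      have d0: "d \<ge> 0" using nu norm_ge_zero order_trans by blast
      have nx: "norm x \<le> 2 * r"
        using in_ball norm_triangle_ineq4[of "u s" "w s"] by (simp add: x_def)
      \<comment> \<open>Discrete product rule; the last term is quadratic in the clock
        increment.\<close>
      have eq: "\<gamma> t - \<gamma> s = X (\<Delta>u - \<Delta>w) + (P - Q) x + (P - Q) (\<Delta>u - \<Delta>w)"
        unfolding \<gamma>_def defs by (simp add: blinfun.bilinear_simps)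
      have nP: "norm P \<le> b * d" and nQ: "norm Q \<le> b * d"
        using order_trans[OF \<Phi>_lipschitz[OF reg in_ball(3,1)] mult_left_mono[OF nu b0, unfolded \<Delta>u_def]]
          order_trans[OF \<Phi>_lipschitz[OF reg in_ball(4,2)] mult_left_mono[OF nw b0, unfolded \<Delta>w_def]]
        by (auto simp: P_def Q_def)
      have "(P - Q) (\<Delta>u - \<Delta>w) \<le> (2 * (b * d)) * (2 * d)"
        by (rule blinfun_le_norm(1)) (use nP nQ nu nw norm_triangle_ineq4[of P Q] norm_triangle_ineq4[of \<Delta>u \<Delta>w] in linarith)+
      then have cross: "(P - Q) (\<Delta>u - \<Delta>w) \<le> 4 * b * d\<^sup>2" by (simp add: power2_eq_square)
      have TX1: "norm (X - B (u s) x) \<le> c * (norm x)\<^sup>2"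
        using \<Phi>_taylor[OF reg in_ball(1,2)]
        by (simp add: defs norm_minus_commute blinfun.diff_right algebra_simps)
      have TX2: "norm (X - B (w s) x) \<le> c * (norm x)\<^sup>2"
        using \<Phi>_taylor[OF reg in_ball(2,1)] by (simp add: defs)
      have TP: "norm (P - B (u s) \<Delta>u) \<le> c * d\<^sup>2"
        using order_trans[OF \<Phi>_taylor[OF reg in_ball(1,3)] mult_left_mono[OF power_mono[OF nu norm_ge_zero, of 2] c0, unfolded \<Delta>u_def]]
        by (simp add: defs)
      have TQ: "norm (Q - B (w s) \<Delta>w) \<le> c * d\<^sup>2"
        using order_trans[OF \<Phi>_taylor[OF reg in_ball(2,4)] mult_left_mono[OF power_mono[OF nw norm_ge_zero, of 2] c0, unfolded \<Delta>w_def]]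
        by (simp add: defs)
      have "P x \<le> X \<Delta>u + c * (norm x)\<^sup>2 * d + c * d\<^sup>2 * (2 * r)"
        using blinfun_le_norm(1)[OF TP nx] blinfun_le_norm(2)[OF TX1 nu] B_symmetric[of "u s" \<Delta>u x] by (simp add: blinfun.diff_left)
      moreover have "- Q x \<le> - X \<Delta>w + c * (norm x)\<^sup>2 * d + c * d\<^sup>2 * (2 * r)"
        using blinfun_le_norm(2)[OF TQ nx] blinfun_le_norm(1)[OF TX2 nw] B_symmetric[of "w s" \<Delta>w x] by (simp add: blinfun.diff_left)
      \<comment> \<open>The value \<open>S \<Delta>u\<close> cancels between the energy balance of
        \<open>u\<close> and the stability of \<open>w\<close> tested with \<open>\<Delta>u\<close>;
        the stability defect \<open>\<omega>2 s * d\<close> is paid for by the increment of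
        \<open>\<Omega>2\<close>.\<close>
      moreover have "X \<Delta>u \<le> k * d\<^sup>2 + (\<Omega>1 t - \<Omega>1 s) + (\<Omega>2 t - \<Omega>2 s)"
      proof -
        have "\<omega>2 s * norm \<Delta>u \<le> \<omega>2 s * d" using nu stab(2) by (rule mult_left_mono)
        then show ?thesis using e1 e2 stab(4)[of \<Delta>u] by (simp add: defs blinfun.diff_left)
      qed
      moreover have "- X \<Delta>w \<le> k * d\<^sup>2 + (\<Omega>1 t - \<Omega>1 s) + (\<Omega>2 t - \<Omega>2 s)"
      proof -
        have "\<omega>1 s * norm \<Delta>w \<le> \<omega>1 s * d" using nw stab(1) by (rule mult_left_mono)
        then show ?thesis using e1 e2 stab(3)[of \<Delta>w] by (simp add: defs blinfun.diff_left)
      qed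
      ultimately have 1: "\<gamma> t - \<gamma> s \<le> 2 * c * (norm x)\<^sup>2 * d + (4 * r * c + 4 * b + 4 * k) * d\<^sup>2 +
          4 * ((\<Omega>1 t - \<Omega>1 s) + (\<Omega>2 t - \<Omega>2 s))"
        using cross unfolding eq by (simp add: blinfun.diff_left blinfun.diff_right algebra_simps)
      have "(norm x)\<^sup>2 \<le> \<gamma> s / \<kappa>" using \<gamma>_ge[of s] \<kappa> by (simp add: x_def field_simps)
      then have "2 * c * d * (norm x)\<^sup>2 \<le> 2 * c * d * (\<gamma> s / \<kappa>)"
        using c0 d0 by (intro mult_left_mono) auto
      then have 2: "2 * c * (norm x)\<^sup>2 * d \<le> (2 * c / \<kappa>) * (\<gamma> s * d)" by (simp add: mult_ac)
      have "(2 * c / \<kappa>) * (\<gamma> s * d) \<le> C * (\<gamma> s * d)"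
        using b0 c0 \<kappa> k r0 \<gamma>0[of s] d0 by (intro mult_right_mono) (auto simp: C_def)
      moreover have "(4 * r * c + 4 * b + 4 * k) * d\<^sup>2 \<le> C * d\<^sup>2"
        using b0 c0 \<kappa> k r0 by (intro mult_right_mono) (auto simp: C_def)
      ultimately show "\<gamma> t - \<gamma> s \<le> C * \<gamma> s * (\<sigma> t - \<sigma> s) + C * (\<sigma> t - \<sigma> s)\<^sup>2 +
        ((4 * \<Omega>1 t + 4 * \<Omega>2 t) - (4 * \<Omega>1 s + 4 * \<Omega>2 s))"
        using 1 2 unfolding d_def[symmetric] by (simp add: mult.assoc)
    qed
  qed
  moreover have "\<gamma> 0 = 0" by (simp add: \<gamma>_def init)
  ultimately show ?thesis using \<gamma>_ge[of t] unfolding C_def[symmetric] by (simp add: algebra_simps)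
qed

end

section \<open>The implicit Euler scheme on nonuniform grids\<close>

definition grid :: "nat \<Rightarrow> (nat \<Rightarrow> real) \<Rightarrow> bool" where
  "grid N t \<longleftrightarrow> (\<forall>k<N. t k < t (Suc k))"

lemma grid_mono:
  assumes "grid N t" "i \<le> j" "j \<le> N"
  shows "t i \<le> t j"
  using assms(2,3)
proof (induction j rule: dec_induct)
  case (step n)
  then show ?case using assms(1) by (simp add: grid_def) (meson less_imp_le order_trans Suc_le_lessD)
qed simp

text \<open>On a grid this is the primitive, vanishing at \<open>t 0\<close>, of the step function
  with value \<open>d k\<close> on cell \<open>k\<close>. In the \<open>min\<close> form no cell has
  to be located, and increments are combinations of the \<open>d k\<close> with nonnegative
  weights.\<close>

definition grid_interpolation :: "nat \<Rightarrow> (nat \<Rightarrow> real) \<Rightarrow> (nat \<Rightarrow> 'a::real_vector) \<Rightarrow> real \<Rightarrow> 'a" where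
  "grid_interpolation N t d s = (\<Sum>k<N. (min s (t (Suc k)) - min s (t k)) *\<^sub>R d k)"

text \<open>The least index makes the cells closed on the left and open on the right, as is needed
  for small steps to the right of \<open>s\<close>.\<close>

definition cell :: "(nat \<Rightarrow> real) \<Rightarrow> real \<Rightarrow> nat" where
  "cell t s = (LEAST q. s < t (Suc q))"

lemma cell_bounds:
  assumes "t 0 \<le> s" "s < t N"
  shows "cell t s < N" "t (cell t s) \<le> s" "s < t (Suc (cell t s))"
proof -
  obtain q where q: "q < N" "s < t (Suc q)"
    using ex_least_nat_less[of "\<lambda>k. s < t k" N] assms by auto
  show "s < t (Suc (cell t s))" unfolding cell_def by (rule LeastI[of "\<lambda>q. s < t (Suc q)", OF q(2)])
  have "cell t s \<le> q" unfolding cell_def by (rule Least_le[of "\<lambda>q. s < t (Suc q)", OF q(2)])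
  then show "cell t s < N" using q by simp
  show "t (cell t s) \<le> s"
  proof (cases "cell t s")
    case 0
    then show ?thesis using assms by simp
  next
    case (Suc p)
    then have "\<not> s < t (Suc p)" unfolding cell_def by (intro not_less_Least) simp
    then show ?thesis using Suc by simp
  qed
qed

lemma grid_interpolation_cell:
  fixes d :: "nat \<Rightarrow> 'a::real_vector"
  assumes g: "grid N t" and q: "q < N" and s: "t q \<le> s" "s \<le> t (Suc q)"
  shows "grid_interpolation N t d s = (\<Sum>k<q. (t (Suc k) - t k) *\<^sub>R d k) + (s - t q) *\<^sub>R d q"
proof -
  define c where "c k = (min s (t (Suc k)) - min s (t k)) *\<^sub>R d k" for k
  have "(\<Sum>k<N. c k) = (\<Sum>k<Suc q. c k)"
  proof (rule sum.mono_neutral_right)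
    show "\<forall>k\<in>{..<N} - {..<Suc q}. c k = 0"
    proof
      fix k assume "k \<in> {..<N} - {..<Suc q}"
      then have "t (Suc q) \<le> t k" "t k \<le> t (Suc k)" using grid_mono[OF g] by auto
      then show "c k = 0" using s by (simp add: c_def)
    qed
  qed (use q in auto)
  also have "\<dots> = (\<Sum>k<q. c k) + c q" by simp
  also have "(\<Sum>k<q. c k) = (\<Sum>k<q. (t (Suc k) - t k) *\<^sub>R d k)"
  proof (rule sum.cong)
    fix k assume "k \<in> {..<q}"
    then have "t (Suc k) \<le> t q" "t k \<le> t (Suc k)" using grid_mono[OF g] q by auto
    then show "c k = (t (Suc k) - t k) *\<^sub>R d k" using s by (simp add: c_def)
  qed simp
  also have "c q = (s - t q) *\<^sub>R d q" using s by (simp add: c_def min_def)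
  finally show ?thesis by (simp add: grid_interpolation_def c_def)
qed

lemma grid_interpolation_increment:
  "grid_interpolation N t d s' - grid_interpolation N t d s =
    (\<Sum>k<N. ((min s' (t (Suc k)) - min s (t (Suc k))) - (min s' (t k) - min s (t k))) *\<^sub>R d k)"
  unfolding grid_interpolation_def sum_subtractf[symmetric]
  by (intro sum.cong) (simp_all add: algebra_simps)

text \<open>The weight is the length of the part of cell \<open>k\<close> between \<open>s\<close>
  and \<open>s'\<close>.\<close>

lemma grid_weight_nonneg:
  assumes "grid N t" "k < N" "s \<le> s'"
  shows "0 \<le> (min s' (t (Suc k)) - min s (t (Suc k))) - (min s' (t k) - min s (t k))"
  using assms by (auto simp: grid_def min_def)

lemma grid_interpolation_lipschitz:
  fixes d :: "nat \<Rightarrow> 'a::real_normed_vector"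
  assumes g: "grid N t" and s: "s \<le> s'" and d: "\<And>k. k < N \<Longrightarrow> norm (d k) \<le> M" and M: "0 \<le> M"
  shows "norm (grid_interpolation N t d s' - grid_interpolation N t d s) \<le> M * (s' - s)"
proof -
  define f where "f k = min s' (t k) - min s (t k)" for k
  have f: "0 \<le> f k" "f k \<le> s' - s" for k using s by (auto simp: f_def min_def)
  have "norm (grid_interpolation N t d s' - grid_interpolation N t d s) \<le> (\<Sum>k<N. (f (Suc k) - f k) * M)"
    unfolding grid_interpolation_increment f_def
  proof (rule sum_norm_le)
    fix k assume "k \<in> {..<N}"
    then have k: "k < N" by simp
    show "norm ((min s' (t (Suc k)) - min s (t (Suc k)) - (min s' (t k) - min s (t k))) *\<^sub>R d k)
      \<le> (min s' (t (Suc k)) - min s (t (Suc k)) - (min s' (t k) - min s (t k))) * M"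
      unfolding norm_scaleR using grid_weight_nonneg[OF g k s] d[OF k] by (simp add: mult_left_mono)
  qed
  also have "\<dots> = (f N - f 0) * M" by (simp add: sum_distrib_right[symmetric] sum_lessThan_telescope)
  also have "\<dots> \<le> (s' - s) * M" using f[of 0] f[of N] M by (intro mult_right_mono) auto
  finally show ?thesis by (simp add: mult.commute)
qed

lemma grid_interpolation_mono:
  fixes d :: "nat \<Rightarrow> real"
  assumes g: "grid N t" and s: "s \<le> s'" and d: "\<And>k. k < N \<Longrightarrow> 0 \<le> d k"
  shows "grid_interpolation N t d s \<le> grid_interpolation N t d s'"
proof -
  have "0 \<le> grid_interpolation N t d s' - grid_interpolation N t d s"
    unfolding grid_interpolation_increment real_scaleR_def
    using grid_weight_nonneg[OF g _ s] d by (intro sum_nonneg mult_nonneg_nonneg) auto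
  then show ?thesis by simp
qed

lemma grid_interpolation_end:
  fixes d :: "nat \<Rightarrow> real"
  assumes g: "grid N t"
  shows "grid_interpolation N t d (t N) = (\<Sum>k<N. (t (Suc k) - t k) * d k)"
    and "grid_interpolation N t d (t 0) = 0"
proof -
  show "grid_interpolation N t d (t N) = (\<Sum>k<N. (t (Suc k) - t k) * d k)"
    unfolding grid_interpolation_def
    by (intro sum.cong) (use grid_mono[OF g] in \<open>simp_all add: min_absorb2\<close>)
  show "grid_interpolation N t d (t 0) = 0"
    unfolding grid_interpolation_def
    by (intro sum.neutral) (use grid_mono[OF g] in \<open>simp add: min_absorb1\<close>)
qed

section \<open>Implicit Euler scheme: a priori bounds and defects\<close>

context convex_rate_independent
begin

text \<open>Stability of the initial state is included, so that all nodes are stable; at later nodes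
  stability is part of the inclusion.\<close>

definition euler_scheme :: "real \<Rightarrow> (real \<Rightarrow> ('z \<Rightarrow>\<^sub>L real)) \<Rightarrow> nat \<Rightarrow> (nat \<Rightarrow> real) \<Rightarrow> (nat \<Rightarrow> 'z) \<Rightarrow> bool" where
  "euler_scheme T m N t y \<longleftrightarrow> grid N t \<and> t 0 = 0 \<and> t N = T \<and>
     (\<forall>v. (\<Phi> (y 0) - m 0) v + S v \<ge> 0) \<and>
     (\<forall>k<N. incl (y (Suc k) - y k) (\<Phi> (y (Suc k)) - m (t (Suc k))))"

lemma euler_stable:
  assumes "euler_scheme T m N t y" "k \<le> N"
  shows "(\<Phi> (y k) - m (t k)) v + S v \<ge> 0"
  using assms by (cases k) (auto simp: euler_scheme_def incl_iff)

text \<open>Testing the stability of \<open>x\<close> with the actual increment and adding the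
  energy inequality at \<open>y\<close> leaves strong monotonicity against the change of load. It
  yields both the slope bound of the Euler scheme and the inactivity of the constraint in the local
  scheme.\<close>

lemma stable_increment_bound:
  assumes st: "\<And>v. (\<Phi> x - p) v + S v \<ge> 0"
    and en: "S (y - x) + (\<Phi> y - q) (y - x) \<le> 0" and pq: "norm (q - p) \<le> e"
  shows "norm (y - x) \<le> e / \<kappa>"
proof (cases "y = x")
  case True
  then show ?thesis using order_trans[OF norm_ge_zero pq] \<kappa> by simp
next
  case False
  have "(\<Phi> y - \<Phi> x) (y - x) \<le> (q - p) (y - x)"
    using en st[of "y - x"] by (simp add: blinfun.diff_left)
  then have "\<kappa> * (norm (y - x))\<^sup>2 \<le> e * norm (y - x)"
    using \<Phi>_strongly_monotone[where x=x and y=y] blinfun_le_norm(1)[OF pq order_refl, of "y - x"] by linarith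
  then have "\<kappa> * norm (y - x) \<le> e" using False by (simp add: power2_eq_square)
  then show ?thesis using \<kappa> by (simp add: field_simps)
qed

lemma euler_increment_bound:
  assumes e: "euler_scheme T m N t y" and k: "k < N"
    and m: "\<And>s t. 0 \<le> s \<Longrightarrow> s \<le> t \<Longrightarrow> t \<le> T \<Longrightarrow> norm (m t - m s) \<le> L * (t - s)"
  shows "norm (y (Suc k) - y k) \<le> L / \<kappa> * (t (Suc k) - t k)"
proof -
  have g: "grid N t" using e by (simp add: euler_scheme_def)
  have tt: "0 \<le> t k" "t k \<le> t (Suc k)" "t (Suc k) \<le> T"
    using grid_mono[OF g, of 0 k] grid_mono[OF g, of k "Suc k"] grid_mono[OF g, of "Suc k" N] k e
    by (auto simp: euler_scheme_def)
  have "norm (y (Suc k) - y k) \<le> (L * (t (Suc k) - t k)) / \<kappa>"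
  proof (rule stable_increment_bound)
    show "(\<Phi> (y k) - m (t k)) v + S v \<ge> 0" for v using euler_stable[OF e, of k] k by simp
    show "S (y (Suc k) - y k) + (\<Phi> (y (Suc k)) - m (t (Suc k))) (y (Suc k) - y k) \<le> 0"
      using e k by (auto simp: euler_scheme_def incl_iff)
    show "norm (m (t (Suc k)) - m (t k)) \<le> L * (t (Suc k) - t k)" using m[OF tt] .
  qed
  then show ?thesis by simp
qed

lemma euler_bound:
  assumes e: "euler_scheme T m N t y" and k: "k \<le> N"
    and m: "\<And>s t. 0 \<le> s \<Longrightarrow> s \<le> t \<Longrightarrow> t \<le> T \<Longrightarrow> norm (m t - m s) \<le> L * (t - s)"
  shows "norm (y k - y 0) \<le> L / \<kappa> * t k"
  using k
proof (induction k)
  case 0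
  then show ?case using e by (simp add: euler_scheme_def)
next
  case (Suc k)
  then show ?case
    using norm_triangle_ineq[of "y (Suc k) - y k" "y k - y 0"] euler_increment_bound[OF e _ m, of k]
    by (simp add: algebra_simps)
qed

definition affine_interpolant :: "nat \<Rightarrow> (nat \<Rightarrow> real) \<Rightarrow> (nat \<Rightarrow> 'z) \<Rightarrow> real \<Rightarrow> 'z" where
  "affine_interpolant N t y s =
     y 0 + grid_interpolation N t (\<lambda>k. (1 / (t (Suc k) - t k)) *\<^sub>R (y (Suc k) - y k)) s"

lemma affine_interpolant_cell:
  assumes g: "grid N t" and q: "q < N" and s: "t q \<le> s" "s \<le> t (Suc q)"
  shows "affine_interpolant N t y s =
    y q + (s - t q) *\<^sub>R ((1 / (t (Suc q) - t q)) *\<^sub>R (y (Suc q) - y q))"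
proof -
  have "(\<Sum>k<q. (t (Suc k) - t k) *\<^sub>R ((1 / (t (Suc k) - t k)) *\<^sub>R (y (Suc k) - y k))) =
      (\<Sum>k<q. y (Suc k) - y k)"
  proof (rule sum.cong)
    fix k assume "k \<in> {..<q}"
    then have "t k < t (Suc k)" using g q by (simp add: grid_def)
    then show "(t (Suc k) - t k) *\<^sub>R ((1 / (t (Suc k) - t k)) *\<^sub>R (y (Suc k) - y k)) = y (Suc k) - y k"
      by simp
  qed simp
  also have "\<dots> = y q - y 0" by (rule sum_lessThan_telescope)
  finally show ?thesis
    unfolding affine_interpolant_def grid_interpolation_cell[OF g q s] by simp
qed

text \<open>
  The sum controls the failure of the energy balance at the left end points of the grid intervals.
  Testing two consecutive inclusions against each other gives a telescoping energy of the slopes; the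
  bounded variation of the derivative of \<open>m\<close> absorbs the change of its difference quotients.
\<close>

lemma euler_defect_sum:
  assumes e: "euler_scheme T m N t y" and N: "N > 0"
    and m: "\<And>s t. 0 \<le> s \<Longrightarrow> s \<le> t \<Longrightarrow> t \<le> T \<Longrightarrow> norm (m t - m s) \<le> L * (t - s)"
    and m': "\<And>s c t. 0 \<le> s \<Longrightarrow> s \<le> c \<Longrightarrow> c \<le> t \<Longrightarrow> t \<le> T \<Longrightarrow>
      norm (m t - m s - (t - s) *\<^sub>R m' c) \<le> (t - s) * (V t - V s)"
    and reg: "regular_on_ball r b c" and yr: "\<And>k. k \<le> N \<Longrightarrow> y k \<in> ball 0 r"
    and M: "M = L / \<kappa>"
  defines "h \<equiv> \<lambda>k. t (Suc k) - t k"
  defines "d \<equiv> \<lambda>k. (1 / h k) *\<^sub>R (y (Suc k) - y k)"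
  defines "\<xi> \<equiv> \<lambda>k. \<Phi> (y k) - m (t k)"
  shows "(\<Sum>k<N. (S (d k) + \<xi> k (d k)) / h k) \<le>
    (b * M + L) * M + b * M\<^sup>2 + 2 * L * M + 3 * c * M ^ 3 * T + 2 * M * (V T - V 0)"
proof -
  have g: "grid N t" and t0: "t 0 = 0" and tN: "t N = T" using e by (auto simp: euler_scheme_def)
  have h_eq: "t (Suc k) - t k = h k" for k by (simp add: h_def)
  have h: "h k > 0" if "k < N" for k using g that by (simp add: grid_def h_def)
  have tt: "0 \<le> t k" "t k \<le> t (Suc k)" "t (Suc k) \<le> T" if "k < N" for k
    using grid_mono[OF g, of 0 k] grid_mono[OF g, of k "Suc k"] grid_mono[OF g, of "Suc k" N] that t0 tN by auto
  have b0: "b \<ge> 0" and c0: "c \<ge> 0" using reg by (auto simp: regular_on_ball_def)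
  have T0: "T > 0" using tt[OF N] h[OF N] by (simp add: h_def)
  have L0: "L \<ge> 0"
  proof -
    have "norm (m T - m 0) \<le> L * T" using m[of 0 T] T0 by simp
    then have "0 \<le> L * T" by (rule order_trans[OF norm_ge_zero])
    then show ?thesis using T0 by (simp add: zero_le_mult_iff)
  qed
  have M0: "M \<ge> 0" using L0 \<kappa> by (simp add: M)
  have Vmono: "V (t k) \<le> V (t (Suc k))" if "k < N" for k
  proof -
    have "0 \<le> h k * (V (t (Suc k)) - V (t k))"
      using m'[OF tt(1)[OF that] order_refl tt(2,3)[OF that]] norm_ge_zero order_trans unfolding h_def by blast
    then show ?thesis using h[OF that] by (simp add: zero_le_mult_iff)
  qed
  have y_diff: "y (Suc k) - y k = h k *\<^sub>R d k" if "k < N" for k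
    using h[OF that] by (simp add: d_def)
  have dM: "norm (d k) \<le> M" if "k < N" for k
  proof -
    have "h k * norm (d k) \<le> h k * M"
      using euler_increment_bound[OF e that m] h[OF that] unfolding y_diff[OF that] M h_eq
      by (simp add: mult.commute)
    then show ?thesis using h[OF that] by simp
  qed
  define \<eta> where "\<eta> k = (1 / h k) *\<^sub>R (m (t (Suc k)) - m (t k))" for k
  have m_diff: "m (t (Suc k)) - m (t k) = h k *\<^sub>R \<eta> k" if "k < N" for k
    using h[OF that] by (simp add: \<eta>_def)
  have \<eta>L: "norm (\<eta> k) \<le> L" if "k < N" for k
  proof -
    have "h k * norm (\<eta> k) \<le> h k * L"
      using m[OF tt[OF that]] h[OF that] unfolding m_diff[OF that] h_eq by (simp add: mult.commute)
    then show ?thesis using h[OF that] by simp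
  qed
  have \<eta>V: "norm (\<eta> k - m' p) \<le> V (t (Suc k)) - V (t k)" if k: "k < N" and p: "p = t k \<or> p = t (Suc k)" for k p
  proof -
    have "norm (m (t (Suc k)) - m (t k) - h k *\<^sub>R m' p) \<le> h k * (V (t (Suc k)) - V (t k))"
      unfolding h_def using tt[OF k] p by (intro m') auto
    then have "h k * norm (\<eta> k - m' p) \<le> h k * (V (t (Suc k)) - V (t k))"
      unfolding m_diff[OF k] scaleR_diff_right[symmetric] using h[OF k] by simp
    then show ?thesis using h[OF k] by simp
  qed
  define \<beta> where "\<beta> k = B (y k)" for k
  \<comment> \<open>The discrete energy of the slopes that telescopes: half the quadratic form of
    \<open>B\<close> on the slope, minus the slope of the load applied to it.\<close>
  define p where "p k = \<beta> k (d k) (d k) / 2 - \<eta> k (d k)" for k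
  have balance: "S (d k) + \<xi> (Suc k) (d k) \<le> 0" if "k < N" for k
  proof -
    have "S (h k *\<^sub>R d k) + \<xi> (Suc k) (h k *\<^sub>R d k) \<le> 0"
      using e that unfolding euler_scheme_def incl_iff \<xi>_def y_diff[OF that, symmetric] by blast
    then have "h k * (S (d k) + \<xi> (Suc k) (d k)) \<le> 0"
      using h[OF that] by (simp add: S_scale blinfun.scaleR_right algebra_simps)
    then show ?thesis using h[OF that] by (simp add: mult_le_0_iff)
  qed
  have stable: "\<xi> k v + S v \<ge> 0" if "k \<le> N" for k v
    unfolding \<xi>_def by (rule euler_stable[OF e that])
  have \<Phi>_diff: "norm (\<Phi> (y (Suc k)) - \<Phi> (y k) - h k *\<^sub>R \<beta> k (d k)) \<le> c * M\<^sup>2 * (h k)\<^sup>2" if k: "k < N" for k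
  proof -
    have "norm (\<Phi> (y (Suc k)) - \<Phi> (y k) - h k *\<^sub>R \<beta> k (d k)) \<le> c * (norm (y (Suc k) - y k))\<^sup>2"
      using \<Phi>_taylor[OF reg yr[of k] yr[of "Suc k"]] k unfolding y_diff[OF k] \<beta>_def by (simp add: blinfun.scaleR_right)
    also have "\<dots> \<le> c * (h k * M)\<^sup>2"
      unfolding y_diff[OF k] using h[OF k] dM[OF k] c0 by (intro mult_left_mono power_mono) auto
    finally show ?thesis by (simp add: power_mult_distrib mult_ac)
  qed
  \<comment> \<open>The first interval has no predecessor to test against. The change of the
    residual over one step is of order \<open>h 0\<close>, which still gives a bounded
    quotient.\<close>
  have first: "(S (d 0) + \<xi> 0 (d 0)) / h 0 \<le> (b * M + L) * M"
  proof -
    have "norm (\<xi> (Suc 0) - \<xi> 0) \<le> b * norm (y (Suc 0) - y 0) + L * h 0"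
      using norm_triangle_ineq4[of "\<Phi> (y (Suc 0)) - \<Phi> (y 0)" "m (t (Suc 0)) - m (t 0)"]
        \<Phi>_lipschitz[OF reg yr[of "Suc 0"] yr[of 0]] m[OF tt[OF N]] N
      by (simp add: \<xi>_def h_def algebra_simps)
    also have "\<dots> \<le> b * (h 0 * M) + L * h 0"
      unfolding y_diff[OF N] using h[OF N] dM[OF N] b0 by (simp add: mult_left_mono)
    finally have "norm (\<xi> (Suc 0) - \<xi> 0) \<le> (b * M + L) * h 0" by (simp add: algebra_simps)
    from blinfun_le_norm(2)[OF this dM[OF N]] balance[OF N]
    have "S (d 0) + \<xi> 0 (d 0) \<le> ((b * M + L) * M) * h 0" by (simp add: blinfun.diff_left algebra_simps)
    then show ?thesis using h[OF N] by (simp add: field_simps)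
  qed
  have step: "(S (d (Suc j)) + \<xi> (Suc j) (d (Suc j))) / h (Suc j) \<le> p j - p (Suc j) +
      2 * c * M ^ 3 * h (Suc j) + c * M ^ 3 * h j + M * (V (t (Suc (Suc j))) - V (t j))"
    if k: "Suc j < N" for j
  proof -
    define k e where "k = Suc j" and "e = d k - d j"
    have kN: "k < N" "j < N" using k by (auto simp: k_def)
    have e2: "norm e \<le> 2 * M" using norm_triangle_ineq4[of "d k" "d j"] dM[OF kN(1)] dM[OF kN(2)] by (simp add: e_def)
    have hk: "h k > 0" using h[OF kN(1)] .
    \<comment> \<open>Energy balance on both intervals and stability at the later node, tested with
      the earlier slope \<open>d j\<close>; the value \<open>S (d j)\<close> cancels.\<close>
    have "S (d k) + \<xi> k (d k) \<le> - (\<xi> (Suc k) - \<xi> k) e"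
      using balance[OF kN(1)] balance[OF kN(2)] stable[of "Suc k" "d j"] kN
      by (simp add: e_def k_def blinfun.diff_left blinfun.diff_right)
    also have "\<dots> = - (\<Phi> (y (Suc k)) - \<Phi> (y k) - h k *\<^sub>R \<beta> k (d k)) e + h k * (\<eta> k e - \<beta> k (d k) e)"
    proof -
      have "m (t (Suc k)) = m (t k) + h k *\<^sub>R \<eta> k" using m_diff[OF kN(1)] by (simp add: algebra_simps)
      then show ?thesis by (simp add: \<xi>_def blinfun.bilinear_simps right_diff_distrib)
    qed
    also have "- (\<Phi> (y (Suc k)) - \<Phi> (y k) - h k *\<^sub>R \<beta> k (d k)) e \<le> c * M\<^sup>2 * (h k)\<^sup>2 * (2 * M)"
      by (rule blinfun_le_norm(2)[OF \<Phi>_diff[OF kN(1)] e2])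
    finally have "S (d k) + \<xi> k (d k) \<le> (2 * c * M ^ 3 * h k + (\<eta> k e - \<beta> k (d k) e)) * h k"
      by (simp add: algebra_simps power2_eq_square power3_eq_cube)
    then have 1: "(S (d k) + \<xi> k (d k)) / h k \<le> 2 * c * M ^ 3 * h k + (\<eta> k e - \<beta> k (d k) e)"
      using hk by (simp add: pos_divide_le_eq)
    \<comment> \<open>Positivity of the quadratic form on \<open>e = d k - d j\<close> turns the
      mixed term into half a difference of squares, which telescopes.\<close>
    have "0 \<le> \<beta> k e e"
      using order_trans[OF _ B_coercive[of e "y k"]] \<kappa> by (simp add: \<beta>_def)
    then have 2: "\<beta> k (d k) e \<ge> \<beta> k (d k) (d k) / 2 - \<beta> k (d j) (d j) / 2"
      using B_symmetric[of "y k" "d k" "d j"] by (simp add: e_def \<beta>_def blinfun.bilinear_simps)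
    have "norm (y k - y j) \<le> h j * M"
      using y_diff[OF kN(2)] dM[OF kN(2)] h[OF kN(2)] by (simp add: k_def)
    moreover have "norm (B (y k) - B (y j)) \<le> c * norm (y k - y j)"
      using reg yr[of k] yr[of j] kN by (auto simp: regular_on_ball_def)
    ultimately have "norm (\<beta> k - \<beta> j) \<le> c * (h j * M)"
      using c0 unfolding \<beta>_def by (meson mult_left_mono order_trans)
    then have "norm ((\<beta> k - \<beta> j) (d j)) \<le> c * (h j * M) * M"
      using dM[OF kN(2)] norm_blinfun[of "\<beta> k - \<beta> j" "d j"] c0 h[OF kN(2)] M0
      by (meson mult_mono mult_nonneg_nonneg less_imp_le norm_ge_zero order_trans)
    from blinfun_le_norm(1)[OF this dM[OF kN(2)]]
    have 3: "\<beta> k (d j) (d j) \<le> \<beta> j (d j) (d j) + c * M ^ 3 * h j"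
      by (simp add: blinfun.diff_left power3_eq_cube mult_ac)
    \<comment> \<open>Both difference quotients of \<open>m\<close> are compared with the single
      value \<open>m' (t k)\<close> at the common node.\<close>
    have "norm (\<eta> k - \<eta> j) \<le> V (t (Suc k)) - V (t j)"
      using norm_triangle_ineq4[of "\<eta> k - m' (t k)" "\<eta> j - m' (t k)"] \<eta>V[OF kN(1), of "t k"] \<eta>V[OF kN(2), of "t k"]
      by (simp add: k_def)
    from blinfun_le_norm(2)[OF this dM[OF kN(2)]]
    have 4: "\<eta> k e \<le> \<eta> k (d k) - \<eta> j (d j) + M * (V (t (Suc k)) - V (t j))"
      by (simp add: e_def blinfun.diff_left blinfun.diff_right mult.commute)
    have "0 \<le> c * M ^ 3 * h j" using c0 M0 h[OF kN(2)] by simp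
    then show ?thesis using 1 2 3 4 unfolding p_def k_def[symmetric] by linarith
  qed
  \<comment> \<open>Each step uses the variation over two neighbouring cells, so \<open>V\<close> is
    counted twice; this is the factor 2 before \<open>M * (V T - V 0)\<close>. The factor 3 before
    \<open>c * M ^ 3 * T\<close> adds the Taylor error, counted twice, and the change of
    \<open>B\<close> between neighbouring nodes.\<close>
  have main: "(\<Sum>k\<le>n. (S (d k) + \<xi> k (d k)) / h k) \<le> (b * M + L) * M + (p 0 - p n) +
      2 * c * M ^ 3 * t (Suc n) + c * M ^ 3 * t n + M * (V (t (Suc n)) + V (t n) - V (t 1) - V (t 0))"
    if "n < N" for n
    using that
  proof (induction n)
    case 0
    have "0 \<le> 2 * c * M ^ 3 * t (Suc 0) + c * M ^ 3 * t 0" using c0 M0 tt[OF N] by simp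
    then show ?case using first by simp
  next
    case (Suc n)
    then show ?case using step[of n] Suc.IH by (simp add: h_def algebra_simps)
  qed
  obtain n where n: "N = Suc n" using N by (cases N) auto
  have pb: "\<bar>p k\<bar> \<le> b * M\<^sup>2 / 2 + L * M" if k: "k < N" for k
  proof -
    have "norm (\<beta> k) \<le> b" using reg yr[of k] k by (auto simp: regular_on_ball_def \<beta>_def)
    then have "norm (\<beta> k (d k)) \<le> b * M"
      using norm_blinfun[of "\<beta> k" "d k"] dM[OF k] b0 by (meson mult_mono norm_ge_zero order_trans)
    then have "\<bar>\<beta> k (d k) (d k)\<bar> \<le> b * M * M"
      using blinfun_le_norm[OF _ dM[OF k]] by (simp add: abs_le_iff)
    moreover have "\<bar>\<eta> k (d k)\<bar> \<le> L * M" using blinfun_le_norm[OF \<eta>L[OF k] dM[OF k]] by (simp add: abs_le_iff)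
    ultimately show ?thesis by (simp add: p_def power2_eq_square abs_le_iff)
  qed
  have "t n \<le> T" using tt[of n] n by simp
  then have "c * M ^ 3 * t n \<le> c * M ^ 3 * T" using c0 M0 by (intro mult_left_mono) auto
  moreover have "M * (V (t (Suc n)) + V (t n) - V (t 1) - V (t 0)) \<le> M * (2 * (V T - V 0))"
  proof -
    have "V (t n) \<le> V T" using Vmono[of n] n tN by simp
    moreover have "V 0 \<le> V (t 1)" using Vmono[OF N] t0 by simp
    ultimately show ?thesis using M0 n tN t0 by (intro mult_left_mono) auto
  qed
  moreover have "t (Suc n) = T" using n tN by simp
  moreover have "(\<Sum>k<N. (S (d k) + \<xi> k (d k)) / h k) = (\<Sum>k\<le>n. (S (d k) + \<xi> k (d k)) / h k)"
    by (simp add: n lessThan_Suc_atMost)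
  ultimately show ?thesis using main[of n] pb[of 0] pb[of n] n N by (simp add: abs_le_iff algebra_simps)
qed

lemma affine_interpolant_in_ball:
  assumes g: "grid N t" and s: "t 0 \<le> s" "s \<le> t N" and N: "N > 0"
    and yr: "\<And>k. k \<le> N \<Longrightarrow> y k \<in> ball 0 r"
  shows "affine_interpolant N t y s \<in> ball 0 r"
proof -
  obtain q where q: "q < N" "t q \<le> s" "s \<le> t (Suc q)"
  proof (cases "s < t N")
    case True
    then show ?thesis using cell_bounds[OF s(1) True] that[of "cell t s"] by simp
  next
    case False
    then show ?thesis using that[of "N - 1"] N s grid_mono[OF g, of "N - 1" N] by simp
  qed
  have h: "t q < t (Suc q)" using g q by (simp add: grid_def)
  define \<theta> where "\<theta> = (s - t q) / (t (Suc q) - t q)"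
  have \<theta>: "0 \<le> \<theta>" "\<theta> \<le> 1" using q h by (auto simp: \<theta>_def)
  have "affine_interpolant N t y s = y q + \<theta> *\<^sub>R (y (Suc q) - y q)"
    unfolding affine_interpolant_cell[OF g q] by (simp add: \<theta>_def)
  also have "\<dots> = (1 - \<theta>) *\<^sub>R y q + \<theta> *\<^sub>R y (Suc q)" by (simp add: algebra_simps)
  also have "\<dots> \<in> ball 0 r"
    using yr[of q] yr[of "Suc q"] q(1) \<theta> by (intro convexD convex_ball) auto
  finally show ?thesis .
qed

text \<open>Inside a cell the residual \<open>\<Phi> (u s) - m s\<close> is, up to an error
  \<open>\<epsilon> k\<close>, the affine interpolation of the residuals at the two nodes. Stability
  survives such convex combinations, and only the left node contributes an energy defect.\<close>

theorem euler_interpolant_approx_solution: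
  assumes e: "euler_scheme T m N t y" and N: "N > 0"
    and m: "\<And>s t. 0 \<le> s \<Longrightarrow> s \<le> t \<Longrightarrow> t \<le> T \<Longrightarrow> norm (m t - m s) \<le> L * (t - s)"
    and m': "\<And>s c t. 0 \<le> s \<Longrightarrow> s \<le> c \<Longrightarrow> c \<le> t \<Longrightarrow> t \<le> T \<Longrightarrow>
      norm (m t - m s - (t - s) *\<^sub>R m' c) \<le> (t - s) * (V t - V s)"
    and reg: "regular_on_ball r b c" and yr: "\<And>k. k \<le> N \<Longrightarrow> y k \<in> ball 0 r"
    and M: "M = L / \<kappa>" and L: "0 \<le> L" and \<tau>: "\<And>k. k < N \<Longrightarrow> t (Suc k) - t k \<le> \<tau>"
  obtains \<omega> \<Omega> where "approx_solution T m (\<lambda>s. M * s) 0 \<omega> \<Omega> (affine_interpolant N t y)"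
    and "\<Omega> T - \<Omega> 0 \<le> ((b * M + L) * M + b * M\<^sup>2 + 2 * L * M + 3 * c * M ^ 3 * T + 2 * M * (V T - V 0) +
        M * (2 * c * M\<^sup>2 * T + 2 * (V T - V 0))) * \<tau>\<^sup>2"
proof -
  define u where "u = affine_interpolant N t y"
  define h where "h k = t (Suc k) - t k" for k
  define d where "d k = (1 / h k) *\<^sub>R (y (Suc k) - y k)" for k
  define \<xi> where "\<xi> k = \<Phi> (y k) - m (t k)" for k
  define q where "q k = S (d k) + \<xi> k (d k)" for k
  \<comment> \<open>Two Taylor remainders of \<open>\<Phi>\<close> and two linearization errors of
    \<open>m\<close>: one of each at the current point and one at the right node.\<close>
  define \<epsilon> where "\<epsilon> k = 2 * c * M\<^sup>2 * (h k)\<^sup>2 + 2 * h k * (V (t (Suc k)) - V (t k))" for k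
  \<comment> \<open>Growth rate of \<open>\<Omega>\<close> on the cell. The term
    \<open>M * \<epsilon> k\<close> covers two demands at once: the error in the energy balance,
    since slopes are bounded by \<open>M\<close>, and the stability defect times the clock
    increment.\<close>
  define a where "a k = q k + M * \<epsilon> k" for k
  define \<Omega> where "\<Omega> = grid_interpolation N t a"
  have g: "grid N t" and t0: "t 0 = 0" and tN: "t N = T" using e by (auto simp: euler_scheme_def)
  have h_eq: "t (Suc k) - t k = h k" for k by (simp add: h_def)
  have h: "h k > 0" if "k < N" for k using g that by (simp add: grid_def h_def)
  have tt: "0 \<le> t k" "t k \<le> t (Suc k)" "t (Suc k) \<le> T" if "k < N" for k
    using grid_mono[OF g, of 0 k] grid_mono[OF g, of k "Suc k"] grid_mono[OF g, of "Suc k" N] that t0 tN by auto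
  have b0: "b \<ge> 0" and c0: "c \<ge> 0" using reg by (auto simp: regular_on_ball_def)
  have M0: "M \<ge> 0" using L \<kappa> by (simp add: M)
  have Vmono: "V p \<le> V s" if "0 \<le> p" "p < s" "s \<le> T" for p s
  proof -
    have "0 \<le> (s - p) * (V s - V p)"
      using m'[OF that(1) order_refl less_imp_le[OF that(2)] that(3)] norm_ge_zero order_trans by blast
    then show ?thesis using that by (simp add: zero_le_mult_iff)
  qed
  have \<Delta>V: "0 \<le> V (t (Suc k)) - V (t k)" if "k < N" for k
    using Vmono[of "t k" "t (Suc k)"] tt[OF that] h[OF that] by (simp add: h_def)
  have y_diff: "y (Suc k) - y k = h k *\<^sub>R d k" if "k < N" for k
    using h[OF that] by (simp add: d_def)
  have dM: "norm (d k) \<le> M" if "k < N" for k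
  proof -
    have "h k * norm (d k) \<le> h k * M"
      using euler_increment_bound[OF e that m] h[OF that] unfolding y_diff[OF that] M h_eq
      by (simp add: mult.commute)
    then show ?thesis using h[OF that] by simp
  qed
  have balance: "S (d k) + \<xi> (Suc k) (d k) \<le> 0" if "k < N" for k
  proof -
    have "S (h k *\<^sub>R d k) + \<xi> (Suc k) (h k *\<^sub>R d k) \<le> 0"
      using e that unfolding euler_scheme_def incl_iff \<xi>_def y_diff[OF that, symmetric] by blast
    then have "h k * (S (d k) + \<xi> (Suc k) (d k)) \<le> 0"
      using h[OF that] by (simp add: S_scale blinfun.scaleR_right algebra_simps)
    then show ?thesis using h[OF that] by (simp add: mult_le_0_iff)
  qed
  have stable: "\<xi> k v + S v \<ge> 0" if "k \<le> N" for k v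
    unfolding \<xi>_def by (rule euler_stable[OF e that])
  have q0: "0 \<le> q k" if "k < N" for k using stable[of k "d k"] that by (simp add: q_def)
  have \<epsilon>0: "0 \<le> \<epsilon> k" if "k < N" for k
    unfolding \<epsilon>_def using \<Delta>V[OF that] h[OF that] c0 by (intro add_nonneg_nonneg mult_nonneg_nonneg) auto
  have a0: "0 \<le> a k" if "k < N" for k using q0[OF that] \<epsilon>0[OF that] M0 by (simp add: a_def)
  have u_cell: "u s = y k + (s - t k) *\<^sub>R d k" if "k < N" "t k \<le> s" "s \<le> t (Suc k)" for k s
    unfolding u_def affine_interpolant_cell[OF g that] d_def h_def ..
  have near: "norm (\<Phi> (u s) - m s - ((1 - (s - t k) / h k) *\<^sub>R \<xi> k + ((s - t k) / h k) *\<^sub>R \<xi> (Suc k))) \<le> \<epsilon> k"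
    if k: "k < N" and s: "t k \<le> s" "s < t (Suc k)" for k s
  proof -
    define z \<theta> where "z = s - t k" and "\<theta> = z / h k"
    have z: "0 \<le> z" "z \<le> h k" using s by (auto simp: z_def h_def)
    have \<theta>: "0 \<le> \<theta>" "\<theta> \<le> 1" "\<theta> * h k = z" using z h[OF k] by (auto simp: \<theta>_def)
    have us: "u s = y k + z *\<^sub>R d k" using u_cell[OF k] s by (simp add: z_def)
    have sT: "0 \<le> s" "s \<le> T" using s tt[OF k] by auto
    have ur: "u s \<in> ball 0 r" unfolding u_def
      by (rule affine_interpolant_in_ball[OF g _ _ N yr]) (use sT t0 tN in auto)
    define P1 where "P1 = \<Phi> (u s) - \<Phi> (y k) - B (y k) (z *\<^sub>R d k)"
    define P2 where "P2 = \<Phi> (y (Suc k)) - \<Phi> (y k) - B (y k) (h k *\<^sub>R d k)"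
    define Q1 where "Q1 = m s - m (t k) - z *\<^sub>R m' (t k)"
    define Q2 where "Q2 = m (t (Suc k)) - m (t k) - h k *\<^sub>R m' (t k)"
    have taylor_term: "c * (norm (x *\<^sub>R d k))\<^sup>2 \<le> c * M\<^sup>2 * (h k)\<^sup>2" if "0 \<le> x" "x \<le> h k" for x
    proof -
      have "c * (norm (x *\<^sub>R d k))\<^sup>2 \<le> c * (h k * M)\<^sup>2"
        unfolding norm_scaleR using that dM[OF k] M0 c0 by (intro mult_left_mono power_mono mult_mono) auto
      then show ?thesis by (simp add: power_mult_distrib mult_ac)
    qed
    have nP1: "norm P1 \<le> c * M\<^sup>2 * (h k)\<^sup>2"
      using \<Phi>_taylor[OF reg yr[of k] ur] k taylor_term[OF z] by (simp add: P1_def us)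
    have nP2: "norm P2 \<le> c * M\<^sup>2 * (h k)\<^sup>2"
      using \<Phi>_taylor[OF reg yr[of k] yr[of "Suc k"]] k taylor_term[of "h k"] h[OF k] by (simp add: P2_def y_diff[OF k])
    have "norm Q1 \<le> z * (V s - V (t k))"
      unfolding Q1_def z_def using tt[OF k] s sT by (intro m') auto
    also have "\<dots> \<le> h k * (V (t (Suc k)) - V (t k))"
    proof (cases "s = t k")
      case True
      then show ?thesis using h[OF k] \<Delta>V[OF k] by (simp add: z_def)
    next
      case False
      then show ?thesis using z Vmono[of s "t (Suc k)"] Vmono[of "t k" s] s tt[OF k] sT by (intro mult_mono) auto
    qed
    finally have nQ1: "norm Q1 \<le> h k * (V (t (Suc k)) - V (t k))" .
    have nQ2: "norm Q2 \<le> h k * (V (t (Suc k)) - V (t k))"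
      unfolding Q2_def using m'[OF tt(1)[OF k] order_refl tt(2,3)[OF k]] by (simp add: h_def)
    have "\<Phi> (u s) - m s - ((1 - \<theta>) *\<^sub>R \<xi> k + \<theta> *\<^sub>R \<xi> (Suc k)) = P1 - \<theta> *\<^sub>R P2 - (Q1 - \<theta> *\<^sub>R Q2)"
      by (simp add: \<xi>_def P1_def P2_def Q1_def Q2_def algebra_simps blinfun.scaleR_right \<theta>(3))
    also have "norm \<dots> \<le> (norm P1 + norm (\<theta> *\<^sub>R P2)) + (norm Q1 + norm (\<theta> *\<^sub>R Q2))"
      by (intro norm_triangle_le_diff add_mono norm_triangle_ineq4)
    also have "\<dots> \<le> (norm P1 + norm P2) + (norm Q1 + norm Q2)"
      unfolding norm_scaleR using \<theta> by (intro add_mono) (auto intro!: mult_left_le_one_le)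
    also have "\<dots> \<le> \<epsilon> k" using nP1 nP2 nQ1 nQ2 by (simp add: \<epsilon>_def)
    finally show ?thesis unfolding \<theta>_def z_def .
  qed
  have loc: "(\<Phi> (u s) - m s) v + S v \<ge> - \<epsilon> k * norm v" (is ?stab)
    "S (d k) + (\<Phi> (u s) - m s) (d k) \<le> a k" (is ?en)
    if k: "k < N" and s: "t k \<le> s" "s < t (Suc k)" for k s v
  proof -
    define \<theta> where "\<theta> = (s - t k) / h k"
    have \<theta>: "0 \<le> \<theta>" "\<theta> \<le> 1" using s h[OF k] by (auto simp: \<theta>_def h_def)
    define \<zeta> where "\<zeta> = (1 - \<theta>) *\<^sub>R \<xi> k + \<theta> *\<^sub>R \<xi> (Suc k)"
    note n = near[OF k s, folded \<theta>_def, folded \<zeta>_def]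
    have \<zeta>: "\<zeta> v + S v = (1 - \<theta>) * (\<xi> k v + S v) + \<theta> * (\<xi> (Suc k) v + S v)" for v
      by (simp add: \<zeta>_def blinfun.bilinear_simps algebra_simps)
    have "0 \<le> \<zeta> v + S v" unfolding \<zeta> using stable[of k v] stable[of "Suc k" v] k \<theta> by simp
    then show ?stab using blinfun_le_norm(2)[OF n order_refl, of v] by (simp add: blinfun.diff_left)
    have "\<zeta> (d k) + S (d k) \<le> q k"
    proof -
      have "(1 - \<theta>) * (\<xi> k (d k) + S (d k)) \<le> 1 * q k"
        unfolding q_def using \<theta> stable[of k "d k"] k by (intro mult_mono) auto
      moreover have "\<theta> * (\<xi> (Suc k) (d k) + S (d k)) \<le> 0"
        using \<theta> balance[OF k] by (intro mult_nonneg_nonpos) auto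
      ultimately show ?thesis unfolding \<zeta> by simp
    qed
    then show ?en using blinfun_le_norm(1)[OF n dM[OF k]] by (simp add: a_def blinfun.diff_left mult.commute)
  qed
  have \<Omega>_cell: "\<Omega> s' - \<Omega> s = (s' - s) * a k"
    if "k < N" "t k \<le> s" "s \<le> s'" "s' \<le> t (Suc k)" for k s s'
    unfolding \<Omega>_def using grid_interpolation_cell[OF g that(1), of s a] grid_interpolation_cell[OF g that(1), of s' a] that
    by (simp add: algebra_simps)
  have "approx_solution T m (\<lambda>s. M * s) 0 (\<lambda>s. \<epsilon> (cell t s)) \<Omega> u"
    unfolding approx_solution_def
  proof (intro conjI allI impI; elim conjE)
    fix s s' assume s: "0 \<le> s" "s \<le> s'" "s' \<le> T"
    have "norm (u s' - u s) \<le> M * (s' - s)"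
      unfolding u_def affine_interpolant_def
      using grid_interpolation_lipschitz[OF g s(2) dM M0] by (simp add: d_def h_def)
    then show "norm (u s' - u s) \<le> M * s' - M * s" by (simp add: right_diff_distrib)
    show "\<Omega> s \<le> \<Omega> s'" unfolding \<Omega>_def by (rule grid_interpolation_mono[OF g s(2) a0])
  next
    fix s assume s: "0 \<le> s" "s < T"
    note k = cell_bounds[of t s N, unfolded t0 tN, OF s]
    show "0 \<le> \<epsilon> (cell t s)" by (rule \<epsilon>0[OF k(1)])
    show "- \<epsilon> (cell t s) * norm v \<le> (\<Phi> (u s) - m s) v + S v" for v by (rule loc(1)[OF k])
    show "\<exists>\<delta>>0. \<forall>s'. s < s' \<and> s' < s + \<delta> \<and> s' \<le> T \<longrightarrow>
        S (u s' - u s) + (\<Phi> (u s) - m s) (u s' - u s) \<le> 0 * (M * s' - M * s)\<^sup>2 + (\<Omega> s' - \<Omega> s) \<and>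
        \<epsilon> (cell t s) * (M * s' - M * s) \<le> \<Omega> s' - \<Omega> s"
    \<comment> \<open>The step stays inside the cell of \<open>s\<close>, on which \<open>u\<close>
      and \<open>\<Omega>\<close> are affine.\<close>
    proof (intro exI[of _ "t (Suc (cell t s)) - s"] conjI allI impI)
      show "0 < t (Suc (cell t s)) - s" using k by simp
      fix s' assume s': "s < s' \<and> s' < s + (t (Suc (cell t s)) - s) \<and> s' \<le> T"
      let ?k = "cell t s"
      have \<Delta>: "u s' - u s = (s' - s) *\<^sub>R d ?k"
      proof -
        have us: "u s = y ?k + (s - t ?k) *\<^sub>R d ?k" "u s' = y ?k + (s' - t ?k) *\<^sub>R d ?k"
          using u_cell[OF k(1), of s] u_cell[OF k(1), of s'] k s' by auto
        show ?thesis unfolding us by (simp add: algebra_simps)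
      qed
      have \<Omega>: "\<Omega> s' - \<Omega> s = (s' - s) * a ?k" using \<Omega>_cell[OF k(1,2), of s'] s' by simp
      have "S (u s' - u s) + (\<Phi> (u s) - m s) (u s' - u s) = (s' - s) * (S (d ?k) + (\<Phi> (u s) - m s) (d ?k))"
        unfolding \<Delta> using s' by (simp add: S_scale blinfun.scaleR_right distrib_left)
      also have "\<dots> \<le> (s' - s) * a ?k" using loc(2)[OF k] s' by (intro mult_left_mono) auto
      finally show "S (u s' - u s) + (\<Phi> (u s) - m s) (u s' - u s) \<le> 0 * (M * s' - M * s)\<^sup>2 + (\<Omega> s' - \<Omega> s)"
        unfolding \<Omega> by simp
      have "(s' - s) * (M * \<epsilon> ?k) \<le> (s' - s) * a ?k"
        using s' q0[OF k(1)] by (intro mult_left_mono) (auto simp: a_def)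
      then show "\<epsilon> ?k * (M * s' - M * s) \<le> \<Omega> s' - \<Omega> s" unfolding \<Omega> by (simp add: algebra_simps)
    qed
  qed
  moreover have "\<Omega> T - \<Omega> 0 \<le> ((b * M + L) * M + b * M\<^sup>2 + 2 * L * M + 3 * c * M ^ 3 * T + 2 * M * (V T - V 0) +
        M * (2 * c * M\<^sup>2 * T + 2 * (V T - V 0))) * \<tau>\<^sup>2"
  proof -
    have hsq: "(h k)\<^sup>2 \<le> \<tau>\<^sup>2" if "k < N" for k
      using \<tau>[OF that] h[OF that] unfolding h_eq by (intro power_mono) auto
    have "\<Omega> T - \<Omega> 0 = (\<Sum>k<N. h k * a k)"
      using grid_interpolation_end[OF g, of a] by (simp add: \<Omega>_def t0 tN h_def)
    also have "\<dots> \<le> (\<Sum>k<N. \<tau>\<^sup>2 * (q k / h k + M * (2 * c * M\<^sup>2 * h k + 2 * (V (t (Suc k)) - V (t k)))))"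
    proof (rule sum_mono)
      fix k assume "k \<in> {..<N}"
      then have k: "k < N" by simp
      \<comment> \<open>In this form \<open>\<tau>\<^sup>2\<close> can be pulled out, and the
        remaining sum of \<open>q k / h k\<close> is the one bounded by
        \<open>euler_defect_sum\<close>.\<close>
      have eq: "h k * a k = (h k)\<^sup>2 * (q k / h k + M * (2 * c * M\<^sup>2 * h k + 2 * (V (t (Suc k)) - V (t k))))"
        using h[OF k] by (simp add: a_def \<epsilon>_def field_simps power2_eq_square)
      show "h k * a k \<le> \<tau>\<^sup>2 * (q k / h k + M * (2 * c * M\<^sup>2 * h k + 2 * (V (t (Suc k)) - V (t k))))"
        unfolding eq using hsq[OF k] q0[OF k] h[OF k] M0 c0 \<Delta>V[OF k]
        by (intro mult_right_mono add_nonneg_nonneg mult_nonneg_nonneg) auto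
    qed
    also have "\<dots> = \<tau>\<^sup>2 * ((\<Sum>k<N. q k / h k) + M * (2 * c * M\<^sup>2 * (\<Sum>k<N. t (Suc k) - t k) +
        2 * (\<Sum>k<N. V (t (Suc k)) - V (t k))))"
      by (simp only: sum_distrib_left sum.distrib distrib_left h_eq)
    also have "(\<Sum>k<N. t (Suc k) - t k) = T" by (simp only: sum_lessThan_telescope t0 tN diff_0_right)
    also have "(\<Sum>k<N. V (t (Suc k)) - V (t k)) = V T - V 0"
      using sum_lessThan_telescope[of "\<lambda>k. V (t k)" N] by (simp add: t0 tN)
    also have "\<tau>\<^sup>2 * ((\<Sum>k<N. q k / h k) + M * (2 * c * M\<^sup>2 * T + 2 * (V T - V 0))) \<le>
        \<tau>\<^sup>2 * (((b * M + L) * M + b * M\<^sup>2 + 2 * L * M + 3 * c * M ^ 3 * T + 2 * M * (V T - V 0)) +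
          M * (2 * c * M\<^sup>2 * T + 2 * (V T - V 0)))"
    proof (intro mult_left_mono add_right_mono)
      show "(\<Sum>k<N. q k / h k) \<le> (b * M + L) * M + b * M\<^sup>2 + 2 * L * M + 3 * c * M ^ 3 * T + 2 * M * (V T - V 0)"
        unfolding q_def d_def h_def \<xi>_def by (rule euler_defect_sum[OF e N m m' reg yr M])
    qed simp
    finally show ?thesis by (simp add: mult.commute)
  qed
  ultimately show thesis unfolding u_def by (rule that)
qed

end

section \<open>Existence and uniqueness of solutions\<close>

text \<open>By the midpoint inequality every minimizing sequence is Cauchy, so completeness in norm
  yields the minimizer.\<close>

lemma strongly_convex_has_minimizer:
  fixes J :: "'a::banach \<Rightarrow> real"
  assumes cont: "continuous_on UNIV J" and bdd: "\<And>x. l \<le> J x" and c: "c > 0"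
    and mid: "\<And>x y. J ((1/2) *\<^sub>R (x + y)) \<le> (J x + J y) / 2 - c * (norm (x - y))\<^sup>2"
  obtains x where "\<And>y. J x \<le> J y"
proof -
  define I where "I = Inf (range J)"
  have bb: "bdd_below (range J)" using bdd by (intro bdd_belowI[of _ l]) auto
  have I_le: "I \<le> J x" for x unfolding I_def using bb by (intro cInf_lower) auto
  have "\<exists>x. J x < I + inverse (real (Suc n))" for n
    using cInf_lessD[of "range J" "I + inverse (real (Suc n))"] by (auto simp: I_def)
  then obtain x where x: "\<And>n. J (x n) < I + inverse (real (Suc n))" by metis
  have "Cauchy x"
  proof (rule metric_CauchyI)
    fix e :: real assume e: "e > 0"
    then have "c * e\<^sup>2 > 0" using c by simp
    then obtain N where N: "inverse (real (Suc N)) < c * e\<^sup>2" using reals_Archimedean by blast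
    have "dist (x p) (x q) < e" if "p \<ge> N" "q \<ge> N" for p q
    proof -
      have "inverse (real (Suc n)) \<le> inverse (real (Suc N))" if "n \<ge> N" for n
        using that by (intro le_imp_inverse_le) auto
      then have "J (x p) < I + c * e\<^sup>2" "J (x q) < I + c * e\<^sup>2"
        using x[of p] x[of q] N that by (meson add_left_mono less_le_trans order_less_trans le_less_trans less_imp_le)+
      then have "c * (norm (x p - x q))\<^sup>2 < c * e\<^sup>2"
        using order_trans[OF I_le mid[of "x p" "x q"]] by (simp add: field_simps)
      then have "(norm (x p - x q))\<^sup>2 < e\<^sup>2" using c by simp
      then show ?thesis using e by (simp add: dist_norm power2_less_imp_less)
    qed
    then show "\<exists>N. \<forall>p\<ge>N. \<forall>q\<ge>N. dist (x p) (x q) < e" by blast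
  qed
  then obtain a where a: "x \<longlonglongrightarrow> a" by (auto simp: Cauchy_convergent_iff convergent_def)
  have "(\<lambda>n. J (x n)) \<longlonglongrightarrow> J a"
    by (rule continuous_on_tendsto_compose[OF cont a]) auto
  moreover have "(\<lambda>n. I + inverse (real (Suc n))) \<longlonglongrightarrow> I + 0"
    by (intro tendsto_intros LIMSEQ_inverse_real_of_nat)
  ultimately have "J a \<le> I + 0"
    by (rule LIMSEQ_le) (use x in \<open>auto intro: less_imp_le\<close>)
  then show thesis using I_le by (intro that[of a]) (auto intro: order_trans)
qed

context convex_rate_independent
begin

text \<open>On the way from \<open>y\<close> to \<open>v\<close> the smooth part contributes its
  directional derivative, and \<open>S\<close> lies below its chord by convexity. If the sum were
  negative, a short step would improve on the minimizer.\<close>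

lemma minimizer_variational_inequality:
  fixes p :: "'z \<Rightarrow>\<^sub>L real"
  assumes C: "convex C" "y \<in> C" "v \<in> C"
    and min: "\<And>x. x \<in> C \<Longrightarrow> E y - p y + S (y - x0) \<le> E x - p x + S (x - x0)"
  shows "(\<Phi> y - p) (v - y) + S (v - x0) - S (y - x0) \<ge> 0"
proof (rule ccontr)
  assume neg: "\<not> ?thesis"
  define w where "w = v - y"
  define g where "g s = E (y + s *\<^sub>R w) - s * p w + s * (S (v - x0) - S (y - x0))" for s
  have "(g has_real_derivative (\<Phi> y - p) w + S (v - x0) - S (y - x0)) (at 0)"
    unfolding g_def has_field_derivative_def
    by (auto intro!: derivative_eq_intros has_derivative_compose[OF _ E_deriv]
        simp: blinfun.scaleR_right blinfun.diff_left algebra_simps fun_eq_iff)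
  then obtain d where d: "d > 0" "\<forall>h>0. h < d \<longrightarrow> g (0 + h) < g 0"
    using DERIV_neg_dec_right neg unfolding w_def by (metis not_le)
  define s where "s = min 1 (d / 2)"
  have s: "0 < s" "s \<le> 1" "s < d" using d(1) by (auto simp: s_def)
  have x: "y + s *\<^sub>R w = (1 - s) *\<^sub>R y + s *\<^sub>R v" by (simp add: w_def algebra_simps)
  have "y + s *\<^sub>R w \<in> C" unfolding x using C s by (intro convexD) auto
  from min[OF this] have "E y + S (y - x0) \<le> E (y + s *\<^sub>R w) - s * p w + S (y + s *\<^sub>R w - x0)"
    by (simp add: blinfun.bilinear_simps)
  also have "S (y + s *\<^sub>R w - x0) \<le> (1 - s) * S (y - x0) + s * S (v - x0)"
  proof -
    have "y + s *\<^sub>R w - x0 = (1 - s) *\<^sub>R (y - x0) + s *\<^sub>R (v - x0)" by (simp add: w_def algebra_simps)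
    then show ?thesis using S_add[of "(1 - s) *\<^sub>R (y - x0)" "s *\<^sub>R (v - x0)"] s by (simp add: S_scale)
  qed
  finally have "g 0 \<le> g s" by (simp add: g_def algebra_simps)
  moreover have "g s < g 0" using d(2) s by auto
  ultimately show False by simp
qed

lemma minimizer_incl:
  fixes p :: "'z \<Rightarrow>\<^sub>L real"
  assumes min: "\<And>x. E y - p y + S (y - x0) \<le> E x - p x + S (x - x0)"
  shows "incl (y - x0) (\<Phi> y - p)"
  unfolding incl_def
proof
  fix v
  have "(\<Phi> y - p) ((v + x0) - y) + S ((v + x0) - x0) - S (y - x0) \<ge> 0"
    by (rule minimizer_variational_inequality[where C=UNIV]) (use min in auto)
  then show "S (y - x0) - (\<Phi> y - p) (v - (y - x0)) \<le> S v" by (simp add: algebra_simps)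
qed

lemma euler_step_exists:
  fixes p :: "'z \<Rightarrow>\<^sub>L real"
  shows "\<exists>y. incl (y - x0) (\<Phi> y - p)"
proof -
  define J where "J y = E y - p y + S (y - x0)" for y
  \<comment> \<open>Strong convexity is used at the midpoint \<open>a\<close>, where the first-order
    terms in \<open>w\<close> and \<open>- w\<close> cancel; \<open>\<kappa> / 8\<close> is
    \<open>\<kappa> / 2\<close> times the square of one half.\<close>
  have E_mid: "E ((1/2) *\<^sub>R (x + y)) \<le> (E x + E y) / 2 - \<kappa> / 8 * (norm (x - y))\<^sup>2" for x y
  proof -
    define a where "a = (1/2) *\<^sub>R (x + y)"
    define w where "w = (1/2) *\<^sub>R (x - y)"
    have "x = (1/2) *\<^sub>R x + (1/2) *\<^sub>R x" "y = (1/2) *\<^sub>R y + (1/2) *\<^sub>R y"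
      by (simp_all flip: scaleR_add_left)
    then have d: "x - a = w" "y - a = - w"
      unfolding a_def w_def by (simp_all add: algebra_simps)
    have "norm w = norm (x - y) / 2" by (simp add: w_def)
    then have "(norm w)\<^sup>2 = (norm (x - y))\<^sup>2 / 4" by (simp only: power_divide) simp
    then have n: "\<kappa> / 8 * (norm (x - y))\<^sup>2 = \<kappa> / 2 * (norm w)\<^sup>2" by simp
    show ?thesis
      unfolding n a_def[symmetric]
      using E_strongly_convex[of a x] E_strongly_convex[of a y] unfolding d norm_minus_cancel
      by (simp add: blinfun.minus_right field_simps)
  qed
  have S_mid: "S ((1/2) *\<^sub>R (x + y) - x0) \<le> (S (x - x0) + S (y - x0)) / 2" for x y
  proof -
    have "(1/2) *\<^sub>R (x + y) - x0 = (1/2) *\<^sub>R (x - x0) + (1/2) *\<^sub>R (y - x0)"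
      by (simp add: algebra_simps flip: scaleR_add_left)
    then show ?thesis using S_add[of "(1/2) *\<^sub>R (x - x0)" "(1/2) *\<^sub>R (y - x0)"] by (simp add: S_scale)
  qed
  obtain y where y: "\<And>x. J y \<le> J x"
  proof (rule strongly_convex_has_minimizer[of J "E 0 - (norm (\<Phi> 0 - p))\<^sup>2 / (2 * \<kappa>)" "\<kappa> / 8"])
    show "continuous_on UNIV J" unfolding J_def
      by (intro continuous_intros continuous_on_compose2[OF continuous_on_S[of UNIV]]
          has_derivative_continuous_on[OF E_deriv]) auto
    show "\<kappa> / 8 > 0" using \<kappa> by simp
    show "J ((1/2) *\<^sub>R (x + y)) \<le> (J x + J y) / 2 - \<kappa> / 8 * (norm (x - y))\<^sup>2" for x y
      using E_mid[of x y] S_mid[of x y] by (simp add: J_def blinfun.bilinear_simps field_simps)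
    fix x
    define e where "e = norm (\<Phi> 0 - p)"
    have "- (\<Phi> 0 - p) x \<le> e * norm x" unfolding e_def by (rule blinfun_le_norm(2)) auto
    then have "J x \<ge> E 0 - e * norm x + \<kappa> / 2 * (norm x)\<^sup>2"
      using E_strongly_convex[of 0 x] S_nonneg[of "x - x0"] by (simp add: J_def blinfun.diff_left)
    \<comment> \<open>Completing the square, which is where the lower bound for \<open>J\<close>
      comes from.\<close>
    moreover have "\<kappa> / 2 * (norm x)\<^sup>2 - e * norm x + e\<^sup>2 / (2 * \<kappa>) = (\<kappa> * norm x - e)\<^sup>2 / (2 * \<kappa>)"
      using \<kappa> by (simp add: power2_diff field_simps) (simp add: power2_eq_square)
    moreover have "(\<kappa> * norm x - e)\<^sup>2 / (2 * \<kappa>) \<ge> 0" using \<kappa> by simp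
    ultimately show "E 0 - (norm (\<Phi> 0 - p))\<^sup>2 / (2 * \<kappa>) \<le> J x" unfolding e_def[symmetric] by linarith
  qed (auto intro: that)
  then have "incl (y - x0) (\<Phi> y - p)" by (intro minimizer_incl) (simp add: J_def)
  then show ?thesis ..
qed

lemma uniform_euler_scheme_exists:
  assumes T: "T > 0" and N: "N > 0" and stable: "\<And>v. (\<Phi> z0 - m 0) v + S v \<ge> 0"
  obtains y where "y 0 = z0" "euler_scheme T m N (\<lambda>k. real k * (T / real N)) y"
proof -
  define t where "t k = real k * (T / real N)" for k
  have "\<exists>y. \<forall>k. (k = 0 \<longrightarrow> y k = z0) \<and> incl (y (Suc k) - y k) (\<Phi> (y (Suc k)) - m (t (Suc k)))"
    by (rule dependent_nat_choice) (use euler_step_exists in auto)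
  then obtain y where y: "y 0 = z0" "\<And>k. incl (y (Suc k) - y k) (\<Phi> (y (Suc k)) - m (t (Suc k)))" by blast
  have "grid N t" unfolding grid_def t_def   proof (intro allI impI)
    fix k
    have "T / real N > 0" using T N by simp
    then show "real k * (T / real N) < real (Suc k) * (T / real N)" by (intro mult_strict_right_mono) auto
  qed
  then have "euler_scheme T m N t y"
    using y stable N by (simp add: euler_scheme_def t_def)
  with y(1) show thesis unfolding t_def by (rule that)
qed

section \<open>Estimates independent of the grid, and the limit of Euler schemes\<close>

lemma euler_lipschitz:
  assumes e: "euler_scheme T m N t y" and ij: "i \<le> j" "j \<le> N"
    and m: "\<And>s t. 0 \<le> s \<Longrightarrow> s \<le> t \<Longrightarrow> t \<le> T \<Longrightarrow> norm (m t - m s) \<le> L * (t - s)"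
  shows "norm (y j - y i) \<le> L / \<kappa> * (t j - t i)"
  using ij
proof (induction j rule: dec_induct)
  case (step k)
  then show ?case
    using norm_triangle_ineq[of "y (Suc k) - y k" "y k - y i"] euler_increment_bound[OF e _ m, of k]
    by (simp add: algebra_simps)
qed simp

text \<open>The residuals at nodes \<open>i\<close> and \<open>Suc j\<close> differ by at most
  \<open>(b * M + L) * (t (Suc j) - t i)\<close>, so a further step costs this times
  \<open>M * (t (Suc j) - t j)\<close>, and the costs add up to at most the square of the elapsed
  time. The bound does not depend on the grid and therefore passes to the limit.\<close>

lemma euler_energy_balance:
  assumes e: "euler_scheme T m N t y" and ij: "i \<le> j" "j \<le> N"
    and m: "\<And>s t. 0 \<le> s \<Longrightarrow> s \<le> t \<Longrightarrow> t \<le> T \<Longrightarrow> norm (m t - m s) \<le> L * (t - s)"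
    and reg: "regular_on_ball r b c" and yr: "\<And>k. k \<le> N \<Longrightarrow> y k \<in> ball 0 r"
    and M: "M = L / \<kappa>"
  shows "S (y j - y i) + (\<Phi> (y i) - m (t i)) (y j - y i) \<le> (b * M + L) * M * (t j - t i)\<^sup>2"
  using ij
proof (induction j rule: dec_induct)
  case base
  then show ?case by simp
next
  case (step j)
  have g: "grid N t" and t0: "t 0 = 0" and tN: "t N = T" using e by (auto simp: euler_scheme_def)
  have j: "j < N" using step by simp
  have tt: "0 \<le> t i" "t i \<le> t (Suc j)" "t (Suc j) \<le> T" "t i \<le> t j" "t j \<le> t (Suc j)"
    using grid_mono[OF g, of 0 i] grid_mono[OF g, of i "Suc j"] grid_mono[OF g, of "Suc j" N]
      grid_mono[OF g, of i j] grid_mono[OF g, of j "Suc j"] step t0 tN by auto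
  define \<Delta> where "\<Delta> = y (Suc j) - y j"
  define K where "K = (b * M + L) * M"
  have b0: "b \<ge> 0" using reg by (auto simp: regular_on_ball_def)
  have nM: "norm (y (Suc j) - y i) \<le> M * (t (Suc j) - t i)"
    unfolding M by (rule euler_lipschitz[OF e _ _ m]) (use step in auto)
  have n\<Delta>: "norm \<Delta> \<le> M * (t (Suc j) - t j)"
    unfolding M \<Delta>_def by (rule euler_increment_bound[OF e j m])
  have "norm (\<Phi> (y (Suc j)) - \<Phi> (y i)) \<le> b * norm (y (Suc j) - y i)"
    by (rule \<Phi>_lipschitz[OF reg]) (use yr step in auto)
  also have "\<dots> \<le> b * (M * (t (Suc j) - t i))" using nM b0 by (rule mult_left_mono)
  finally have "norm ((\<Phi> (y i) - m (t i)) - (\<Phi> (y (Suc j)) - m (t (Suc j)))) \<le> (b * M + L) * (t (Suc j) - t i)"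
    using norm_triangle_ineq4[of "m (t (Suc j)) - m (t i)" "\<Phi> (y (Suc j)) - \<Phi> (y i)"] m[OF tt(1-3)]
    by (simp add: algebra_simps)
  from blinfun_le_norm(1)[OF this n\<Delta>]
  have 1: "(\<Phi> (y i) - m (t i)) \<Delta> \<le> (\<Phi> (y (Suc j)) - m (t (Suc j))) \<Delta> + K * ((t (Suc j) - t i) * (t (Suc j) - t j))"
    unfolding K_def by (simp add: blinfun.diff_left mult_ac)
  have 2: "S \<Delta> + (\<Phi> (y (Suc j)) - m (t (Suc j))) \<Delta> \<le> 0"
    using e j unfolding euler_scheme_def incl_iff \<Delta>_def by blast
  have K0: "0 \<le> K * ((t j - t i) * (t (Suc j) - t j))"
  proof (cases "t j - t i = 0 \<or> t (Suc j) - t j = 0")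
    case False
    then have "0 < t (Suc j) - t i" "0 < t (Suc j) - t j" using tt by auto
    then have "0 \<le> M" "0 \<le> L"
      using order_trans[OF norm_ge_zero nM] order_trans[OF norm_ge_zero m[OF tt(1-3)]] by (simp_all add: zero_le_mult_iff)
    then show ?thesis using b0 tt by (simp add: K_def)
  qed auto
  have "S (y (Suc j) - y i) \<le> S (y j - y i) + S \<Delta>" using S_add[of "y j - y i" \<Delta>] by (simp add: \<Delta>_def)
  moreover have "(\<Phi> (y i) - m (t i)) (y (Suc j) - y i) = (\<Phi> (y i) - m (t i)) (y j - y i) + (\<Phi> (y i) - m (t i)) \<Delta>"
    by (simp add: \<Delta>_def flip: blinfun.add_right)
  ultimately have "S (y (Suc j) - y i) + (\<Phi> (y i) - m (t i)) (y (Suc j) - y i) \<le>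
      K * (t j - t i)\<^sup>2 + K * ((t (Suc j) - t i) * (t (Suc j) - t j))"
    using step.IH[folded K_def] 1 2 step j by linarith
  also have "\<dots> = K * (t (Suc j) - t i)\<^sup>2 - K * ((t j - t i) * (t (Suc j) - t j))"
    by (simp add: power2_eq_square algebra_simps)
  finally show ?case using K0 unfolding K_def by linarith
qed

end

text \<open>The Gronwall factor of \<open>approx_solution_comparison\<close> with
  \<open>k = 0\<close>, times four times the defect constant of
  \<open>euler_interpolant_approx_solution\<close>; \<open>W\<close> stands for
  \<open>V T - V 0\<close>.\<close>

definition euler_error_const :: "real \<Rightarrow> real \<Rightarrow> real \<Rightarrow> real \<Rightarrow> real \<Rightarrow> real \<Rightarrow> real \<Rightarrow> real" where
  "euler_error_const \<kappa> L T W r b c = (let M = L / \<kappa> in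
     exp ((2 * c / \<kappa> + 4 * r * c + 4 * b) * (M * T)) *
     (4 * ((b * M + L) * M + b * M\<^sup>2 + 2 * L * M + 3 * c * M ^ 3 * T + 2 * M * W +
        M * (2 * c * M\<^sup>2 * T + 2 * W))))"

context convex_rate_independent
begin

lemma euler_in_ball:
  assumes e: "euler_scheme T m N t y" and k: "k \<le> N"
    and m: "\<And>s t. 0 \<le> s \<Longrightarrow> s \<le> t \<Longrightarrow> t \<le> T \<Longrightarrow> norm (m t - m s) \<le> L * (t - s)" and L: "0 \<le> L"
    and r: "norm (y 0) + L / \<kappa> * T < r"
  shows "y k \<in> ball 0 r"
proof -
  have g: "grid N t" and tN: "t N = T" using e by (auto simp: euler_scheme_def)
  have "t k \<le> T" using grid_mono[OF g k] tN by simp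
  then have "L / \<kappa> * t k \<le> L / \<kappa> * T" using L \<kappa> by (intro mult_left_mono) auto
  then show ?thesis
    using euler_bound[OF e k m] norm_triangle_sub[of "y k" "y 0"] r by simp
qed

text \<open>The two grids are unrelated. The comparison acts on the interpolants in continuous time,
  with the common clock \<open>M * s\<close>.\<close>

lemma euler_interpolants_close:
  assumes T: "T > 0" and L: "0 \<le> L"
    and m: "\<And>s t. 0 \<le> s \<Longrightarrow> s \<le> t \<Longrightarrow> t \<le> T \<Longrightarrow> norm (m t - m s) \<le> L * (t - s)"
    and m': "\<And>s c t. 0 \<le> s \<Longrightarrow> s \<le> c \<Longrightarrow> c \<le> t \<Longrightarrow> t \<le> T \<Longrightarrow>
      norm (m t - m s - (t - s) *\<^sub>R m' c) \<le> (t - s) * (V t - V s)"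
    and reg: "regular_on_ball r b c" and r: "norm z0 + L / \<kappa> * T < r"
    and e1: "euler_scheme T m N1 t1 y1" "y1 0 = z0" "\<And>k. k < N1 \<Longrightarrow> t1 (Suc k) - t1 k \<le> \<tau>1"
    and e2: "euler_scheme T m N2 t2 y2" "y2 0 = z0" "\<And>k. k < N2 \<Longrightarrow> t2 (Suc k) - t2 k \<le> \<tau>2"
    and s: "s \<in> {0..T}"
  shows "\<kappa> * (norm (affine_interpolant N1 t1 y1 s - affine_interpolant N2 t2 y2 s))\<^sup>2 \<le>
    euler_error_const \<kappa> L T (V T - V 0) r b c * (\<tau>1\<^sup>2 + \<tau>2\<^sup>2)"
proof -
  define M where "M = L / \<kappa>"
  define Q where "Q = (b * M + L) * M + b * M\<^sup>2 + 2 * L * M + 3 * c * M ^ 3 * T + 2 * M * (V T - V 0) +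
        M * (2 * c * M\<^sup>2 * T + 2 * (V T - V 0))"
  have pos: "N > 0" if "euler_scheme T m N t y" for N t y
    using that T by (cases N) (auto simp: euler_scheme_def)
  have ends: "t 0 = 0" "t N = T" "grid N t" if "euler_scheme T m N t y" for N t y
    using that by (auto simp: euler_scheme_def)
  have yr1: "y1 k \<in> ball 0 r" if "k \<le> N1" for k
    by (rule euler_in_ball[OF e1(1) that m L]) (use r e1(2) in auto)
  have yr2: "y2 k \<in> ball 0 r" if "k \<le> N2" for k
    by (rule euler_in_ball[OF e2(1) that m L]) (use r e2(2) in auto)
  have start: "affine_interpolant N t y 0 = y 0" if "euler_scheme T m N t y" for N t y
  proof -
    have "t 0 < t (Suc 0)" using ends(3)[OF that] pos[OF that] by (simp add: grid_def)
    then show ?thesis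
      using affine_interpolant_cell[OF ends(3)[OF that] pos[OF that], of 0 y] ends[OF that] by simp
  qed
  obtain \<omega>1 \<Omega>1 where a1: "approx_solution T m (\<lambda>s. M * s) 0 \<omega>1 \<Omega>1 (affine_interpolant N1 t1 y1)"
    and b1: "\<Omega>1 T - \<Omega>1 0 \<le> Q * \<tau>1\<^sup>2"
    unfolding Q_def
    by (rule euler_interpolant_approx_solution[OF e1(1) pos[OF e1(1)] _ _ reg _ M_def L, where m'=m' and V=V and \<tau>=\<tau>1])
      (assumption | erule (2) m | erule (3) m' | erule yr1 | erule e1(3) | erule (1) that)+
  obtain \<omega>2 \<Omega>2 where a2: "approx_solution T m (\<lambda>s. M * s) 0 \<omega>2 \<Omega>2 (affine_interpolant N2 t2 y2)"
    and b2: "\<Omega>2 T - \<Omega>2 0 \<le> Q * \<tau>2\<^sup>2"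
    unfolding Q_def
    by (rule euler_interpolant_approx_solution[OF e2(1) pos[OF e2(1)] _ _ reg _ M_def L, where m'=m' and V=V and \<tau>=\<tau>2])
      (assumption | erule (2) m | erule (3) m' | erule yr2 | erule e2(3) | erule (1) that)+
  have "\<kappa> * (norm (affine_interpolant N1 t1 y1 s - affine_interpolant N2 t2 y2 s))\<^sup>2 \<le>
      exp ((2 * c / \<kappa> + 4 * r * c + 4 * b + 4 * 0) * (M * T - M * 0)) *
        (4 * ((\<Omega>1 s - \<Omega>1 0) + (\<Omega>2 s - \<Omega>2 0)))"
  proof (rule approx_solution_comparison[OF _ reg _ _ a1 a2])
    show "affine_interpolant N1 t1 y1 t \<in> ball 0 r" if "t \<in> {0..T}" for t
      by (rule affine_interpolant_in_ball[OF ends(3)[OF e1(1)] _ _ pos[OF e1(1)] yr1])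
        (use that ends[OF e1(1)] in auto)
    show "affine_interpolant N2 t2 y2 t \<in> ball 0 r" if "t \<in> {0..T}" for t
      by (rule affine_interpolant_in_ball[OF ends(3)[OF e2(1)] _ _ pos[OF e2(1)] yr2])
        (use that ends[OF e2(1)] in auto)
    show "affine_interpolant N1 t1 y1 0 = affine_interpolant N2 t2 y2 0"
      using start[OF e1(1)] start[OF e2(1)] e1(2) e2(2) by simp
    show "continuous_on {0..T} (\<lambda>s. M * s)" by (intro continuous_intros)
  qed (use T s in auto)
  also have "\<dots> \<le> exp ((2 * c / \<kappa> + 4 * r * c + 4 * b + 4 * 0) * (M * T - M * 0)) *
        (4 * (Q * \<tau>1\<^sup>2 + Q * \<tau>2\<^sup>2))"
    using b1 b2 approx_solutionD(2)[OF a1, of s T] approx_solutionD(2)[OF a2, of s T] s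
    by (intro mult_left_mono add_mono) auto
  also have "\<dots> = euler_error_const \<kappa> L T (V T - V 0) r b c * (\<tau>1\<^sup>2 + \<tau>2\<^sup>2)"
    unfolding euler_error_const_def Let_def M_def[symmetric] Q_def[symmetric] by (simp add: algebra_simps)
  finally show ?thesis .
qed

text \<open>A derivative-free notion of solution that is closed under pointwise limits. The error
  \<open>k * (t - s)\<^sup>2\<close> disappears when the inequality is divided by
  \<open>t - s\<close> and the interval shrinks.\<close>

definition solution_curve :: "real \<Rightarrow> (real \<Rightarrow> ('z \<Rightarrow>\<^sub>L real)) \<Rightarrow> real \<Rightarrow> real \<Rightarrow> (real \<Rightarrow> 'z) \<Rightarrow> bool" where
  "solution_curve T m M k z \<longleftrightarrow>
     (\<forall>s t. 0 \<le> s \<and> s \<le> t \<and> t \<le> T \<longrightarrow> norm (z t - z s) \<le> M * (t - s)) \<and>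
     (\<forall>s v. 0 \<le> s \<and> s \<le> T \<longrightarrow> (\<Phi> (z s) - m s) v + S v \<ge> 0) \<and>
     (\<forall>s t. 0 \<le> s \<and> s \<le> t \<and> t \<le> T \<longrightarrow>
        S (z t - z s) + (\<Phi> (z s) - m s) (z t - z s) \<le> k * (t - s)\<^sup>2)"

text \<open>Schemes on uniform grids supply the Cauchy sequence. Any other scheme is compared with
  these, and letting only the uniform mesh tend to 0 leaves its own error
  \<open>\<tau>\<^sup>2\<close>; hence one limit \<open>z\<close> serves for all schemes that start
  in \<open>z0\<close>.\<close>

theorem euler_schemes_converge:
  assumes T: "T > 0" and L: "0 \<le> L"
    and m: "\<And>s t. 0 \<le> s \<Longrightarrow> s \<le> t \<Longrightarrow> t \<le> T \<Longrightarrow> norm (m t - m s) \<le> L * (t - s)"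
    and m': "\<And>s c t. 0 \<le> s \<Longrightarrow> s \<le> c \<Longrightarrow> c \<le> t \<Longrightarrow> t \<le> T \<Longrightarrow>
      norm (m t - m s - (t - s) *\<^sub>R m' c) \<le> (t - s) * (V t - V s)"
    and reg: "regular_on_ball r b c" and r: "norm z0 + L / \<kappa> * T < r"
    and stable: "\<And>v. (\<Phi> z0 - m 0) v + S v \<ge> 0"
  obtains z where "z 0 = z0" "solution_curve T m (L / \<kappa>) ((b * (L / \<kappa>) + L) * (L / \<kappa>)) z"
    and "\<And>N t y \<tau> s. euler_scheme T m N t y \<Longrightarrow> y 0 = z0 \<Longrightarrow> (\<And>k. k < N \<Longrightarrow> t (Suc k) - t k \<le> \<tau>) \<Longrightarrow>
      s \<in> {0..T} \<Longrightarrow>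
      \<kappa> * (norm (affine_interpolant N t y s - z s))\<^sup>2 \<le> euler_error_const \<kappa> L T (V T - V 0) r b c * \<tau>\<^sup>2"
proof -
  define M where "M = L / \<kappa>"
  define C where "C = euler_error_const \<kappa> L T (V T - V 0) r b c"
  have M0: "0 \<le> M" using L \<kappa> by (simp add: M_def)
  define \<tau> where "\<tau> n = T / real (Suc n)" for n
  define t where "t n k = real k * \<tau> n" for n k
  have \<tau>: "\<tau> n > 0" for n using T by (simp add: \<tau>_def)
  have \<tau>0: "\<tau> \<longlonglongrightarrow> 0"
  proof -
    have "(\<lambda>n. T * inverse (real (Suc n))) \<longlonglongrightarrow> T * 0"
      by (intro tendsto_intros LIMSEQ_inverse_real_of_nat)
    then show ?thesis unfolding \<tau>_def by (simp add: divide_inverse)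
  qed
  have "\<exists>y. y 0 = z0 \<and> euler_scheme T m (Suc n) (t n) y" for n
  proof -
    obtain y where "y 0 = z0" "euler_scheme T m (Suc n) (\<lambda>k. real k * (T / real (Suc n))) y"
      by (rule uniform_euler_scheme_exists[of T "Suc n" z0 m]) (use T stable in auto)
    then show ?thesis unfolding t_def \<tau>_def by blast
  qed
  then obtain y where y: "\<And>n. y n 0 = z0" "\<And>n. euler_scheme T m (Suc n) (t n) (y n)" by metis
  have mesh: "t n (Suc k) - t n k \<le> \<tau> n" for n k by (simp add: t_def algebra_simps)
  define u where "u n = affine_interpolant (Suc n) (t n) (y n)" for n
  have close: "\<kappa> * (norm (affine_interpolant N t' y' s - u n s))\<^sup>2 \<le> C * (\<tau>'\<^sup>2 + (\<tau> n)\<^sup>2)"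
    if "euler_scheme T m N t' y'" "y' 0 = z0" "\<And>k. k < N \<Longrightarrow> t' (Suc k) - t' k \<le> \<tau>'" "s \<in> {0..T}"
    for N t' y' \<tau>' s n
    unfolding C_def u_def
    using euler_interpolants_close[OF T L m m' reg r that(1-3) y(2,1) mesh that(4)] .
  have "Cauchy (\<lambda>n. u n s)" if s: "s \<in> {0..T}" for s
  proof (rule metric_CauchyI)
    fix e :: real assume e: "e > 0"
    have "(\<lambda>n. C * (\<tau> n)\<^sup>2) \<longlonglongrightarrow> C * 0\<^sup>2" by (intro tendsto_intros \<tau>0)
    then have "\<forall>\<^sub>F n in sequentially. C * (\<tau> n)\<^sup>2 < \<kappa> * e\<^sup>2 / 2"
      using e \<kappa> by (intro order_tendstoD) auto
    then obtain n0 where n0: "\<And>n. n \<ge> n0 \<Longrightarrow> C * (\<tau> n)\<^sup>2 < \<kappa> * e\<^sup>2 / 2" by (auto simp: eventually_sequentially)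
    have "dist (u p s) (u q s) < e" if "p \<ge> n0" "q \<ge> n0" for p q
    proof -
      have "\<kappa> * (norm (u p s - u q s))\<^sup>2 \<le> C * ((\<tau> p)\<^sup>2 + (\<tau> q)\<^sup>2)"
        using close[OF y(2,1) mesh s] unfolding u_def .
      also have "\<dots> < \<kappa> * e\<^sup>2" using n0[OF that(1)] n0[OF that(2)] by (simp add: distrib_left)
      finally have "(norm (u p s - u q s))\<^sup>2 < e\<^sup>2" using \<kappa> by simp
      then show ?thesis using e by (simp add: dist_norm power2_less_imp_less)
    qed
    then show "\<exists>n0. \<forall>p\<ge>n0. \<forall>q\<ge>n0. dist (u p s) (u q s) < e" by blast
  qed
  then have "\<exists>x. (\<lambda>n. u n s) \<longlonglongrightarrow> x" if "s \<in> {0..T}" for s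
    using that by (simp add: Cauchy_convergent_iff convergent_def)
  then obtain z where z: "\<And>s. s \<in> {0..T} \<Longrightarrow> (\<lambda>n. u n s) \<longlonglongrightarrow> z s" by metis
  have err: "\<kappa> * (norm (affine_interpolant N t' y' s - z s))\<^sup>2 \<le> C * \<tau>'\<^sup>2"
    if "euler_scheme T m N t' y'" "y' 0 = z0" "\<And>k. k < N \<Longrightarrow> t' (Suc k) - t' k \<le> \<tau>'" "s \<in> {0..T}"
    for N t' y' \<tau>' s
  proof (rule LIMSEQ_le)
    show "(\<lambda>n. \<kappa> * (norm (affine_interpolant N t' y' s - u n s))\<^sup>2) \<longlonglongrightarrow>
        \<kappa> * (norm (affine_interpolant N t' y' s - z s))\<^sup>2"
      by (intro tendsto_intros z that)
    have "(\<lambda>n. C * (\<tau>'\<^sup>2 + (\<tau> n)\<^sup>2)) \<longlonglongrightarrow> C * (\<tau>'\<^sup>2 + 0\<^sup>2)" by (intro tendsto_intros \<tau>0)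
    then show "(\<lambda>n. C * (\<tau>'\<^sup>2 + (\<tau> n)\<^sup>2)) \<longlonglongrightarrow> C * \<tau>'\<^sup>2" by simp
    show "\<exists>k. \<forall>n\<ge>k. \<kappa> * (norm (affine_interpolant N t' y' s - u n s))\<^sup>2 \<le> C * (\<tau>'\<^sup>2 + (\<tau> n)\<^sup>2)"
      using close[OF that] by blast
  qed
  \<comment> \<open>Index of the last node not after \<open>s\<close>. Stability holds exactly at
    nodes but only approximately for the interpolants, so the limit properties are derived along
    nodes.\<close>
  define i where "i s n = nat \<lfloor>s / \<tau> n\<rfloor>" for s n
  have node: "i s n \<le> Suc n" "t n (i s n) \<le> s" "s - t n (i s n) \<le> \<tau> n" if "s \<in> {0..T}" for s n
  proof -
    have "T = real (Suc n) * \<tau> n" by (simp add: \<tau>_def)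
    then have x: "0 \<le> s / \<tau> n" "s / \<tau> n \<le> real (Suc n)" using that \<tau>[of n] by (auto simp: pos_divide_le_eq)
    have "real (i s n) \<le> s / \<tau> n \<and> s / \<tau> n \<le> real (i s n) + 1" using x(1) unfolding i_def by linarith
    then have i: "real (i s n) \<le> s / \<tau> n" "s / \<tau> n \<le> real (i s n) + 1" by auto
    have "real (i s n) \<le> real (Suc n)" using i x by linarith
    then show "i s n \<le> Suc n" by (simp only: of_nat_le_iff)
    show "t n (i s n) \<le> s" using i(1) \<tau>[of n] by (simp add: t_def field_simps)
    show "s - t n (i s n) \<le> \<tau> n" using i(2) \<tau>[of n] by (simp add: t_def field_simps)
  qed
  have t_lim: "(\<lambda>n. t n (i s n)) \<longlonglongrightarrow> s" if "s \<in> {0..T}" for s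
  proof -
    have "(\<lambda>n. t n (i s n) - s) \<longlonglongrightarrow> 0"
      by (rule Lim_null_comparison[OF _ \<tau>0]) (use node[OF that] in auto)
    then show ?thesis by (simp add: LIM_zero_iff)
  qed
  have y_lim: "(\<lambda>n. y n (i s n)) \<longlonglongrightarrow> z s" if s: "s \<in> {0..T}" for s
  proof -
    have near: "norm (u n s - y n (i s n)) \<le> M * \<tau> n" for n
    proof -
      have g: "grid (Suc n) (t n)" and ends: "t n 0 = 0" "t n (Suc n) = T"
        using y(2)[of n] by (auto simp: euler_scheme_def)
      show ?thesis
      proof (cases "i s n < Suc n")
        case True
        have c: "t n (i s n) \<le> s" "s \<le> t n (Suc (i s n))"
          using node[OF s, of n] by (auto simp: t_def algebra_simps)
        have h: "t n (Suc (i s n)) - t n (i s n) = \<tau> n" by (simp add: t_def algebra_simps)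
        have "u n s - y n (i s n) = ((s - t n (i s n)) / \<tau> n) *\<^sub>R (y n (Suc (i s n)) - y n (i s n))"
          unfolding u_def affine_interpolant_cell[OF g True c] h by simp
        then have "norm (u n s - y n (i s n)) = ((s - t n (i s n)) / \<tau> n) * norm (y n (Suc (i s n)) - y n (i s n))"
          using c \<tau>[of n] by simp
        also have "\<dots> \<le> 1 * (M * \<tau> n)"
          using c node(3)[OF s, of n] \<tau>[of n] euler_increment_bound[OF y(2) True m] M0 unfolding h M_def
          by (intro mult_mono) auto
        finally show ?thesis by simp
      next
        case False
        then have i: "i s n = Suc n" using node(1)[OF s, of n] by simp
        then have "s = t n (Suc n)" using node(2)[OF s, of n] ends s by auto
        moreover have "u n (t n (Suc n)) = y n (Suc n)"
        proof -
          have "t n n < t n (Suc n)" using g by (simp add: grid_def)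
          then show ?thesis using affine_interpolant_cell[OF g lessI, of "t n (Suc n)" "y n"] by (simp add: u_def)
        qed
        ultimately show ?thesis using i M0 \<tau>[of n] by simp
      qed
    qed
    have "(\<lambda>n. M * \<tau> n) \<longlonglongrightarrow> 0" using tendsto_mult_left[OF \<tau>0, of M] by simp
    then have "(\<lambda>n. u n s - y n (i s n)) \<longlonglongrightarrow> 0"
      by (rule Lim_null_comparison[OF always_eventually[OF allI[OF near]]])
    from tendsto_diff[OF z[OF s] this] show ?thesis by simp
  qed
  have m_cont: "continuous_on {0..T} m" by (rule lipschitz_bound_continuous_on[OF L m])
  have \<xi>_lim: "(\<lambda>n. \<Phi> (y n (i s n)) - m (t n (i s n))) \<longlonglongrightarrow> \<Phi> (z s) - m s" if s: "s \<in> {0..T}" for s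
  proof (intro tendsto_diff)
    show "(\<lambda>n. \<Phi> (y n (i s n))) \<longlonglongrightarrow> \<Phi> (z s)"
      by (rule continuous_on_tendsto_compose[OF continuous_on_\<Phi>[of UNIV] y_lim[OF s]]) auto
    have "t n (i s n) \<in> {0..T}" for n using node(2)[OF s, of n] \<tau>[of n] s by (auto simp: t_def)
    then show "(\<lambda>n. m (t n (i s n))) \<longlonglongrightarrow> m s"
      by (intro continuous_on_tendsto_compose[OF m_cont t_lim[OF s] s]) auto
  qed
  have i_mono: "i s n \<le> i s' n" if "s \<le> s'" for s s' n
    unfolding i_def using that \<tau>[of n] by (intro nat_mono floor_mono divide_right_mono) auto
  have "solution_curve T m M ((b * M + L) * M) z"
    unfolding solution_curve_def
  proof (intro conjI allI impI; elim conjE)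
    fix s s' assume ss: "0 \<le> s" "s \<le> s'" "s' \<le> T"
    then have s: "s \<in> {0..T}" "s' \<in> {0..T}" by auto
    show "norm (z s' - z s) \<le> M * (s' - s)"
    proof (rule LIMSEQ_le)
      show "(\<lambda>n. norm (y n (i s' n) - y n (i s n))) \<longlonglongrightarrow> norm (z s' - z s)"
        by (intro tendsto_intros y_lim s)
      show "(\<lambda>n. M * (t n (i s' n) - t n (i s n))) \<longlonglongrightarrow> M * (s' - s)" by (intro tendsto_intros t_lim s)
      show "\<exists>k. \<forall>n\<ge>k. norm (y n (i s' n) - y n (i s n)) \<le> M * (t n (i s' n) - t n (i s n))"
        unfolding M_def using euler_lipschitz[OF y(2) i_mono[OF ss(2)] node(1)[OF s(2)] m] by blast
    qed
    show "S (z s' - z s) + (\<Phi> (z s) - m s) (z s' - z s) \<le> (b * M + L) * M * (s' - s)\<^sup>2"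
    proof (rule LIMSEQ_le)
      have "(\<lambda>n. S (y n (i s' n) - y n (i s n))) \<longlonglongrightarrow> S (z s' - z s)"
        by (rule continuous_on_tendsto_compose[OF continuous_on_S[of UNIV]]) (auto intro!: tendsto_diff y_lim s)
      moreover have "(\<lambda>n. (\<Phi> (y n (i s n)) - m (t n (i s n))) (y n (i s' n) - y n (i s n))) \<longlonglongrightarrow>
          (\<Phi> (z s) - m s) (z s' - z s)"
        by (intro blinfun.tendsto \<xi>_lim tendsto_diff y_lim s)
      ultimately show "(\<lambda>n. S (y n (i s' n) - y n (i s n)) +
          (\<Phi> (y n (i s n)) - m (t n (i s n))) (y n (i s' n) - y n (i s n))) \<longlonglongrightarrow>
          S (z s' - z s) + (\<Phi> (z s) - m s) (z s' - z s)" by (rule tendsto_add)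
      show "(\<lambda>n. (b * M + L) * M * (t n (i s' n) - t n (i s n))\<^sup>2) \<longlonglongrightarrow> (b * M + L) * M * (s' - s)\<^sup>2"
        by (intro tendsto_intros t_lim s)
      have yr: "y n k \<in> ball 0 r" if "k \<le> Suc n" for n k
        by (rule euler_in_ball[OF y(2) that m L]) (use r y(1) in auto)
      show "\<exists>k. \<forall>n\<ge>k. S (y n (i s' n) - y n (i s n)) +
          (\<Phi> (y n (i s n)) - m (t n (i s n))) (y n (i s' n) - y n (i s n)) \<le>
          (b * M + L) * M * (t n (i s' n) - t n (i s n))\<^sup>2"
        using euler_energy_balance[OF y(2) i_mono[OF ss(2)] node(1)[OF s(2)] m reg yr M_def] by blast
    qed
  next
    fix s v assume "0 \<le> s" "s \<le> T"
    then have s: "s \<in> {0..T}" by simp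
    show "0 \<le> (\<Phi> (z s) - m s) v + S v"
    proof (rule LIMSEQ_le_const)
      show "(\<lambda>n. (\<Phi> (y n (i s n)) - m (t n (i s n))) v + S v) \<longlonglongrightarrow> (\<Phi> (z s) - m s) v + S v"
        by (intro tendsto_add blinfun.tendsto \<xi>_lim s tendsto_const)
      show "\<exists>k. \<forall>n\<ge>k. 0 \<le> (\<Phi> (y n (i s n)) - m (t n (i s n))) v + S v"
        using euler_stable[OF y(2) node(1)[OF s]] by blast
    qed
  qed
  moreover have "z 0 = z0"
  proof -
    have "(\<lambda>n. y n (i 0 n)) \<longlonglongrightarrow> z 0" using T by (intro y_lim) auto
    moreover have "y n (i 0 n) = z0" for n using y(1) by (simp add: i_def)
    ultimately show ?thesis by (simp add: LIMSEQ_const_iff)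
  qed
  ultimately show thesis using that[of z] err unfolding M_def C_def by metis
qed

end

section \<open>Limit curves as differential solutions, and uniqueness\<close>

lemma in_closure_diff_negligible:
  fixes T :: real
  assumes N: "negligible N" and T: "T > 0" and s: "s \<in> {0..T}"
  shows "s \<in> closure ({0..T} - N)"
  unfolding closure_approachable
proof (intro allI impI)
  fix e :: real assume e: "e > 0"
  have "max 0 (s - e) < min T (s + e)" using e s T by auto
  then have "\<not> negligible {max 0 (s - e)<..<min T (s + e)}"
    by (intro open_not_negligible) (auto simp del: max_less_iff_conj min_less_iff_conj)
  then obtain x where "x \<in> {max 0 (s - e)<..<min T (s + e)}" "x \<notin> N"
    using negligible_subset[OF N] by blast
  then show "\<exists>y\<in>{0..T} - N. dist y s < e"
    by (intro bexI[of _ x]) (auto simp: dist_real_def)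
qed

context convex_rate_independent
begin

lemma solution_curveD:
  assumes "solution_curve T m M k z"
  shows "0 \<le> s \<Longrightarrow> s \<le> t \<Longrightarrow> t \<le> T \<Longrightarrow> norm (z t - z s) \<le> M * (t - s)"
    and "0 \<le> s \<Longrightarrow> s \<le> T \<Longrightarrow> (\<Phi> (z s) - m s) v + S v \<ge> 0"
    and "0 \<le> s \<Longrightarrow> s \<le> t \<Longrightarrow> t \<le> T \<Longrightarrow>
        S (z t - z s) + (\<Phi> (z s) - m s) (z t - z s) \<le> k * (t - s)\<^sup>2"
  using assms[unfolded solution_curve_def, THEN conjunct1, rule_format, of s t]
    assms[unfolded solution_curve_def, THEN conjunct2, THEN conjunct1, rule_format, of s v]
    assms[unfolded solution_curve_def, THEN conjunct2, THEN conjunct2, rule_format, of s t]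
  by simp_all

text \<open>The energy inequality on the dyadic cell containing \<open>x\<close>, divided by the
  cell length \<open>h j\<close>, leaves the error \<open>k * h j\<close>, which tends to 0. The
  argument uses convergence of the slopes over these cells, not differentiability of
  \<open>z\<close> at \<open>x\<close>.\<close>

lemma solution_curve_incl_dyadic_limit:
  assumes T: "T > 0" and z: "solution_curve T m M k z" and M: "M \<ge> 0" and m: "continuous_on {0..T} m"
    and x: "x \<in> {0..<T}" and r: "strict_mono r"
    and lim: "(\<lambda>j. dyadic_step T (r j) (dyadic_slope T z (r j)) x) \<longlonglongrightarrow> g"
  shows "incl g (\<Phi> (z x) - m x)"
proof -
  define h where "h j = T / 2 ^ r j" for j
  define a where "a j = real (nat \<lfloor>x * 2 ^ r j / T\<rfloor>) * h j" for j
  define d where "d j = dyadic_slope T z (r j) (nat \<lfloor>x * 2 ^ r j / T\<rfloor>)" for j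
  have d_lim: "d \<longlonglongrightarrow> g" using lim x by (simp add: dyadic_step_def d_def[abs_def])
  have h: "h j > 0" for j using T by (simp add: h_def)
  have "(\<lambda>n. T * (1/2) ^ n) \<longlonglongrightarrow> T * 0" by (intro tendsto_intros LIMSEQ_power_zero) simp
  then have "(\<lambda>n. T / 2 ^ n) \<longlonglongrightarrow> 0" by (simp add: power_divide)
  from LIMSEQ_subseq_LIMSEQ[OF this r] have h_lim: "h \<longlonglongrightarrow> 0" by (simp add: h_def[abs_def] o_def)
  have ax: "a j \<le> x" "x < a j + h j" "0 \<le> a j" "a j + h j \<le> T" for j
  proof -
    note i = dyadic_index[OF T x, of "r j"]
    show "a j \<le> x" using i(2) by (simp add: a_def h_def)
    show "x < a j + h j" using i(3) by (simp add: a_def h_def algebra_simps add_divide_distrib)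
    show "0 \<le> a j" using h[of j] by (simp add: a_def)
    show "a j + h j \<le> T" using dyadic_node_le(1)[OF T Suc_leI[OF i(1)]] by (simp add: a_def h_def algebra_simps add_divide_distrib)
  qed
  have a_lim: "a \<longlonglongrightarrow> x"
  proof -
    have near: "norm (a j - x) \<le> h j" for j using ax(1,2)[of j] by simp
    have "(\<lambda>j. a j - x) \<longlonglongrightarrow> 0"
      by (rule Lim_null_comparison[OF always_eventually[OF allI[OF near]] h_lim])
    then show ?thesis by (simp add: LIM_zero_iff)
  qed
  have z_cont: "continuous_on {0..T} z"
    by (rule lipschitz_bound_continuous_on[OF M solution_curveD(1)[OF z]])
  have aT: "a j \<in> {0..T}" for j using ax[of j] x by auto
  have xT: "x \<in> {0..T}" using x by simp
  have za_lim: "(\<lambda>j. z (a j)) \<longlonglongrightarrow> z x"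
    by (rule continuous_on_tendsto_compose[OF z_cont a_lim xT]) (use aT in auto)
  have "(\<lambda>j. \<Phi> (z (a j)) - m (a j)) \<longlonglongrightarrow> \<Phi> (z x) - m x"
    by (intro tendsto_diff continuous_on_tendsto_compose[OF continuous_on_\<Phi>[of UNIV] za_lim]
        continuous_on_tendsto_compose[OF m a_lim xT]) (use aT in auto)
  moreover have "(\<lambda>j. S (d j)) \<longlonglongrightarrow> S g"
    by (rule continuous_on_tendsto_compose[OF continuous_on_S[of UNIV] d_lim]) auto
  ultimately have "(\<lambda>j. S (d j) + (\<Phi> (z (a j)) - m (a j)) (d j)) \<longlonglongrightarrow> S g + (\<Phi> (z x) - m x) g"
    by (intro tendsto_add blinfun.tendsto d_lim)
  moreover have "(\<lambda>j. k * h j) \<longlonglongrightarrow> 0" using tendsto_mult_left[OF h_lim, of k] by simp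
  moreover have "S (d j) + (\<Phi> (z (a j)) - m (a j)) (d j) \<le> k * h j" for j
  proof -
    have zd: "z (a j + h j) - z (a j) = h j *\<^sub>R d j"
      using h[of j] T by (simp add: d_def dyadic_slope_def a_def h_def algebra_simps add_divide_distrib)
    have "S (z (a j + h j) - z (a j)) + (\<Phi> (z (a j)) - m (a j)) (z (a j + h j) - z (a j)) \<le> k * (a j + h j - a j)\<^sup>2"
      by (rule solution_curveD(3)[OF z]) (use ax(3,4)[of j] h[of j] in auto)
    then have "h j * (S (d j) + (\<Phi> (z (a j)) - m (a j)) (d j)) \<le> h j * (k * h j)"
      unfolding zd using h[of j] by (simp add: S_scale blinfun.scaleR_right distrib_left power2_eq_square mult_ac)
    then show ?thesis using h[of j] by simp
  qed
  ultimately have "S g + (\<Phi> (z x) - m x) g \<le> 0"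
    using LIMSEQ_le[of "\<lambda>j. S (d j) + (\<Phi> (z (a j)) - m (a j)) (d j)"] by blast
  then show ?thesis using solution_curveD(2)[OF z, of x] xT by (simp add: incl_iff)
qed

text \<open>
  The energy estimate for a \<open>W\<^sup>1\<^sup>,\<^sup>1\<close> curve: the pairs \<open>(w', |w'|)\<close> lie in a closed convex cone,
  hence so does their integral. This replaces Jensen's inequality for the gauge integral.
\<close>

lemma W11_energy_bound:
  fixes \<xi> :: "'z \<Rightarrow>\<^sub>L real" and w' :: "real \<Rightarrow> 'z"
  assumes w': "(w' has_integral J) {s..t}" and n': "((\<lambda>x. norm (w' x)) has_integral j) {s..t}"
    and N: "negligible N" and en: "\<And>x. x \<in> {s..t} - N \<Longrightarrow> S (w' x) + \<xi> (w' x) \<le> e * norm (w' x)"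
  shows "S J + \<xi> J \<le> e * j"
proof -
  define C where "C = {p :: 'z \<times> real. S (fst p) + \<xi> (fst p) \<le> e * snd p}"
  \<comment> \<open>On the exceptional set the pair is replaced by 0, which lies in the cone, so
    that all values of \<open>f\<close> lie in \<open>C\<close>.\<close>
  define f where "f x = (if x \<in> N then (0::'z, 0::real) else (w' x, norm (w' x)))" for x
  have "((\<lambda>x. (w' x, 0::real) + (0, norm (w' x))) has_integral ((J, 0) + (0, j))) {s..t}"
  proof (rule has_integral_add)
    have "bounded_linear (\<lambda>x::'z. (x, 0::real))" by (intro bounded_linear_Pair bounded_linear_ident bounded_linear_zero)
    from has_integral_linear[OF w' this] show "((\<lambda>x. (w' x, 0::real)) has_integral (J, 0)) {s..t}" by (simp add: o_def)
    have "bounded_linear (\<lambda>x::real. (0::'z, x))" by (intro bounded_linear_Pair bounded_linear_ident bounded_linear_zero)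
    from has_integral_linear[OF n' this] show "((\<lambda>x. (0::'z, norm (w' x))) has_integral (0, j)) {s..t}" by (simp add: o_def)
  qed
  then have "((\<lambda>x. (w' x, norm (w' x))) has_integral (J, j)) (cbox s t)" unfolding cbox_interval by simp
  then have "(f has_integral (J, j)) (cbox s t)"
    by (rule has_integral_spike[OF N, rotated]) (simp add: f_def)
  then have "(J, j) \<in> C"
  proof (rule has_integral_in_closed_cone)
    show "f x \<in> C" if "x \<in> cbox s t" for x
      using en[of x] that by (auto simp: f_def C_def)
    have "continuous_on UNIV (\<lambda>p. S (fst p) + \<xi> (fst p))" "continuous_on UNIV (\<lambda>p :: 'z \<times> real. e * snd p)"
      by (intro continuous_intros continuous_on_compose2[OF continuous_on_S[of UNIV]]; simp)+
    then show "closed C" unfolding C_def by (rule closed_Collect_le)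
    show "0 \<in> C" by (simp add: C_def)
    show "p + q \<in> C" if "p \<in> C" "q \<in> C" for p q
      using that S_add[of "fst p" "fst q"] by (simp add: C_def blinfun.add_right algebra_simps)
    show "a *\<^sub>R p \<in> C" if "a \<ge> 0" "p \<in> C" for a p
      using that mult_left_mono[of "S (fst p) + \<xi> (fst p)" "e * snd p" a]
      by (simp add: C_def S_scale blinfun.scaleR_right algebra_simps)
  qed
  then show ?thesis by (simp add: C_def)
qed

text \<open>Both curves are approximate solutions without stability defect and with constant
  \<open>\<Omega>\<close>, once the errors of their energy balances are quadratic in a common clock.
  The comparison then bounds their distance by 0.\<close>

theorem W11_solution_unique:
  assumes T: "T > 0" and L: "0 \<le> L"
    and m: "\<And>s t. 0 \<le> s \<Longrightarrow> s \<le> t \<Longrightarrow> t \<le> T \<Longrightarrow> norm (m t - m s) \<le> L * (t - s)"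
    and reg: "\<And>r. r > 0 \<Longrightarrow> \<exists>b c. regular_on_ball r b c"
    and z: "solution_curve T m M k z" and M: "0 \<le> M" and k: "0 \<le> k"
    and w: "has_W11_derivative T w w'"
    and w_incl: "AE t in lebesgue_on {0..T}. incl (w' t) (\<Phi> (w t) - m t)"
    and init: "w 0 = z 0" and t: "t \<in> {0..T}"
  shows "w t = z t"
proof -
  define \<sigma>0 where "\<sigma>0 t = integral {0..t} (\<lambda>x. norm (w' x))" for t
  have w_int: "(w' has_integral (w t - w s)) {s..t}" if "0 \<le> s" "s \<le> t" "t \<le> T" for s t
    by (rule has_integral_subinterval_diff[where T=T]) (use w that in \<open>auto simp: has_W11_derivative_def\<close>)
  have nT: "(\<lambda>x. norm (w' x)) integrable_on {0..T}"
    using w by (intro integrable_on_lebesgue_on) (auto simp: has_W11_derivative_def bochner_integrable_def)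
  have n_int: "((\<lambda>x. norm (w' x)) has_integral (\<sigma>0 t - \<sigma>0 s)) {s..t}" if "0 \<le> s" "s \<le> t" "t \<le> T" for s t
  proof (rule has_integral_subinterval_diff[where T=T, OF _ that])
    fix p assume "p \<in> {0..T}"
    then have "(\<lambda>x. norm (w' x)) integrable_on {0..p}" by (intro integrable_on_subinterval[OF nT]) auto
    then show "((\<lambda>x. norm (w' x)) has_integral (\<sigma>0 p - \<sigma>0 0)) {0..p}"
      by (simp add: \<sigma>0_def integrable_integral)
  qed
  have \<sigma>0: "norm (w t - w s) \<le> \<sigma>0 t - \<sigma>0 s" if "0 \<le> s" "s \<le> t" "t \<le> T" for s t
  proof -
    have "norm (integral {s..t} w') \<le> integral {s..t} (\<lambda>x. norm (w' x))"
      using w_int[OF that] n_int[OF that] by (intro integral_norm_bound_integral) (auto simp: has_integral_integrable)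
    then show ?thesis using w_int[OF that] n_int[OF that] by (simp add: integral_unique)
  qed
  have \<sigma>0_cont: "continuous_on {0..T} \<sigma>0"
    unfolding \<sigma>0_def by (rule indefinite_integral_continuous_1[OF nT])
  have \<sigma>0_mono: "\<sigma>0 s \<le> \<sigma>0 t" if "0 \<le> s" "s \<le> t" "t \<le> T" for s t
    using \<sigma>0[OF that] norm_ge_zero[of "w t - w s"] by linarith
  have wb: "norm (w s) \<le> norm (w 0) + (\<sigma>0 T - \<sigma>0 0)" if "s \<in> {0..T}" for s
    using \<sigma>0[of 0 s] \<sigma>0_mono[of s T] norm_triangle_sub[of "w s" "w 0"] that by auto
  have zb: "norm (z s) \<le> norm (z 0) + M * T" if s: "s \<in> {0..T}" for s
  proof -
    have "norm (z s - z 0) \<le> M * (s - 0)"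
      by (rule solution_curveD(1)[OF z]) (use s in auto)
    also have "\<dots> \<le> M * T" using M s by (intro mult_left_mono) auto
    finally show ?thesis using norm_triangle_sub[of "z s" "z 0"] by simp
  qed
  \<comment> \<open>A ball containing both curves. The size of \<open>w\<close> is not known in
    advance, which is why regularity is assumed on every ball.\<close>
  define r where "r = norm (w 0) + norm (z 0) + (\<sigma>0 T - \<sigma>0 0) + M * T + 1"
  have nn: "0 \<le> \<sigma>0 T - \<sigma>0 0" "0 \<le> M * T" using \<sigma>0_mono[of 0 T] T M by auto
  have r: "r > 0" using nn by (auto simp: r_def intro: add_nonneg_pos)
  obtain b c where bc: "regular_on_ball r b c" using reg[OF r] by blast
  have b0: "b \<ge> 0" using bc by (simp add: regular_on_ball_def)
  have wr: "w s \<in> ball 0 r" and zr: "z s \<in> ball 0 r" if "s \<in> {0..T}" for s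
    unfolding mem_ball_0 r_def using wb[OF that] zb[OF that] nn norm_ge_zero[of "w 0"] norm_ge_zero[of "z 0"]
    by linarith+
  obtain N where N: "negligible N" "\<And>x. x \<in> {0..T} - N \<Longrightarrow> incl (w' x) (\<Phi> (w x) - m x)"
    using AE_lebesgue_on_negligible[OF w_incl] by blast
  have m_cont: "continuous_on {0..T} m" by (rule lipschitz_bound_continuous_on[OF L m])
  have w_cont: "continuous_on {0..T} w"
  proof -
    have "continuous_on {0..T} (\<lambda>t. integral {0..t} w')"
      by (rule indefinite_integral_continuous_1) (use w_int[of 0 T] T in \<open>auto simp: has_integral_integrable\<close>)
    then have "continuous_on {0..T} (\<lambda>t. w 0 + integral {0..t} w')" by (intro continuous_intros)
    moreover have "w 0 + integral {0..t} w' = w t" if "t \<in> {0..T}" for t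
      using w_int[of 0 t] that by (simp add: integral_unique)
    ultimately show ?thesis by (rule continuous_on_eq)
  qed
  \<comment> \<open>The inclusion gives stability off a negligible set, whose complement is dense;
    continuity extends it to every time.\<close>
  have w_stable: "(\<Phi> (w s) - m s) v + S v \<ge> 0" if s: "s \<in> {0..T}" for s v
  proof (rule continuous_ge_on_closure[where f="\<lambda>s. (\<Phi> (w s) - m s) v + S v" and S="{0..T} - N"])
    have "closure ({0..T} - N) \<subseteq> {0..T}" by (intro closure_minimal) auto
    moreover have "continuous_on {0..T} (\<lambda>s. (\<Phi> (w s) - m s) v + S v)"
      by (intro continuous_intros m_cont continuous_on_compose2[OF continuous_on_\<Phi>[of UNIV] w_cont]) auto
    ultimately show "continuous_on (closure ({0..T} - N)) (\<lambda>s. (\<Phi> (w s) - m s) v + S v)"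
      by (rule continuous_on_subset[rotated])
    show "s \<in> closure ({0..T} - N)" by (rule in_closure_diff_negligible[OF N(1) T s])
    show "0 \<le> (\<Phi> (w x) - m x) v + S v" if "x \<in> {0..T} - N" for x
      using N(2)[OF that] by (simp add: incl_iff)
  qed
  \<comment> \<open>Arc length of \<open>w\<close>, plus \<open>M * t\<close> for the motion of
    \<open>z\<close>, plus \<open>t\<close> for the change of the load; the increments of
    \<open>\<sigma>\<close> dominate all three.\<close>
  define \<sigma> where "\<sigma> t = \<sigma>0 t + (M + 1) * t" for t
  define K where "K = k + (b + L)"
  have K0: "0 \<le> K" using k b0 L by (simp add: K_def)
  have \<sigma>_ge: "\<sigma>0 t - \<sigma>0 s \<le> \<sigma> t - \<sigma> s" "M * (t - s) \<le> \<sigma> t - \<sigma> s" "t - s \<le> \<sigma> t - \<sigma> s"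
    if "0 \<le> s" "s \<le> t" "t \<le> T" for s t
  proof -
    have eq: "\<sigma> t - \<sigma> s = (\<sigma>0 t - \<sigma>0 s) + M * (t - s) + (t - s)" by (simp add: \<sigma>_def algebra_simps)
    have "0 \<le> M * (t - s)" using M that by simp
    then show "\<sigma>0 t - \<sigma>0 s \<le> \<sigma> t - \<sigma> s" "M * (t - s) \<le> \<sigma> t - \<sigma> s" "t - s \<le> \<sigma> t - \<sigma> s"
      unfolding eq using \<sigma>0_mono[OF that] that by auto
  qed
  have w_approx: "approx_solution T m \<sigma> K (\<lambda>_. 0) (\<lambda>_. 0) w"
    unfolding approx_solution_def
  proof (intro conjI allI impI; (elim conjE)?)
    fix s t assume "0 \<le> s" "s \<le> t" "t \<le> T"
    then show "norm (w t - w s) \<le> \<sigma> t - \<sigma> s" using \<sigma>0[of s t] \<sigma>_ge(1)[of s t] by linarith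
  next
    fix s v assume "0 \<le> s" "s < T"
    then show "- 0 * norm v \<le> (\<Phi> (w s) - m s) v + S v" using w_stable[of s v] by simp
  next
    fix s assume s: "0 \<le> s" "s < T"
    show "\<exists>\<delta>>0. \<forall>t. s < t \<and> t < s + \<delta> \<and> t \<le> T \<longrightarrow>
        S (w t - w s) + (\<Phi> (w s) - m s) (w t - w s) \<le> K * (\<sigma> t - \<sigma> s)\<^sup>2 + (0 - 0) \<and>
        0 * (\<sigma> t - \<sigma> s) \<le> 0 - (0::real)"
    proof (intro exI[of _ 1] conjI allI impI; (elim conjE)?)
      fix t assume "s < t" "t \<le> T"
      with s have t: "0 \<le> s" "s \<le> t" "t \<le> T" by auto
      \<comment> \<open>Bound for the change of the residual \<open>\<Phi> (w x) - m x\<close> as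
        \<open>x\<close> runs through \<open>[s,t]\<close>; it allows the residual to be frozen at
        time \<open>s\<close>.\<close>
      define e where "e = b * (\<sigma>0 t - \<sigma>0 s) + L * (t - s)"
      have "S (w t - w s) + (\<Phi> (w s) - m s) (w t - w s) \<le> e * (\<sigma>0 t - \<sigma>0 s)"
      proof (rule W11_energy_bound[OF w_int[OF t] n_int[OF t] N(1)])
        fix x assume x: "x \<in> {s..t} - N"
        then have xs: "0 \<le> s" "s \<le> x" "x \<le> T" "x \<le> t" using t by auto
        have "norm (\<Phi> (w s) - \<Phi> (w x)) \<le> b * norm (w s - w x)"
          by (rule \<Phi>_lipschitz[OF bc wr wr]) (use xs in auto)
        also have "\<dots> \<le> b * (\<sigma>0 t - \<sigma>0 s)"
          using \<sigma>0[OF xs(1-3)] \<sigma>0_mono[of x t] t xs b0 by (intro mult_left_mono) (auto simp: norm_minus_commute)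
        finally have "norm ((\<Phi> (w s) - m s) - (\<Phi> (w x) - m x)) \<le> e"
          using norm_triangle_ineq[of "\<Phi> (w s) - \<Phi> (w x)" "m x - m s"] m[OF xs(1-3)]
            mult_left_mono[of "x - s" "t - s" L] L xs by (simp add: e_def algebra_simps)
        from blinfun_le_norm(1)[OF this order_refl, of "w' x"]
        show "S (w' x) + (\<Phi> (w s) - m s) (w' x) \<le> e * norm (w' x)"
          using N(2)[of x] x t by (auto simp: incl_iff blinfun.diff_left)
      qed
      also have "\<dots> \<le> ((b + L) * (\<sigma> t - \<sigma> s)) * (\<sigma> t - \<sigma> s)"
      proof (rule mult_mono)
        show "e \<le> (b + L) * (\<sigma> t - \<sigma> s)"
          using mult_left_mono[OF \<sigma>_ge(1)[OF t] b0] mult_left_mono[OF \<sigma>_ge(3)[OF t] L]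
          by (simp add: e_def algebra_simps)
        show "0 \<le> (b + L) * (\<sigma> t - \<sigma> s)" using b0 L \<sigma>_ge(3)[OF t] t by simp
      qed (use \<sigma>_ge(1)[OF t] \<sigma>0_mono[OF t] in auto)
      also have "\<dots> = (b + L) * (\<sigma> t - \<sigma> s)\<^sup>2" by (simp add: power2_eq_square)
      also have "\<dots> \<le> K * (\<sigma> t - \<sigma> s)\<^sup>2"
        using k by (intro mult_right_mono) (auto simp: K_def)
      finally show "S (w t - w s) + (\<Phi> (w s) - m s) (w t - w s) \<le> K * (\<sigma> t - \<sigma> s)\<^sup>2 + (0 - 0)" by simp
    qed auto
  qed auto
  have z_approx: "approx_solution T m \<sigma> K (\<lambda>_. 0) (\<lambda>_. 0) z"
    unfolding approx_solution_def
  proof (intro conjI allI impI; (elim conjE)?)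
    fix s t assume st: "0 \<le> s" "s \<le> t" "t \<le> T"
    then have "norm (z t - z s) \<le> M * (t - s)" by (rule solution_curveD(1)[OF z])
    then show "norm (z t - z s) \<le> \<sigma> t - \<sigma> s" using \<sigma>_ge(2)[OF st] by linarith
  next
    fix s v assume "0 \<le> s" "s < T"
    then have "0 \<le> (\<Phi> (z s) - m s) v + S v" by (intro solution_curveD(2)[OF z]) auto
    then show "- 0 * norm v \<le> (\<Phi> (z s) - m s) v + S v" by simp
  next
    fix s assume s: "0 \<le> s" "s < T"
    show "\<exists>\<delta>>0. \<forall>t. s < t \<and> t < s + \<delta> \<and> t \<le> T \<longrightarrow>
        S (z t - z s) + (\<Phi> (z s) - m s) (z t - z s) \<le> K * (\<sigma> t - \<sigma> s)\<^sup>2 + (0 - 0) \<and>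
        0 * (\<sigma> t - \<sigma> s) \<le> 0 - (0::real)"
    proof (intro exI[of _ 1] conjI allI impI; (elim conjE)?)
      fix t assume "s < t" "t \<le> T"
      with s have t: "0 \<le> s" "s \<le> t" "t \<le> T" by auto
      have "S (z t - z s) + (\<Phi> (z s) - m s) (z t - z s) \<le> k * (t - s)\<^sup>2"
        by (rule solution_curveD(3)[OF z t])
      also have "\<dots> \<le> K * (\<sigma> t - \<sigma> s)\<^sup>2"
        using \<sigma>_ge(3)[OF t] t k b0 L by (intro mult_mono power_mono) (auto simp: K_def)
      finally show "S (z t - z s) + (\<Phi> (z s) - m s) (z t - z s) \<le> K * (\<sigma> t - \<sigma> s)\<^sup>2 + (0 - 0)" by simp
    qed auto
  qed auto
  have "continuous_on {0..T} \<sigma>" unfolding \<sigma>_def by (intro continuous_intros \<sigma>0_cont)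
  from approx_solution_comparison[OF less_imp_le[OF T] bc K0 this w_approx z_approx wr zr init t]
  have "\<kappa> * (norm (w t - z t))\<^sup>2 \<le> 0" by simp
  then have "(norm (w t - z t))\<^sup>2 \<le> 0" using \<kappa> by (simp add: mult_le_0_iff)
  then show ?thesis by simp
qed

end

section \<open>The local incremental minimization scheme\<close>

context convex_rate_independent
begin

text \<open>The old state \<open>x\<close> is an admissible test, and testing with it already gives
  the energy inequality and thereby the bound \<open>e / \<kappa> < \<tau>\<close>. The minimizer
  then lies strictly inside the constraint, short moves in every direction are admissible, and the
  unconstrained inclusion follows.\<close>

lemma constrained_step_incl:
  fixes \<iota> :: "'z \<Rightarrow>\<^sub>L 'v::real_normed_vector" and p p' :: "'z \<Rightarrow>\<^sub>L real"
  assumes \<iota>: "\<And>v. norm (\<iota> v) \<le> norm v"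
    and stable: "\<And>v. (\<Phi> x - p) v + S v \<ge> 0" and pp: "norm (p' - p) \<le> e" and e: "e / \<kappa> < \<tau>"
    and y: "norm (\<iota> (y - x)) \<le> \<tau>"
    and min: "\<And>v. norm (\<iota> (v - x)) \<le> \<tau> \<Longrightarrow> E y - p' y + S (y - x) \<le> E v - p' v + S (v - x)"
  shows "norm (y - x) \<le> e / \<kappa>" "incl (y - x) (\<Phi> y - p')"
proof -
  define C where "C = {v. norm (\<iota> (v - x)) \<le> \<tau>}"
  have conv: "convex C"
  proof (rule convexI)
    fix u v and a b :: real
    assume uv: "u \<in> C" "v \<in> C" and ab: "0 \<le> a" "0 \<le> b" "a + b = 1"
    have "a *\<^sub>R u + b *\<^sub>R v - x = a *\<^sub>R (u - x) + b *\<^sub>R (v - x)"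
      using ab(3) by (simp add: algebra_simps flip: scaleR_add_left)
    then have "norm (\<iota> (a *\<^sub>R u + b *\<^sub>R v - x)) \<le> a * norm (\<iota> (u - x)) + b * norm (\<iota> (v - x))"
      using ab norm_triangle_ineq[of "a *\<^sub>R \<iota> (u - x)" "b *\<^sub>R \<iota> (v - x)"]
      by (simp add: blinfun.add_right blinfun.scaleR_right)
    also have "\<dots> \<le> a * \<tau> + b * \<tau>" using uv ab by (intro add_mono mult_left_mono) (auto simp: C_def)
    also have "\<dots> = \<tau>" using ab by (simp flip: distrib_right)
    finally show "a *\<^sub>R u + b *\<^sub>R v \<in> C" by (simp add: C_def)
  qed
  have yC: "y \<in> C" using y by (simp add: C_def)
  have vi: "(\<Phi> y - p') (v - y) + S (v - x) - S (y - x) \<ge> 0" if "v \<in> C" for v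
    by (rule minimizer_variational_inequality[OF conv yC that]) (use min in \<open>auto simp: C_def\<close>)
  have "x \<in> C" using order_trans[OF norm_ge_zero y] by (simp add: C_def)
  from vi[OF this] have "S (y - x) + (\<Phi> y - p') (y - x) \<le> 0"
    by (simp add: blinfun.diff_right)
  from stable_increment_bound[OF stable this pp] show n: "norm (y - x) \<le> e / \<kappa>" .
  show "incl (y - x) (\<Phi> y - p')"
    unfolding incl_def
  proof
    fix v
    define w where "w = (v + x) - y"
    \<comment> \<open>A move so short that the Z norm, which dominates the V norm, does not exceed
      \<open>\<tau>\<close>; the \<open>+ 1\<close> keeps the denominator positive.\<close>
    define s where "s = min 1 ((\<tau> - norm (y - x)) / (norm w + 1))"
    have gap: "\<tau> - norm (y - x) > 0" using n e by simp
    have nw: "norm w + 1 > 0" by (simp add: add_nonneg_pos)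
    have s: "0 < s" "s \<le> 1" "s * (norm w + 1) \<le> \<tau> - norm (y - x)"
    proof -
      show "0 < s" "s \<le> 1" using gap nw by (auto simp: s_def)
      have "s \<le> (\<tau> - norm (y - x)) / (norm w + 1)" by (simp add: s_def)
      then show "s * (norm w + 1) \<le> \<tau> - norm (y - x)" using nw by (simp add: pos_le_divide_eq)
    qed
    have "norm (\<iota> (y + s *\<^sub>R w - x)) \<le> norm ((y - x) + s *\<^sub>R w)" using \<iota>[of "y + s *\<^sub>R w - x"] by (simp add: algebra_simps)
    also have "\<dots> \<le> norm (y - x) + s * norm w" using norm_triangle_ineq[of "y - x" "s *\<^sub>R w"] s by simp
    also have "\<dots> \<le> \<tau>" using s by (simp add: algebra_simps)
    finally have "y + s *\<^sub>R w \<in> C" by (simp add: C_def)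
    from vi[OF this] have "0 \<le> s * (\<Phi> y - p') w + S (y + s *\<^sub>R w - x) - S (y - x)"
      by (simp add: blinfun.scaleR_right)
    also have "S (y + s *\<^sub>R w - x) \<le> (1 - s) * S (y - x) + s * S v"
    proof -
      have "y + s *\<^sub>R w - x = (1 - s) *\<^sub>R (y - x) + s *\<^sub>R v" by (simp add: w_def algebra_simps)
      then show ?thesis using S_add[of "(1 - s) *\<^sub>R (y - x)" "s *\<^sub>R v"] s by (simp add: S_scale)
    qed
    finally have "0 \<le> s * ((\<Phi> y - p') w + S v - S (y - x))" by (simp add: algebra_simps)
    then have "0 \<le> (\<Phi> y - p') w + S v - S (y - x)" using s(1) by (simp add: zero_le_mult_iff)
    then show "S (y - x) - (\<Phi> y - p') (v - (y - x)) \<le> S v" by (simp add: w_def algebra_simps)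
  qed
qed

text \<open>
  The increments are too short to touch the constraint, and the shift \<open>k \<mapsto> zs (k + 1)\<close> turns the
  scheme, which evaluates the energy at the old time, into the implicit Euler scheme.
\<close>

lemma local_scheme_euler:
  fixes \<iota> :: "'z \<Rightarrow>\<^sub>L 'v::real_normed_vector"
  assumes T: "T > 0" and \<tau>: "\<tau> > 0" and L: "0 \<le> L" "L < \<kappa>"
    and m: "\<And>s t. 0 \<le> s \<Longrightarrow> s \<le> t \<Longrightarrow> t \<le> T \<Longrightarrow> norm (m t - m s) \<le> L * (t - s)"
    and \<iota>: "\<And>v. norm (\<iota> v) \<le> norm v"
    and stable: "\<And>v. (\<Phi> (zs 0) - m 0) v + S v \<ge> 0" and ts0: "ts 0 = 0"
    and adm: "\<And>k. norm (\<iota> (zs (Suc k) - zs k)) \<le> \<tau>"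
    and min: "\<And>k v. norm (\<iota> (v - zs k)) \<le> \<tau> \<Longrightarrow>
      E (zs (Suc k)) - m (ts k) (zs (Suc k)) + S (zs (Suc k) - zs k) \<le> E v - m (ts k) v + S (v - zs k)"
    and ts: "\<And>k. ts (Suc k) = min (ts k + \<tau> - norm (\<iota> (zs (Suc k) - zs k))) T"
  shows "euler_scheme T m (num_steps T ts) ts (\<lambda>k. zs (Suc k))" "zs (Suc 0) = zs 0"
    and "\<And>k. norm (zs (Suc k) - zs k) \<le> L / \<kappa> * \<tau>" "\<And>k. ts (Suc k) - ts k \<le> \<tau>"
proof -
  have q: "L / \<kappa> < 1" "0 \<le> L / \<kappa>" using L \<kappa> by auto
  have \<tau>': "L / \<kappa> * \<tau> < \<tau>" using mult_strict_right_mono[OF q(1) \<tau>] by simp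
  \<comment> \<open>The load at \<open>ts 0 = 0\<close> is the one for which \<open>zs 0\<close> is
    stable. The load change is therefore 0 and the first iterate does not move, so the shifted
    scheme starts in the same state.\<close>
  have first: "norm (zs (Suc 0) - zs 0) \<le> 0 / \<kappa>" "incl (zs (Suc 0) - zs 0) (\<Phi> (zs (Suc 0)) - m (ts 0))"
    using constrained_step_incl[of \<iota> "zs 0" "m 0" "m (ts 0)" 0 \<tau> "zs (Suc 0)"] \<iota> stable ts0 \<tau> adm[of 0] min[of _ 0]
    by auto
  then show z1: "zs (Suc 0) = zs 0" by simp
  have main: "incl (zs (Suc k) - zs k) (\<Phi> (zs (Suc k)) - m (ts k)) \<and> norm (zs (Suc k) - zs k) \<le> L / \<kappa> * \<tau> \<and>
      0 \<le> ts k \<and> ts k \<le> T" for k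
  proof (induction k)
    case 0
    have "0 \<le> L / \<kappa> * \<tau>" using mult_nonneg_nonneg[OF q(2) less_imp_le[OF \<tau>]] .
    then show ?case using first ts0 T z1 by simp
  next
    case (Suc k)
    have nV: "norm (\<iota> (zs (Suc k) - zs k)) \<le> L / \<kappa> * \<tau>" using order_trans[OF \<iota>] Suc by blast
    have t: "0 \<le> ts k" "ts k \<le> ts (Suc k)" "ts (Suc k) \<le> T" "ts (Suc k) - ts k \<le> \<tau>"
    proof -
      define n where "n = norm (\<iota> (zs (Suc k) - zs k))"
      have "0 \<le> n" "n \<le> \<tau>" "ts (Suc k) = min (ts k + \<tau> - n) T"
        using nV \<tau>' ts[of k] by (auto simp: n_def)
      then show "0 \<le> ts k" "ts k \<le> ts (Suc k)" "ts (Suc k) \<le> T" "ts (Suc k) - ts k \<le> \<tau>"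
        using Suc.IH by auto
    qed
    have "norm (m (ts (Suc k)) - m (ts k)) \<le> L * (ts (Suc k) - ts k)" by (rule m[OF t(1-3)])
    also have "\<dots> \<le> L * \<tau>" using L t by (intro mult_left_mono) auto
    finally have dm: "norm (m (ts (Suc k)) - m (ts k)) \<le> L * \<tau>" .
    \<comment> \<open>Stability of the new iterate with respect to the load just used, at time
      \<open>ts k\<close>; the next step uses the load at \<open>ts (Suc k)\<close>, which differs
      by at most \<open>L * \<tau>\<close>.\<close>
    have st: "(\<Phi> (zs (Suc k)) - m (ts k)) v + S v \<ge> 0" for v using Suc by (simp add: incl_iff)
    have "L * \<tau> / \<kappa> < \<tau>" using \<tau>' by simp
    from constrained_step_incl[OF \<iota> st dm this adm min]
    have "norm (zs (Suc (Suc k)) - zs (Suc k)) \<le> L * \<tau> / \<kappa>"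
      "incl (zs (Suc (Suc k)) - zs (Suc k)) (\<Phi> (zs (Suc (Suc k))) - m (ts (Suc k)))" by blast+
    then show ?case using t by simp
  qed
  show nz: "norm (zs (Suc k) - zs k) \<le> L / \<kappa> * \<tau>" for k using main[of k] by blast
  show "ts (Suc k) - ts k \<le> \<tau>" for k
  proof -
    define n where "n = norm (\<iota> (zs (Suc k) - zs k))"
    have "0 \<le> n" "ts (Suc k) = min (ts k + \<tau> - n) T" using ts[of k] by (auto simp: n_def)
    then show ?thesis by auto
  qed
  \<comment> \<open>Least advance of time in a step that does not reach \<open>T\<close>; it makes
    the number of steps finite.\<close>
  define \<delta> where "\<delta> = \<tau> - L / \<kappa> * \<tau>"
  have \<delta>: "\<delta> > 0" using \<tau>' by (simp add: \<delta>_def)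
  have step: "ts (Suc k) \<ge> min (ts k + \<delta>) T" for k
    using ts[of k] order_trans[OF \<iota> nz[of k]] by (auto simp: \<delta>_def)
  have low: "ts k \<ge> min (real k * \<delta>) T" for k
  proof (induction k)
    case 0
    then show ?case using ts0 by simp
  next
    case (Suc k)
    then show ?case using step[of k] \<delta> by (auto simp: algebra_simps min_def split: if_splits)
  qed
  obtain n where "T / \<delta> < real n" using reals_Archimedean2 by blast
  then have "T \<le> real n * \<delta>" using \<delta> by (simp add: field_simps)
  then have "ts n = T" using low[of n] main[of n] by simp
  then have N: "ts (num_steps T ts) = T" unfolding num_steps_def by (rule LeastI)
  have "ts k < ts (Suc k)" if "k < num_steps T ts" for k
  proof -
    have "ts k \<noteq> T" using that unfolding num_steps_def by (rule not_less_Least)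
    then have "ts k < T" using main[of k] by simp
    then show ?thesis using step[of k] \<delta> by (auto simp: min_def split: if_splits)
  qed
  then show "euler_scheme T m (num_steps T ts) ts (\<lambda>k. zs (Suc k))"
    using N ts0 main z1 stable by (simp add: euler_scheme_def grid_def)
qed

text \<open>Both curves are affine on the same cells, and the index shift displaces each node value
  by one increment, of norm at most \<open>M * \<tau>\<close>.\<close>

lemma retransformed_near_interpolant:
  assumes e: "euler_scheme T m (num_steps T ts) ts (\<lambda>k. zs (Suc k))" and T: "T > 0" and M: "0 \<le> M"
    and inc: "\<And>k. norm (zs (Suc k) - zs k) \<le> M * \<tau>" and s: "s \<in> {0..T}"
  shows "norm (retransformed T zs ts s - affine_interpolant (num_steps T ts) ts (\<lambda>k. zs (Suc k)) s) \<le> 2 * (M * \<tau>)"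
proof -
  define N where "N = num_steps T ts"
  define y where "y k = zs (Suc k)" for k
  have g: "grid N ts" and t0: "ts 0 = 0" and tN: "ts N = T" using e by (auto simp: euler_scheme_def N_def)
  have N0: "N > 0" using t0 tN T by (cases N) auto
  have M\<tau>: "0 \<le> M * \<tau>" using order_trans[OF norm_ge_zero inc[of 0]] .
  show ?thesis
  proof (cases "s = T")
    case True
    obtain n where n: "N = Suc n" using N0 by (cases N) auto
    have lt: "ts n < ts (Suc n)" using g by (simp add: grid_def n)
    have "affine_interpolant N ts y T = y n + (ts (Suc n) - ts n) *\<^sub>R ((1 / (ts (Suc n) - ts n)) *\<^sub>R (y (Suc n) - y n))"
      using affine_interpolant_cell[OF g, of n T y] lt tN n by simp
    also have "\<dots> = y N" using lt n by simp
    \<comment> \<open>The interpolant ends in iterate \<open>Suc N\<close>, one step after the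
      arrival at \<open>T\<close>, while the retransformed curve ends in
      \<open>zs N\<close>.\<close>
    finally have "affine_interpolant N ts y T = zs (Suc N)" by (simp add: y_def)
    then have "retransformed T zs ts s - affine_interpolant N ts y s = - (zs (Suc N) - zs N)"
      using True by (simp add: retransformed_def N_def)
    then have "norm (retransformed T zs ts s - affine_interpolant N ts y s) \<le> M * \<tau>"
      using inc[of N] by (simp add: norm_minus_commute)
    then show ?thesis using M\<tau> unfolding N_def y_def by linarith
  next
    case False
    then have "0 \<le> s" "s < T" using s by auto
    note q = cell_bounds[of ts s N, unfolded t0 tN, OF this]
    define q where "q = cell ts s"
    have q: "q < N" "ts q \<le> s" "s < ts (Suc q)" using q by (auto simp: q_def)
    have "(THE k. 1 \<le> k \<and> k \<le> N \<and> ts (k - 1) \<le> s \<and> s < ts k) = Suc q"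
    proof (rule the_equality)
      show "1 \<le> Suc q \<and> Suc q \<le> N \<and> ts (Suc q - 1) \<le> s \<and> s < ts (Suc q)" using q by simp
      fix k assume k: "1 \<le> k \<and> k \<le> N \<and> ts (k - 1) \<le> s \<and> s < ts k"
      have "\<not> k \<le> q" using grid_mono[OF g, of k q] k q by auto
      moreover have "\<not> Suc q \<le> k - 1"
      proof
        assume "Suc q \<le> k - 1"
        moreover have "k - 1 \<le> N" using k by linarith
        ultimately have "ts (Suc q) \<le> ts (k - 1)" by (rule grid_mono[OF g])
        then show False using k q by simp
      qed
      ultimately show "k = Suc q" using k by simp
    qed
    then have re: "retransformed T zs ts s = zs q + ((s - ts q) / (ts (Suc q) - ts q)) *\<^sub>R (zs (Suc q) - zs q)"
      using False by (simp add: retransformed_def N_def)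
    define \<theta> where "\<theta> = (s - ts q) / (ts (Suc q) - ts q)"
    have \<theta>: "0 \<le> \<theta>" "\<theta> \<le> 1" using q by (auto simp: \<theta>_def)
    have ai: "affine_interpolant N ts y s = y q + \<theta> *\<^sub>R (y (Suc q) - y q)"
      using affine_interpolant_cell[OF g q(1,2), of y] q by (simp add: \<theta>_def)
    have "retransformed T zs ts s - affine_interpolant N ts y s =
        - ((1 - \<theta>) *\<^sub>R (zs (Suc q) - zs q)) - \<theta> *\<^sub>R (zs (Suc (Suc q)) - zs (Suc q))"
      unfolding re ai \<theta>_def[symmetric] y_def by (simp add: algebra_simps)
    also have "norm \<dots> \<le> (1 - \<theta>) * norm (zs (Suc q) - zs q) + \<theta> * norm (zs (Suc (Suc q)) - zs (Suc q))"
      using norm_triangle_ineq4[of "- ((1 - \<theta>) *\<^sub>R (zs (Suc q) - zs q))" "\<theta> *\<^sub>R (zs (Suc (Suc q)) - zs (Suc q))"] \<theta>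
      by simp
    also have "\<dots> \<le> 1 * (M * \<tau>) + 1 * (M * \<tau>)"
      using \<theta> inc[of q] inc[of "Suc q"] M\<tau> by (intro add_mono mult_mono) auto
    finally show ?thesis unfolding N_def y_def by simp
  qed
qed

end

text \<open>Placed outside the locale because the existence of the derivative relies on an inner
  product, while the locale only assumes a Banach space.\<close>

lemma solution_curve_differentiable:
  fixes z :: "real \<Rightarrow> 'z::{real_inner, banach}"
  assumes "convex_rate_independent E \<Phi> B S \<kappa> \<rho>" and T: "T > 0"
    and z: "convex_rate_independent.solution_curve \<Phi> S T m M k z" and M: "M \<ge> 0"
    and m: "continuous_on {0..T} m"
  obtains z' where "has_W11_derivative T z z'"
    and "AE t in lebesgue_on {0..T}. convex_rate_independent.incl S (z' t) (\<Phi> (z t) - m t)"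
proof -
  interpret convex_rate_independent E \<Phi> B S \<kappa> \<rho> by fact
  obtain z' r where z': "has_W11_derivative T z z'" and r: "strict_mono r"
    and lim: "AE x in lebesgue_on {0..T}. (\<lambda>j. dyadic_step T (r j) (dyadic_slope T z (r j)) x) \<longlonglongrightarrow> z' x"
    using lipschitz_curve_has_W11_derivative[OF T solution_curveD(1)[OF z]] by blast
  \<comment> \<open>At \<open>x = T\<close> the dyadic step functions vanish by convention, so the
    end point is moved into the null set.\<close>
  have "AE x in lebesgue_on {0..T}. x \<noteq> T"
  proof -
    have "{T} \<in> null_sets (lebesgue_on {0..T})"
      using T by (subst null_sets_restrict_space) auto
    from AE_not_in[OF this] show ?thesis by simp
  qed
  then have "AE x in lebesgue_on {0..T}. incl (z' x) (\<Phi> (z x) - m x)"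
    using lim AE_space
  proof eventually_elim
    case (elim x)
    then have "x \<in> {0..<T}" by (auto simp: space_restrict_space)
    then show ?case using solution_curve_incl_dyadic_limit[OF T z M m _ r elim(2)] by blast
  qed
  with z' show thesis by (rule that)
qed

section \<open>From the concrete energy to the abstract setting\<close>

lemma Deriv_eqI:
  assumes "(f has_derivative blinfun_apply D) (at x)"
  shows "Deriv f x = D"
  unfolding Deriv_def frechet_derivative_at[OF assms, symmetric] by (rule blinfun_apply_inverse)

lemma C1_has_derivative:
  assumes "C1 f"
  shows "(f has_derivative blinfun_apply (Deriv f x)) (at x)"
proof -
  have "(f has_derivative frechet_derivative f (at x)) (at x)"
    using assms by (simp add: C1_def frechet_derivative_works)
  moreover from this have "blinfun_apply (Deriv f x) = frechet_derivative f (at x)"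
    unfolding Deriv_def by (intro bounded_linear_Blinfun_apply has_derivative_bounded_linear)
  ultimately show ?thesis by simp
qed

text \<open>Polarization: for unit vectors, \<open>4 * H u v\<close> is a difference of two values
  of the quadratic form at vectors of norm at most 2. Scaling gives the general case.\<close>

lemma norm_symmetric_blinfun_le:
  fixes H :: "'a::real_normed_vector \<Rightarrow>\<^sub>L 'a \<Rightarrow>\<^sub>L real"
  assumes sym: "\<And>u v. H u v = H v u" and q: "\<And>v. \<bar>H v v\<bar> \<le> c * (norm v)\<^sup>2" and c: "0 \<le> c"
  shows "norm H \<le> 2 * c"
proof (rule norm_blinfun_bound)
  have unit: "\<bar>H u v\<bar> \<le> 2 * c" if "norm u = 1" "norm v = 1" for u v
  proof -
    have "4 * H u v = H (u + v) (u + v) - H (u - v) (u - v)"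
      using sym[of v u] by (simp add: blinfun.bilinear_simps)
    moreover have "\<bar>H (u + v) (u + v)\<bar> \<le> c * 2\<^sup>2"
      using norm_triangle_ineq[of u v] that c by (intro order_trans[OF q] mult_left_mono power_mono) auto
    moreover have "\<bar>H (u - v) (u - v)\<bar> \<le> c * 2\<^sup>2"
      using norm_triangle_ineq4[of u v] that c by (intro order_trans[OF q] mult_left_mono power_mono) auto
    ultimately show ?thesis by (simp add: abs_le_iff)
  qed
  show "0 \<le> 2 * c" using c by simp
  fix u
  show "norm (H u) \<le> 2 * c * norm u"
  proof (rule norm_blinfun_bound)
    fix v
    show "norm (H u v) \<le> 2 * c * norm u * norm v"
    proof (cases "u = 0 \<or> v = 0")
      case False
      then have "\<bar>H ((1 / norm u) *\<^sub>R u) ((1 / norm v) *\<^sub>R v)\<bar> \<le> 2 * c" by (intro unit) auto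
      then show ?thesis using False
        by (simp add: blinfun.scaleR_left blinfun.scaleR_right abs_mult field_simps)
    qed auto
  qed (use c in simp)
qed

lemma norm_blinfun_compose_contraction:
  fixes \<iota> :: "'z::real_normed_vector \<Rightarrow>\<^sub>L 'v::real_normed_vector" and \<xi> :: "'v \<Rightarrow>\<^sub>L real"
  assumes "\<And>v. norm (\<iota> v) \<le> norm v"
  shows "norm (\<xi> o\<^sub>L \<iota>) \<le> norm \<xi>"
proof -
  have "norm \<iota> \<le> 1" by (rule norm_blinfun_bound) (use assms in auto)
  then have "norm \<xi> * norm \<iota> \<le> norm \<xi> * 1" by (intro mult_left_mono) auto
  then show ?thesis using norm_blinfun_compose[of \<xi> \<iota>] by simp
qed

text \<open>Turns the gap \<open>\<delta>\<close> between the Lipschitz seminorm and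
  \<open>\<kappa>\<close> into an actual Lipschitz constant below \<open>\<kappa>\<close>.\<close>

lemma lip_seminorm_less:
  assumes "\<exists>L. L-lipschitz_on X f" "lip_seminorm X f < c"
  obtains L where "L-lipschitz_on X f" "L < c"
  using cInf_lessD[of "{L. L-lipschitz_on X f}" c] assms by (auto simp: lip_seminorm_def)

lemma dissipation_potential_simps:
  assumes "dissipation_potential j R"
  shows "R v \<ge> 0" "R (u + v) \<le> R u + R v" "c \<ge> 0 \<Longrightarrow> R (c *\<^sub>R v) = c * R v"
    and "\<exists>\<rho>>0. \<forall>v. R v \<le> \<rho> * norm v"
proof -
  have nn: "R v \<ge> 0" and cv: "convex_on UNIV R" and sc: "c > 0 \<Longrightarrow> R (c *\<^sub>R v) = c * R v" for v c
    using assms unfolding dissipation_potential_def by blast+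
  show "R v \<ge> 0" by (rule nn)
  show "R (u + v) \<le> R u + R v"
    using convex_onD[OF cv, of "1/2" "2 *\<^sub>R u" "2 *\<^sub>R v"] by (simp add: sc)
  have "R 0 = 0" using sc[of 2 0] by simp
  then show "c \<ge> 0 \<Longrightarrow> R (c *\<^sub>R v) = c * R v" using sc[of c v] by (cases "c = 0") auto
  show "\<exists>\<rho>>0. \<forall>v. R v \<le> \<rho> * norm v"
    using assms unfolding dissipation_potential_def by blast
qed

context
  fixes \<iota> :: "'z::{real_inner, banach} \<Rightarrow>\<^sub>L 'v::{real_inner, banach}"
    and T \<alpha> \<kappa> :: real and l :: "real \<Rightarrow> ('v \<Rightarrow>\<^sub>L real)" and F :: "'z \<Rightarrow> real"
    and A :: "'z \<Rightarrow>\<^sub>L 'z \<Rightarrow>\<^sub>L real"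
  assumes F: "C2 F" and A: "elliptic_operator \<alpha> A"
begin

lemma quadratic_has_derivative:
  "((\<lambda>z. 1 / 2 * A z z + F z) has_derivative blinfun_apply (A z + Deriv F z)) (at z)"
proof -
  have "(F has_derivative blinfun_apply (Deriv F z)) (at z)"
    using F C1_has_derivative by (auto simp: C2_def)
  moreover have "A u v = A v u" for u v using A by (simp add: elliptic_operator_def)
  ultimately show ?thesis
    by (auto intro!: derivative_eq_intros simp: blinfun.add_left fun_eq_iff)
qed

lemma quadratic_has_second_derivative:
  "((\<lambda>z. A z + Deriv F z) has_derivative blinfun_apply (A + Deriv (Deriv F) z)) (at z)"
proof -
  have "(Deriv F has_derivative blinfun_apply (Deriv (Deriv F) z)) (at z)"
    using F C1_has_derivative by (auto simp: C2_def)
  then show ?thesis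
    by (auto intro!: derivative_eq_intros simp: blinfun.add_left fun_eq_iff)
qed

lemma Deriv_energy: "Deriv (energy \<iota> A F l t) z = A z + Deriv F z - (l t o\<^sub>L \<iota>)"
proof (rule Deriv_eqI)
  show "(energy \<iota> A F l t has_derivative blinfun_apply (A z + Deriv F z - (l t o\<^sub>L \<iota>))) (at z)"
    unfolding energy_def
    by (rule has_derivative_eq_rhs, rule has_derivative_diff[OF quadratic_has_derivative], (rule derivative_intros)+)
       (auto simp: blinfun.diff_left fun_eq_iff)
qed

lemma Deriv_Deriv_energy: "Deriv (Deriv (energy \<iota> A F l t)) z = A + Deriv (Deriv F) z"
proof (rule Deriv_eqI)
  have "(\<lambda>z. A z + Deriv F z - (l t o\<^sub>L \<iota>)) = Deriv (energy \<iota> A F l t)" by (simp add: fun_eq_iff Deriv_energy)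
  moreover have "((\<lambda>z. A z + Deriv F z - (l t o\<^sub>L \<iota>)) has_derivative blinfun_apply (A + Deriv (Deriv F) z)) (at z)"
    by (rule has_derivative_eq_rhs, rule has_derivative_diff[OF quadratic_has_second_derivative has_derivative_const]) simp
  ultimately show "(Deriv (energy \<iota> A F l t) has_derivative blinfun_apply (A + Deriv (Deriv F) z)) (at z)" by simp
qed

lemma energy_convex_rate_independent:
  assumes T: "T > 0" and \<kappa>: "\<kappa> > 0" and \<iota>: "\<And>z. norm (\<iota> z) \<le> norm z"
    and convex: "uniformly_convex_energy T \<kappa> (energy \<iota> A F l)" and R: "dissipation_potential j R"
  obtains \<rho> where "convex_rate_independent (\<lambda>z. 1 / 2 * A z z + F z) (\<lambda>z. A z + Deriv F z)
    (\<lambda>z. A + Deriv (Deriv F) z) (\<lambda>v. R (\<iota> v)) \<kappa> \<rho>"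
proof -
  obtain \<rho> where \<rho>: "\<rho> > 0" "\<And>v. R v \<le> \<rho> * norm v" using dissipation_potential_simps(4)[OF R] by blast
  have "convex_rate_independent (\<lambda>z. 1 / 2 * A z z + F z) (\<lambda>z. A z + Deriv F z)
    (\<lambda>z. A + Deriv (Deriv F) z) (\<lambda>v. R (\<iota> v)) \<kappa> \<rho>"
  proof
    show "\<kappa> * (norm v)\<^sup>2 \<le> (A + Deriv (Deriv F) z) v v" for z v
      using convex T unfolding uniformly_convex_energy_def Deriv_Deriv_energy by auto
    show "R (\<iota> v) \<le> \<rho> * norm v" for v
      using \<rho>(2)[of "\<iota> v"] mult_left_mono[OF \<iota>[of v] less_imp_le[OF \<rho>(1)]] by linarith
  qed (use \<kappa> quadratic_has_derivative quadratic_has_second_derivative dissipation_potential_simps[OF R]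
      in \<open>simp_all add: blinfun.add_right blinfun.scaleR_right\<close>)
  then show thesis by (rule that)
qed

lemma Deriv_Deriv_symmetric: "Deriv (Deriv F) z u v = Deriv (Deriv F) z v u"
proof (rule symmetric_second_derivative[of F "Deriv F" _ z])
  show "(F has_derivative blinfun_apply (Deriv F x)) (at x)" for x
    using F C1_has_derivative by (auto simp: C2_def)
  show "(Deriv F has_derivative blinfun_apply (Deriv (Deriv F) z)) (at z)"
    using F C1_has_derivative by (auto simp: C2_def)
qed

lemma second_derivative_quadratic_bound:
  assumes "C21_loc (energy \<iota> A F l t)" "r > 0"
  obtains C where "C \<ge> 0" "\<And>z1 z2 v. z1 \<in> ball 0 r \<Longrightarrow> z2 \<in> ball 0 r \<Longrightarrow>
    (Deriv (Deriv F) z1 - Deriv (Deriv F) z2) v v \<le> C * norm (z1 - z2) * (norm v)\<^sup>2"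
  using assms unfolding C21_loc_def Deriv_Deriv_energy by auto

text \<open>The bound in \<open>C21_loc\<close> is one-sided and concerns the quadratic form only.
  Exchanging \<open>z1\<close> and \<open>z2\<close> makes it two-sided, and symmetry of the second
  derivative turns it into an operator norm bound at the price of a factor 2.\<close>

lemma second_derivative_bounds:
  assumes C: "C \<ge> 0" and q: "\<And>z1 z2 v. z1 \<in> ball 0 r \<Longrightarrow> z2 \<in> ball 0 r \<Longrightarrow>
    (Deriv (Deriv F) z1 - Deriv (Deriv F) z2) v v \<le> C * norm (z1 - z2) * (norm v)\<^sup>2"
    and z: "z1 \<in> ball 0 r" "z2 \<in> ball 0 r"
  shows "norm ((A + Deriv (Deriv F) z1) - (A + Deriv (Deriv F) z2)) \<le> 2 * C * norm (z1 - z2)"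
    and "norm (A + Deriv (Deriv F) z1) \<le> norm A + norm (Deriv (Deriv F) 0) + 2 * C * r"
proof -
  have diff: "norm (Deriv (Deriv F) z1 - Deriv (Deriv F) z2) \<le> 2 * C * norm (z1 - z2)"
    if z: "z1 \<in> ball 0 r" "z2 \<in> ball 0 r" for z1 z2
  proof -
    have "norm (Deriv (Deriv F) z1 - Deriv (Deriv F) z2) \<le> 2 * (C * norm (z1 - z2))"
    proof (rule norm_symmetric_blinfun_le)
      show "(Deriv (Deriv F) z1 - Deriv (Deriv F) z2) u v = (Deriv (Deriv F) z1 - Deriv (Deriv F) z2) v u" for u v
        using Deriv_Deriv_symmetric[of z1 u v] Deriv_Deriv_symmetric[of z2 u v] by (simp add: blinfun.diff_left)
      show "\<bar>(Deriv (Deriv F) z1 - Deriv (Deriv F) z2) v v\<bar> \<le> C * norm (z1 - z2) * (norm v)\<^sup>2" for v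
        using q[OF z, of v] q[OF z(2,1), of v] by (simp add: blinfun.diff_left norm_minus_commute abs_le_iff)
    qed (use C in simp)
    then show ?thesis by simp
  qed
  show "norm ((A + Deriv (Deriv F) z1) - (A + Deriv (Deriv F) z2)) \<le> 2 * C * norm (z1 - z2)"
    using diff[OF z] by simp
  have r: "0 < r" using z(1) by (auto intro: le_less_trans[OF norm_ge_zero])
  have "norm (Deriv (Deriv F) z1 - Deriv (Deriv F) 0) \<le> 2 * C * norm (z1 - 0)" by (rule diff) (use z r in auto)
  also have "\<dots> \<le> 2 * C * r" using z C by (intro mult_left_mono) auto
  finally show "norm (A + Deriv (Deriv F) z1) \<le> norm A + norm (Deriv (Deriv F) 0) + 2 * C * r"
    using norm_triangle_ineq[of A "Deriv (Deriv F) z1"]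
      norm_triangle_sub[of "Deriv (Deriv F) z1" "Deriv (Deriv F) 0"] by linarith
qed

end

text \<open>The quantifier order encodes what the constant may depend on: \<open>K\<close> is chosen
  before \<open>j\<close>, \<open>A\<close> and \<open>R\<close>, and \<open>A\<close> is then
  restricted to operators of norm \<open>a\<close>.\<close>

theorem theorem3p11:
  fixes \<iota> :: "'z::{real_inner, banach} \<Rightarrow>\<^sub>L 'v::{real_inner, banach}"
    and T \<alpha> \<kappa> a :: real
    and l :: "real \<Rightarrow> ('v \<Rightarrow>\<^sub>L real)"
    and F :: "'z \<Rightarrow> real"
    and z0 :: 'z
  assumes "T > 0" and "\<alpha> > 0" and "\<kappa> > 0"
    and "dense_compact_embedding \<iota>" and "\<forall>z. norm (\<iota> z) \<le> norm z"
    and "admissible_nonlinearity \<iota> F"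
    and "\<exists>L. L-lipschitz_on {0..T} l"
    and "\<exists>\<delta>. 0 < \<delta> \<and> \<delta> \<le> \<kappa> \<and> lip_seminorm {0..T} l \<le> \<kappa> - \<delta>"
    and "\<exists>l'. has_W1inf_derivative T l l' \<and> bounded_variation_on {0..T} l'"
  shows "\<exists>K>0. \<forall>(j :: 'v \<Rightarrow>\<^sub>L 'x::banach) A R.
           continuous_embedding j \<and> dissipation_potential j R \<and>
           elliptic_operator \<alpha> A \<and> norm A = a \<and>
           uniformly_convex_energy T \<kappa> (energy \<iota> A F l) \<and>
           (\<forall>t\<in>{0..T}. C21_loc (energy \<iota> A F l t)) \<and>
           subdiff_inclusion \<iota> R 0 (Deriv (energy \<iota> A F l 0) z0)
           \<longrightarrow>
           (\<exists>z. differential_solution T \<iota> (energy \<iota> A F l) R z0 z \<and>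
                (\<forall>w. differential_solution T \<iota> (energy \<iota> A F l) R z0 w \<longrightarrow> (\<forall>t\<in>{0..T}. w t = z t)) \<and>
                (\<forall>zs ts. (\<forall>\<tau>>0. local_incremental_scheme T \<iota> (energy \<iota> A F l) R z0 \<tau> (zs \<tau>) (ts \<tau>)) \<longrightarrow>
                   uniform_limit {0..T} (\<lambda>\<tau>. retransformed T (zs \<tau>) (ts \<tau>)) z (at_right 0)) \<and>
                (\<forall>\<tau>>0. \<forall>zs ts. local_incremental_scheme T \<iota> (energy \<iota> A F l) R z0 \<tau> zs ts \<longrightarrow>
                   (\<forall>t\<in>{0..T}. norm (retransformed T zs ts t - z t) \<le> K * \<tau>)))"
proof -
  have F: "C2 F" using assms(6) by (simp add: admissible_nonlinearity_def)
  have \<iota>: "norm (\<iota> v) \<le> norm v" for v using assms(5) by blast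
  have T: "T > 0" and \<kappa>: "\<kappa> > 0" by fact+
  have "lip_seminorm {0..T} l < \<kappa>" using assms(8) by auto
  then obtain L where Lip: "L-lipschitz_on {0..T} l" and L1: "L < \<kappa>"
    using lip_seminorm_less[OF assms(7)] by blast
  have L: "0 \<le> L" using Lip by (rule lipschitz_on_nonneg)
  obtain l' where l': "has_W11_derivative T l l'" and bv: "bounded_variation_on {0..T} l'"
    using assms(9) by (auto simp: has_W1inf_derivative_def)
  obtain V where V: "\<And>s t. 0 \<le> s \<Longrightarrow> s \<le> t \<Longrightarrow> t \<le> T \<Longrightarrow> norm (l' t - l' s) \<le> V t - V s"
    using bounded_variation_monotone_bound[OF bv] by blast
  define m where "m t = l t o\<^sub>L \<iota>" for t
  define m' where "m' t = l' t o\<^sub>L \<iota>" for t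
  have m: "norm (m t - m s) \<le> L * (t - s)" if "0 \<le> s" "s \<le> t" "t \<le> T" for s t
  proof -
    have "m t - m s = (l t - l s) o\<^sub>L \<iota>" by (rule blinfun_eqI) (simp add: m_def blinfun.diff_left)
    then have "norm (m t - m s) \<le> norm (l t - l s)" using norm_blinfun_compose_contraction[OF \<iota>] by simp
    also have "\<dots> \<le> L * (t - s)" using lipschitz_onD[OF Lip, of t s] that by (simp add: dist_norm)
    finally show ?thesis .
  qed
  have m': "norm (m t - m s - (t - s) *\<^sub>R m' c) \<le> (t - s) * (V t - V s)"
    if "0 \<le> s" "s \<le> c" "c \<le> t" "t \<le> T" for s c t
  proof -
    have "m t - m s - (t - s) *\<^sub>R m' c = (l t - l s - (t - s) *\<^sub>R l' c) o\<^sub>L \<iota>"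
      by (rule blinfun_eqI) (simp add: m_def m'_def blinfun.diff_left blinfun.scaleR_left)
    then have "norm (m t - m s - (t - s) *\<^sub>R m' c) \<le> norm (l t - l s - (t - s) *\<^sub>R l' c)"
      using norm_blinfun_compose_contraction[OF \<iota>] by simp
    also have "\<dots> \<le> (t - s) * (V t - V s)" by (rule linearization_bounded_variation[OF l' V that])
    finally show ?thesis .
  qed
  define M where "M = L / \<kappa>"
  have M: "0 \<le> M" "M \<le> 1" using L L1 \<kappa> by (auto simp: M_def)
  \<comment> \<open>All Euler iterates leave \<open>z0\<close> with speed at most \<open>M\<close>;
    the \<open>+ 1\<close> places them in an open ball.\<close>
  define r where "r = norm z0 + M * T + 1"
  have r: "r > 0" "norm z0 + L / \<kappa> * T < r"
    using mult_nonneg_nonneg[OF M(1) less_imp_le[OF T]]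
    unfolding r_def M_def[symmetric] by (auto intro!: add_nonneg_pos)
  define quad where "quad C \<longleftrightarrow> C \<ge> 0 \<and> (\<forall>z1\<in>ball 0 r. \<forall>z2\<in>ball 0 r. \<forall>v.
    (Deriv (Deriv F) z1 - Deriv (Deriv F) z2) v v \<le> C * norm (z1 - z2) * (norm v)\<^sup>2)" for C
  \<comment> \<open>\<open>C\<close> depends on \<open>F\<close> only, since the quadratic form of \<open>A\<close> cancels; this keeps \<open>K\<close> independent of \<open>A\<close>.\<close>
  define C where "C = (SOME C. quad C)"
  define b c where "b = a + norm (Deriv (Deriv F) 0) + 2 * C * r" and "c = 2 * C"
  \<comment> \<open>The absolute value is taken because \<open>C\<close> is known to be a valid
    constant only after an admissible \<open>A\<close> is given; it keeps the root
    nonnegative.\<close>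
  define G where "G = \<bar>euler_error_const \<kappa> L T (V T - V 0) r b c\<bar>"
  \<comment> \<open>The root is the error constant of the Euler interpolant, and 2 pays for the
    index shift, as \<open>M \<le> 1\<close>.\<close>
  define K where "K = sqrt (G / \<kappa>) + 2"
  have K: "K > 0" using \<kappa> by (auto simp: K_def G_def intro!: add_nonneg_pos)
  show ?thesis
  proof (intro exI[of _ K] conjI allI impI K; (elim conjE)?)
    fix j :: "'v \<Rightarrow>\<^sub>L 'x" and A R
    assume R: "dissipation_potential j R" and A: "elliptic_operator \<alpha> A" and a: "norm A = a"
      and conv: "uniformly_convex_energy T \<kappa> (energy \<iota> A F l)"
      and C21: "\<forall>t\<in>{0..T}. C21_loc (energy \<iota> A F l t)"
      and init: "subdiff_inclusion \<iota> R 0 (Deriv (energy \<iota> A F l 0) z0)"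
    define \<Phi> where "\<Phi> z = A z + Deriv F z" for z
    define S where "S v = R (\<iota> v)" for v
    define E where "E z = 1 / 2 * A z z + F z" for z
    define B where "B z = A + Deriv (Deriv F) z" for z
    obtain \<rho> where "convex_rate_independent E \<Phi> B S \<kappa> \<rho>"
      using energy_convex_rate_independent[OF F A T \<kappa> \<iota> conv R]
      unfolding E_def[abs_def] \<Phi>_def[abs_def] B_def[abs_def] S_def[abs_def] by blast
    then interpret convex_rate_independent E \<Phi> B S \<kappa> \<rho> .
    have D: "Deriv (energy \<iota> A F l t) z = \<Phi> z - m t" for t z
      by (simp add: Deriv_energy[OF F A] \<Phi>_def m_def)
    have incl: "subdiff_inclusion \<iota> R w \<xi> \<longleftrightarrow> incl w \<xi>" for w \<xi>
      by (simp add: subdiff_inclusion_def incl_def S_def)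
    have C21_0: "C21_loc (energy \<iota> A F l 0)" using C21 T by simp
    have reg: "\<exists>b c. regular_on_ball r b c" if "r > 0" for r
    proof -
      from second_derivative_quadratic_bound[OF F A C21_0 that] obtain C where C: "C \<ge> 0"
        "\<And>z1 z2 v. z1 \<in> ball 0 r \<Longrightarrow> z2 \<in> ball 0 r \<Longrightarrow>
          (Deriv (Deriv F) z1 - Deriv (Deriv F) z2) v v \<le> C * norm (z1 - z2) * (norm v)\<^sup>2" by blast
      have "regular_on_ball r (norm A + norm (Deriv (Deriv F) 0) + 2 * C * r) (2 * C)"
        unfolding regular_on_ball_def B_def
        using second_derivative_bounds[OF F A C] C(1) that by (intro conjI ballI) auto
      then show ?thesis by blast
    qed
    \<comment> \<open>With an admissible \<open>A\<close> at hand a suitable constant exists, which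
      justifies the choice of \<open>C\<close> made in advance.\<close>
    have "\<exists>C. quad C"
      using second_derivative_quadratic_bound[OF F A C21_0 r(1)] unfolding quad_def by metis
    then have "quad C" unfolding C_def by (rule someI_ex)
    then have C: "C \<ge> 0" "\<And>z1 z2 v. z1 \<in> ball 0 r \<Longrightarrow> z2 \<in> ball 0 r \<Longrightarrow>
        (Deriv (Deriv F) z1 - Deriv (Deriv F) z2) v v \<le> C * norm (z1 - z2) * (norm v)\<^sup>2"
      unfolding quad_def by blast+
    have bc: "regular_on_ball r b c"
      unfolding regular_on_ball_def B_def b_def c_def a[symmetric]
      using second_derivative_bounds[OF F A C] C(1) r by (intro conjI ballI) auto
    have stable: "(\<Phi> z0 - m 0) v + S v \<ge> 0" for v
      using init by (simp add: incl D incl_iff)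
    obtain z where z0: "z 0 = z0" and z: "solution_curve T m M ((b * M + L) * M) z"
      and err: "\<And>N t y \<tau> s. euler_scheme T m N t y \<Longrightarrow> y 0 = z0 \<Longrightarrow>
        (\<And>k. k < N \<Longrightarrow> t (Suc k) - t k \<le> \<tau>) \<Longrightarrow> s \<in> {0..T} \<Longrightarrow>
        \<kappa> * (norm (affine_interpolant N t y s - z s))\<^sup>2 \<le> euler_error_const \<kappa> L T (V T - V 0) r b c * \<tau>\<^sup>2"
      unfolding M_def
      by (rule euler_schemes_converge[OF T L _ _ bc r(2), where m=m and m'=m' and V=V])
        (assumption | rule stable | erule (2) m | erule (3) m' | metis that)+
    have b0: "b \<ge> 0" using bc by (simp add: regular_on_ball_def)
    have k: "0 \<le> (b * M + L) * M" using b0 M L by simp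
    obtain z' where z': "has_W11_derivative T z z'"
      "AE t in lebesgue_on {0..T}. incl (z' t) (\<Phi> (z t) - m t)"
      using solution_curve_differentiable[OF convex_rate_independent_axioms T z M(1) lipschitz_bound_continuous_on[OF L m]]
      by blast
    have sol: "differential_solution T \<iota> (energy \<iota> A F l) R z0 z"
      unfolding differential_solution_def incl D using z0 z' by blast
    have uniq: "w t = z t" if w: "differential_solution T \<iota> (energy \<iota> A F l) R z0 w" and t: "t \<in> {0..T}" for w t
    proof -
      obtain w' where "w 0 = z0" "has_W11_derivative T w w'"
        "AE t in lebesgue_on {0..T}. incl (w' t) (\<Phi> (w t) - m t)"
        using w unfolding differential_solution_def incl D by blast
      then show ?thesis using W11_solution_unique[OF T L m reg z M(1) k _ _ _ t] z0 by simp
    qed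
    have rate: "norm (retransformed T zs ts t - z t) \<le> K * \<tau>"
      if \<tau>: "\<tau> > 0" and sch: "local_incremental_scheme T \<iota> (energy \<iota> A F l) R z0 \<tau> zs ts" and t: "t \<in> {0..T}"
      for \<tau> zs ts t
    proof -
      have zs0: "zs 0 = z0" and ts0: "ts 0 = 0" using sch by (auto simp: local_incremental_scheme_def)
      have en: "energy \<iota> A F l s v = E v - m s v" for s v by (simp add: energy_def E_def m_def)
      have st: "is_arg_min (\<lambda>z. energy \<iota> A F l (ts k) z + R (\<iota> (z - zs k))) (\<lambda>z. norm (\<iota> (z - zs k)) \<le> \<tau>) (zs (Suc k))"
        "ts (Suc k) = min (ts k + \<tau> - norm (\<iota> (zs (Suc k) - zs k))) T" for k
        using sch[unfolded local_incremental_scheme_def, THEN conjunct2, THEN conjunct2, rule_format, of "Suc k"] by auto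
      have stable0: "(\<Phi> (zs 0) - m 0) v + S v \<ge> 0" for v using stable zs0 by simp
      have adm: "norm (\<iota> (zs (Suc k) - zs k)) \<le> \<tau>" for k using st(1)[of k] by (simp add: is_arg_min_linorder)
      have min: "E (zs (Suc k)) - m (ts k) (zs (Suc k)) + S (zs (Suc k) - zs k) \<le> E v - m (ts k) v + S (v - zs k)"
        if "norm (\<iota> (v - zs k)) \<le> \<tau>" for k v
        using st(1)[of k] that by (simp add: is_arg_min_linorder en S_def)
      define N where "N = num_steps T ts"
      have scheme: "euler_scheme T m N ts (\<lambda>k. zs (Suc k))" "zs (Suc 0) = zs 0"
        "\<And>k. norm (zs (Suc k) - zs k) \<le> L / \<kappa> * \<tau>" "\<And>k. ts (Suc k) - ts k \<le> \<tau>"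
        unfolding N_def by (rule local_scheme_euler[OF T \<tau> L L1 m \<iota> stable0 ts0 adm min st(2)], assumption+)+
      have "\<kappa> * (norm (affine_interpolant N ts (\<lambda>k. zs (Suc k)) t - z t))\<^sup>2 \<le>
          euler_error_const \<kappa> L T (V T - V 0) r b c * \<tau>\<^sup>2"
        by (rule err[OF scheme(1) _ _ t]) (use scheme zs0 in auto)
      also have "\<dots> \<le> G * \<tau>\<^sup>2" unfolding G_def by (intro mult_right_mono) auto
      finally have "(norm (affine_interpolant N ts (\<lambda>k. zs (Suc k)) t - z t))\<^sup>2 \<le> G / \<kappa> * \<tau>\<^sup>2"
        using \<kappa> by (simp add: field_simps)
      then have "norm (affine_interpolant N ts (\<lambda>k. zs (Suc k)) t - z t) \<le> sqrt (G / \<kappa> * \<tau>\<^sup>2)"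
        by (rule real_le_rsqrt)
      also have "\<dots> = sqrt (G / \<kappa>) * \<tau>" unfolding real_sqrt_mult[of "G / \<kappa>"] using \<tau> by simp
      finally have 1: "norm (affine_interpolant N ts (\<lambda>k. zs (Suc k)) t - z t) \<le> sqrt (G / \<kappa>) * \<tau>" .
      have "norm (retransformed T zs ts t - affine_interpolant N ts (\<lambda>k. zs (Suc k)) t) \<le> 2 * (M * \<tau>)"
        unfolding N_def
        by (rule retransformed_near_interpolant[OF _ T M(1) _ t]) (use scheme in \<open>auto simp: M_def N_def\<close>)
      also have "\<dots> \<le> 2 * \<tau>" using mult_right_mono[OF M(2) less_imp_le[OF \<tau>]] by simp
      finally show ?thesis
        using 1 norm_triangle_ineq[of "retransformed T zs ts t - affine_interpolant N ts (\<lambda>k. zs (Suc k)) t"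
            "affine_interpolant N ts (\<lambda>k. zs (Suc k)) t - z t"]
        by (simp add: K_def algebra_simps)
    qed
    have conv: "uniform_limit {0..T} (\<lambda>\<tau>. retransformed T (zs \<tau>) (ts \<tau>)) z (at_right 0)"
      if sch: "\<forall>\<tau>>0. local_incremental_scheme T \<iota> (energy \<iota> A F l) R z0 \<tau> (zs \<tau>) (ts \<tau>)" for zs ts
    proof (rule uniform_limitI)
      fix e :: real assume e: "e > 0"
      show "\<forall>\<^sub>F \<tau> in at_right 0. \<forall>t\<in>{0..T}. dist (retransformed T (zs \<tau>) (ts \<tau>) t) (z t) < e"
        unfolding eventually_at_right[OF zero_less_one]
      proof (intro exI[of _ "e / K"] conjI allI impI ballI)
        show "0 < e / K" using e K by simp
        fix \<tau> t assume \<tau>: "0 < \<tau>" "\<tau> < e / K" and t: "t \<in> {0..T}"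
        have "norm (retransformed T (zs \<tau>) (ts \<tau>) t - z t) \<le> K * \<tau>" using rate[OF \<tau>(1) _ t] sch \<tau>(1) by blast
        also have "\<dots> < e" using \<tau>(2) K by (simp add: field_simps)
        finally show "dist (retransformed T (zs \<tau>) (ts \<tau>) t) (z t) < e" by (simp add: dist_norm)
      qed
    qed
    show "\<exists>z. differential_solution T \<iota> (energy \<iota> A F l) R z0 z \<and>
        (\<forall>w. differential_solution T \<iota> (energy \<iota> A F l) R z0 w \<longrightarrow> (\<forall>t\<in>{0..T}. w t = z t)) \<and>
        (\<forall>zs ts. (\<forall>\<tau>>0. local_incremental_scheme T \<iota> (energy \<iota> A F l) R z0 \<tau> (zs \<tau>) (ts \<tau>)) \<longrightarrow>
           uniform_limit {0..T} (\<lambda>\<tau>. retransformed T (zs \<tau>) (ts \<tau>)) z (at_right 0)) \<and>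
        (\<forall>\<tau>>0. \<forall>zs ts. local_incremental_scheme T \<iota> (energy \<iota> A F l) R z0 \<tau> zs ts \<longrightarrow>
           (\<forall>t\<in>{0..T}. norm (retransformed T zs ts t - z t) \<le> K * \<tau>))"
    proof (intro exI[of _ z] conjI allI impI ballI)
      show "differential_solution T \<iota> (energy \<iota> A F l) R z0 z" by (rule sol)
    qed (fact uniq, fact conv, fact rate)
  qed
qed

end
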